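(* Every $\omega$-categorical NTP$_2$ ring is nilpotent-by-finite, i.e. it has a nilpotent two-sided ideal of finite index.
   Context: Rings are associative, and are not assumed to be commutative or to have a unit. An $\omega$-categorical ring is a ring, considered as a first-order structure (possibly with additional structure, in a countable language), whose complete theory has exactly one countable model up to isomorphism. A ring (or ideal) $J$ is nilpotent if there is $n\ge1$ such that every product of $n$ elements of $J$ is $0$. A complete theory has TP$_2$ if there are a formula $\varphi(\bar x,\bar y)$, some $k<\omega$ and an array $\langle\bar a_{i,j}:i,j<\omega\rangle$ of parameters in a monster model such that for each $i$ the set $\{\varphi(\bar x,\bar a_{i,j}):j<\omega\}$ is $k$-inconsistent, while for each $\eta:\omega\to\omega$ the set $\{\varphi(\bar x,\bar a_{i,\eta(i)}):i<\omega\}$ is consistent. The theory is NTP$_2$ if it does not have TP$_2$; a structure is NTP$_2$ if its complete theory is. *)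

theory Defs
  imports "HOL-Algebra.AbelCoset" "HOL-Library.Countable_Set"
begin

section \<open>First-order logic\<close>

text \<open>
  A language is a set of function symbols and a set of relation symbols, each symbol being paired
  with its arity (constants are function symbols of arity 0).
\<close>

record ('f, 'r) language =
  Funs :: "('f \<times> nat) set"
  Rels :: "('r \<times> nat) set"

definition countable_language :: "('f, 'r) language \<Rightarrow> bool" where
  "countable_language L \<longleftrightarrow> countable (Funs L) \<and> countable (Rels L)"

datatype 'f tm = Var nat | Fun 'f "'f tm list"

datatype ('f, 'r) fm =
    Eq "'f tm" "'f tm"
  | Rel 'r "'f tm list"
  | Neg "('f, 'r) fm"
  | And "('f, 'r) fm" "('f, 'r) fm"
  | Ex nat "('f, 'r) fm"

fun term_of :: "('f, 'r) language \<Rightarrow> 'f tm \<Rightarrow> bool" where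
  "term_of L (Var v) = True"
| "term_of L (Fun f ts) = ((f, length ts) \<in> Funs L \<and> (\<forall>t\<in>set ts. term_of L t))"

fun formula_of :: "('f, 'r) language \<Rightarrow> ('f, 'r) fm \<Rightarrow> bool" where
  "formula_of L (Eq s t) = (term_of L s \<and> term_of L t)"
| "formula_of L (Rel r ts) = ((r, length ts) \<in> Rels L \<and> (\<forall>t\<in>set ts. term_of L t))"
| "formula_of L (Neg \<phi>) = formula_of L \<phi>"
| "formula_of L (And \<phi> \<psi>) = (formula_of L \<phi> \<and> formula_of L \<psi>)"
| "formula_of L (Ex v \<phi>) = formula_of L \<phi>"

fun tvars :: "'f tm \<Rightarrow> nat set" where
  "tvars (Var v) = {v}"
| "tvars (Fun f ts) = (\<Union>t\<in>set ts. tvars t)"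

fun fvars :: "('f, 'r) fm \<Rightarrow> nat set" where
  "fvars (Eq s t) = tvars s \<union> tvars t"
| "fvars (Rel r ts) = (\<Union>t\<in>set ts. tvars t)"
| "fvars (Neg \<phi>) = fvars \<phi>"
| "fvars (And \<phi> \<psi>) = fvars \<phi> \<union> fvars \<psi>"
| "fvars (Ex v \<phi>) = fvars \<phi> - {v}"

definition sentence_of :: "('f, 'r) language \<Rightarrow> ('f, 'r) fm \<Rightarrow> bool" where
  "sentence_of L \<phi> \<longleftrightarrow> formula_of L \<phi> \<and> fvars \<phi> = {}"

text \<open>
  Structures have a carrier set. Only the values of the symbols of the language on tuples of the
  right length from the carrier are relevant.
\<close>

record ('a, 'f, 'r) fo_structure =
  Dom :: "'a set"
  Fn :: "'f \<Rightarrow> 'a list \<Rightarrow> 'a"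
  Rl :: "'r \<Rightarrow> 'a list \<Rightarrow> bool"

definition tuples :: "('a, 'f, 'r) fo_structure \<Rightarrow> nat \<Rightarrow> 'a list set" where
  "tuples M n = {xs. length xs = n \<and> set xs \<subseteq> Dom M}"

definition structure_for :: "('f, 'r) language \<Rightarrow> ('a, 'f, 'r) fo_structure \<Rightarrow> bool" where
  "structure_for L M \<longleftrightarrow> Dom M \<noteq> {} \<and>
     (\<forall>(f, n)\<in>Funs L. \<forall>xs\<in>tuples M n. Fn M f xs \<in> Dom M)"

fun tval :: "('a, 'f, 'r) fo_structure \<Rightarrow> (nat \<Rightarrow> 'a) \<Rightarrow> 'f tm \<Rightarrow> 'a" where
  "tval M \<sigma> (Var v) = \<sigma> v"
| "tval M \<sigma> (Fun f ts) = Fn M f (map (tval M \<sigma>) ts)"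

fun sat :: "('a, 'f, 'r) fo_structure \<Rightarrow> (nat \<Rightarrow> 'a) \<Rightarrow> ('f, 'r) fm \<Rightarrow> bool" where
  "sat M \<sigma> (Eq s t) = (tval M \<sigma> s = tval M \<sigma> t)"
| "sat M \<sigma> (Rel r ts) = Rl M r (map (tval M \<sigma>) ts)"
| "sat M \<sigma> (Neg \<phi>) = (\<not> sat M \<sigma> \<phi>)"
| "sat M \<sigma> (And \<phi> \<psi>) = (sat M \<sigma> \<phi> \<and> sat M \<sigma> \<psi>)"
| "sat M \<sigma> (Ex v \<phi>) = (\<exists>d\<in>Dom M. sat M (\<sigma>(v := d)) \<phi>)"

text \<open>
  Evaluation of a formula at a tuple, the \<open>i\<close>-th entry being the value of the variable \<open>i\<close>. It is
  only used when the free variables of the formula are among the first \<open>length xs\<close> ones.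
\<close>

definition holds_at :: "('a, 'f, 'r) fo_structure \<Rightarrow> ('f, 'r) fm \<Rightarrow> 'a list \<Rightarrow> bool" where
  "holds_at M \<phi> xs \<longleftrightarrow> sat M (\<lambda>i. xs ! i) \<phi>"

definition complete_theory ::
    "('f, 'r) language \<Rightarrow> ('a, 'f, 'r) fo_structure \<Rightarrow> ('f, 'r) fm set" where
  "complete_theory L M = {\<phi>. sentence_of L \<phi> \<and> holds_at M \<phi> []}"

definition model_of ::
    "('f, 'r) language \<Rightarrow> ('f, 'r) fm set \<Rightarrow> ('a, 'f, 'r) fo_structure \<Rightarrow> bool" where
  "model_of L T M \<longleftrightarrow> structure_for L M \<and> (\<forall>\<phi>\<in>T. holds_at M \<phi> [])"

definition isomorphic ::
    "('f, 'r) language \<Rightarrow> ('a, 'f, 'r) fo_structure \<Rightarrow> ('b, 'f, 'r) fo_structure \<Rightarrow> bool" where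
  "isomorphic L M N \<longleftrightarrow> (\<exists>h. bij_betw h (Dom M) (Dom N) \<and>
     (\<forall>(f, n)\<in>Funs L. \<forall>xs\<in>tuples M n. h (Fn M f xs) = Fn N f (map h xs)) \<and>
     (\<forall>(r, n)\<in>Rels L. \<forall>xs\<in>tuples M n. Rl M r xs \<longleftrightarrow> Rl N r (map h xs)))"

text \<open>
  Exactly one countable model up to isomorphism. Every countable structure is isomorphic to one
  whose carrier is a set of natural numbers, and it is such copies that are quantified over. Finite
  models count as countable, so that the theory of a finite structure satisfies the definition.
\<close>

definition omega_categorical_theory :: "('f, 'r) language \<Rightarrow> ('f, 'r) fm set \<Rightarrow> bool" where
  "omega_categorical_theory L T \<longleftrightarrow>
     (\<exists>N :: (nat, 'f, 'r) fo_structure. model_of L T N \<and>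
        (\<forall>N' :: (nat, 'f, 'r) fo_structure. model_of L T N' \<longrightarrow> isomorphic L N N'))"

definition omega_categorical ::
    "('f, 'r) language \<Rightarrow> ('a, 'f, 'r) fo_structure \<Rightarrow> bool" where
  "omega_categorical L M \<longleftrightarrow> omega_categorical_theory L (complete_theory L M)"


section \<open>The tree property of the second kind\<close>

text \<open>
  Saturation over countable parameter sets. A partial type in one variable is a set of pairs
  \<open>(\<phi>, as)\<close> standing for the formulas \<open>\<phi>(x, as)\<close>; here \<open>x\<close> is the variable 0 and the parameters
  \<open>as\<close> are substituted for the variables 1, ..., \<open>length as\<close>.
\<close>

definition aleph1_saturated ::
    "('f, 'r) language \<Rightarrow> ('a, 'f, 'r) fo_structure \<Rightarrow> bool" where
  "aleph1_saturated L M \<longleftrightarrow>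
     (\<forall>A p. A \<subseteq> Dom M \<and> countable A \<and>
        p \<subseteq> {(\<phi>, as). formula_of L \<phi> \<and> set as \<subseteq> A \<and> fvars \<phi> \<subseteq> {..<Suc (length as)}} \<and>
        (\<forall>q. finite q \<and> q \<subseteq> p \<longrightarrow> (\<exists>b\<in>Dom M. \<forall>(\<phi>, as)\<in>q. holds_at M \<phi> (b # as))) \<longrightarrow>
        (\<exists>b\<in>Dom M. \<forall>(\<phi>, as)\<in>p. holds_at M \<phi> (b # as)))"

text \<open>
  For theories in a countable language, \<open>\<aleph>\<^sub>1\<close>-saturation is all that is needed of a monster model
  in order to speak about countable families of formulas with parameters. The type \<open>nat set\<close> of
  the elements is large enough: a theory in a countable language that has a model has an
  \<open>\<aleph>\<^sub>1\<close>-saturated model of cardinality at most the continuum (for example an ultrapower of a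
  countable model over a nonprincipal ultrafilter on the natural numbers).
\<close>

definition monster_model ::
    "('f, 'r) language \<Rightarrow> ('f, 'r) fm set \<Rightarrow> (nat set, 'f, 'r) fo_structure \<Rightarrow> bool" where
  "monster_model L T M \<longleftrightarrow> model_of L T M \<and> aleph1_saturated L M"

text \<open>
  Consistency of \<open>{\<phi>(x, c i) | i \<in> I}\<close> for a countable index set \<open>I\<close> and an \<open>m\<close>-tuple \<open>x\<close> of
  variables: by saturation, this means that the set is realized in the monster model.
\<close>

definition consistent_family ::
    "('a, 'f, 'r) fo_structure \<Rightarrow> nat \<Rightarrow> ('f, 'r) fm \<Rightarrow> (nat \<Rightarrow> 'a list) \<Rightarrow> nat set \<Rightarrow> bool" where
  "consistent_family M m \<phi> c I \<longleftrightarrow> (\<exists>b\<in>tuples M m. \<forall>i\<in>I. holds_at M \<phi> (b @ c i))"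

text \<open>
  As usual, \<open>k\<close>-inconsistency is about indexed families: the formulas belonging to any \<open>k\<close> distinct
  indices are jointly inconsistent (even if parameters are repeated).
\<close>

definition k_inconsistent_family ::
    "('a, 'f, 'r) fo_structure \<Rightarrow> nat \<Rightarrow> ('f, 'r) fm \<Rightarrow> nat \<Rightarrow> (nat \<Rightarrow> 'a list) \<Rightarrow> bool" where
  "k_inconsistent_family M m \<phi> k c \<longleftrightarrow>
     (\<forall>J. finite J \<and> card J = k \<longrightarrow> \<not> consistent_family M m \<phi> c J)"

definition has_TP2 :: "('f, 'r) language \<Rightarrow> ('f, 'r) fm set \<Rightarrow> bool" where
  "has_TP2 L T \<longleftrightarrow>
     (\<exists>(M :: (nat set, 'f, 'r) fo_structure) \<phi> m n k a.
        monster_model L T M \<and>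
        formula_of L \<phi> \<and> fvars \<phi> \<subseteq> {..<m + n} \<and>
        (\<forall>i j. a i j \<in> tuples M n) \<and>
        (\<forall>i. k_inconsistent_family M m \<phi> k (\<lambda>j. a i j)) \<and>
        (\<forall>\<eta> :: nat \<Rightarrow> nat. consistent_family M m \<phi> (\<lambda>i. a i (\<eta> i)) UNIV))"

definition NTP2 :: "('f, 'r) language \<Rightarrow> ('a, 'f, 'r) fo_structure \<Rightarrow> bool" where
  "NTP2 L M \<longleftrightarrow> \<not> has_TP2 L (complete_theory L M)"


section \<open>Rings without unit\<close>

text \<open>
  The locale \<open>ring\<close> of the library requires a unit. The field \<^term>\<open>one\<close> of the ring record plays
  no role in what follows.
\<close>

locale rng = abelian_group R for R (structure) +
  assumes m_closed: "\<lbrakk>x \<in> carrier R; y \<in> carrier R\<rbrakk> \<Longrightarrow> x \<otimes> y \<in> carrier R"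
    and m_assoc: "\<lbrakk>x \<in> carrier R; y \<in> carrier R; z \<in> carrier R\<rbrakk>
      \<Longrightarrow> (x \<otimes> y) \<otimes> z = x \<otimes> (y \<otimes> z)"
    and l_distr: "\<lbrakk>x \<in> carrier R; y \<in> carrier R; z \<in> carrier R\<rbrakk>
      \<Longrightarrow> (x \<oplus> y) \<otimes> z = x \<otimes> z \<oplus> y \<otimes> z"
    and r_distr: "\<lbrakk>x \<in> carrier R; y \<in> carrier R; z \<in> carrier R\<rbrakk>
      \<Longrightarrow> z \<otimes> (x \<oplus> y) = z \<otimes> x \<oplus> z \<otimes> y"

definition two_sided_ideal :: "('a, 'm) ring_scheme \<Rightarrow> 'a set \<Rightarrow> bool" where
  "two_sided_ideal R J \<longleftrightarrow> additive_subgroup J R \<and>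
     (\<forall>a\<in>J. \<forall>x\<in>carrier R. x \<otimes>\<^bsub>R\<^esub> a \<in> J \<and> a \<otimes>\<^bsub>R\<^esub> x \<in> J)"

definition nilpotent_subset :: "('a, 'm) ring_scheme \<Rightarrow> 'a set \<Rightarrow> bool" where
  "nilpotent_subset R J \<longleftrightarrow> (\<exists>n\<ge>1. \<forall>xs. length xs = n \<and> set xs \<subseteq> J \<longrightarrow>
     foldl (\<otimes>\<^bsub>R\<^esub>) (hd xs) (tl xs) = \<zero>\<^bsub>R\<^esub>)"

definition nilpotent_by_finite :: "('a, 'm) ring_scheme \<Rightarrow> bool" where
  "nilpotent_by_finite R \<longleftrightarrow>
     (\<exists>J. two_sided_ideal R J \<and> nilpotent_subset R J \<and> finite (a_rcosets\<^bsub>R\<^esub> J))"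


section \<open>Rings as first-order structures\<close>

datatype 'f ring_sym = Zero | Plus | Minus | Times | Extra 'f

definition ring_symbols :: "('f ring_sym \<times> nat) set" where
  "ring_symbols = {(Zero, 0), (Plus, 2), (Minus, 1), (Times, 2)}"

definition ring_reduct :: "('a, 'f ring_sym, 'r) fo_structure \<Rightarrow> 'a ring" where
  "ring_reduct M =
     \<lparr>carrier = Dom M, mult = (\<lambda>x y. Fn M Times [x, y]), one = undefined,
      zero = Fn M Zero [], add = (\<lambda>x y. Fn M Plus [x, y])\<rparr>"

text \<open>
  A ring, possibly with additional structure: the language may have further function symbols and
  arbitrary relation symbols.
\<close>

definition ring_structure ::
    "('f ring_sym, 'r) language \<Rightarrow> ('a, 'f ring_sym, 'r) fo_structure \<Rightarrow> bool" where
  "ring_structure L M \<longleftrightarrow> ring_symbols \<subseteq> Funs L \<and> structure_for L M \<and>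
     rng (ring_reduct M) \<and>
     (\<forall>x\<in>Dom M. Fn M Minus [x] = \<ominus>\<^bsub>ring_reduct M\<^esub> x)"

end

theory Submission
  imports Defs "HOL-Library.Nat_Bijection" "HOL-Algebra.Multiplicative_Group"
    "HOL-Algebra.Polynomial_Divisibility"
begin

text \<open>
  The proof has a model-theoretic and an algebraic half. They meet in one finite combinatorial
  object, the separating array: elements \<open>u i\<close>, \<open>v i\<close> and \<open>x i j\<close> such that the additive map
  \<open>z \<mapsto> u i z v i\<close> separates the elements \<open>x i j\<close> of its own row and kills those of the other rows.

  The first half extracts what is needed of the two model-theoretic hypotheses. By additivity, the
  value of \<open>u i z v i\<close> at a sum of elements from different rows depends on the summand from row \<open>i\<close>
  only. Hence arbitrarily large separating arrays modulo a definable ideal \<open>Q\<close> produce the tree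
  property for the formula \<open>u z v - b \<in> Q\<close>, so that in an NTP$_2$ ring their size is bounded
  (\<open>bounded_arrays\<close>). Categoricity gives the theorem of Ryll-Nardzewski
  (\<open>finitely_many_formulas\<close>): a type that is not isolated would be realized in one countable model
  and omitted in another. It follows that there are only finitely many parameter-free definable
  sets (\<open>finite_definable\<close>) and that two different powers agree on the whole ring
  (\<open>power_identity\<close>). All the models that are needed are found inside an ultrapower of the countable
  model, which is also the monster model in which the tree property is exhibited.

  The second half is algebra about rings without large separating arrays. First, in such a ring the
  sum \<open>N\<close> of all ideals of square zero is nilpotent (\<open>additive_span_square_zero_nilpotent\<close>). Indeed,
  given ideals \<open>T 0, T 1, \<dots>\<close> of square zero, elements \<open>u\<close> of the ideals before \<open>T i\<close> and \<open>v\<close> of the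
  ideals after it satisfy \<open>u (T l) v = 0\<close> for \<open>l \<noteq> i\<close>. As \<open>u\<close> and \<open>v\<close> can be chosen for each \<open>i\<close>
  independently, the bound on arrays yields some \<open>i\<close> such that the size of \<open>u (T i) v\<close> is bounded for
  all these \<open>u\<close> and \<open>v\<close> together. A lemma of Neumann about families of homomorphisms with small
  images (\<open>neumann_lemma\<close>), and the fact that the nil ring \<open>N\<close> acts nilpotently on finite modules
  (\<open>nil_action\<close>), turn this into the vanishing of a product of the ideals with powers of \<open>N\<close> in
  between.

  Secondly, a semiprime ring without large separating arrays in which a fixed power of every element
  is idempotent is finite (\<open>finite_carrier\<close>). By an argument of Levitzki, every nonzero right ideal
  contains a nonzero idempotent. Orthogonal families of idempotents are bounded, because grouping
  such a family into blocks gives a separating array. A maximal family adds up to a unit, its members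
  are primitive, and their corner rings are division rings of bounded exponent, which are finite
  (\<open>ring.finite_if_bounded_exponent\<close>).

  To conclude, take a maximal one, \<open>Q\<close>, among the finitely many definable nilpotent ideals. By the
  first statement the ideals of square zero of the quotient by \<open>Q\<close> generate a nilpotent ideal, whose
  preimage is again definable and nilpotent and hence equal to \<open>Q\<close>. So the quotient is semiprime, and
  by the second statement it is finite.
\<close>

section \<open>Formulas, renaming and elementary equivalence\<close>

lemma tval_cong: "(\<And>v. v \<in> tvars t \<Longrightarrow> \<sigma> v = \<tau> v) \<Longrightarrow> tval M \<sigma> t = tval M \<tau> t"
proof (induction t)
  case (Fun f ts)
  have "map (tval M \<sigma>) ts = map (tval M \<tau>) ts"
    using Fun by (intro map_cong) auto
  then show ?case by (simp only: tval.simps)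
qed auto

lemma sat_cong: "(\<And>v. v \<in> fvars \<phi> \<Longrightarrow> \<sigma> v = \<tau> v) \<Longrightarrow> sat M \<sigma> \<phi> = sat M \<tau> \<phi>"
proof (induction \<phi> arbitrary: \<sigma> \<tau>)
  case (Eq s t)
  then show ?case using tval_cong[of s \<sigma> \<tau> M] tval_cong[of t \<sigma> \<tau> M] by simp
next
  case (Rel r ts)
  then have "map (tval M \<sigma>) ts = map (tval M \<tau>) ts"
    by (intro map_cong tval_cong) auto
  then show ?case by (simp only: sat.simps)
next
  case (Neg \<phi>)
  then show ?case by (metis fvars.simps(3) sat.simps(3))
next
  case (And \<phi> \<psi>)
  then show ?case by (metis UnCI fvars.simps(4) sat.simps(4))
next
  case (Ex v \<phi>)
  have "sat M (\<sigma>(v := d)) \<phi> = sat M (\<tau>(v := d)) \<phi>" for d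
    by (rule Ex.IH) (use Ex.prems in auto)
  then show ?case by simp
qed

lemma finite_tvars [simp]: "finite (tvars t)"
  by (induction t) auto

lemma finite_fvars [simp]: "finite (fvars \<phi>)"
  by (induction \<phi>) auto

lemma Fn_in_Dom:
  "structure_for L M \<Longrightarrow> (f, n) \<in> Funs L \<Longrightarrow> xs \<in> tuples M n \<Longrightarrow> Fn M f xs \<in> Dom M"
  by (auto simp: structure_for_def)

lemma tval_in_Dom:
  assumes "structure_for L M" "\<And>v. \<sigma> v \<in> Dom M" "term_of L t"
  shows "tval M \<sigma> t \<in> Dom M"
  using assms(3)
proof (induction t)
  case (Fun f ts)
  then have "map (tval M \<sigma>) ts \<in> tuples M (length ts)" by (auto simp: tuples_def)
  then have "Fn M f (map (tval M \<sigma>) ts) \<in> Dom M"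
    using Fun.prems by (intro Fn_in_Dom[OF assms(1)]) auto
  then show ?case by simp
qed (use assms in auto)

fun ren_tm :: "(nat \<Rightarrow> nat) \<Rightarrow> 'f tm \<Rightarrow> 'f tm" where
  "ren_tm g (Var v) = Var (g v)"
| "ren_tm g (Fun f ts) = Fun f (map (ren_tm g) ts)"

text \<open>
  Renaming of the free variables. A bound variable is replaced by one that is larger than
  everything it could clash with, so that nothing is captured, whatever the map \<open>g\<close> is.
\<close>

fun ren :: "(nat \<Rightarrow> nat) \<Rightarrow> ('f, 'r) fm \<Rightarrow> ('f, 'r) fm" where
  "ren g (Eq s t) = Eq (ren_tm g s) (ren_tm g t)"
| "ren g (Rel r ts) = Rel r (map (ren_tm g) ts)"
| "ren g (Neg \<phi>) = Neg (ren g \<phi>)"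
| "ren g (And \<phi> \<psi>) = And (ren g \<phi>) (ren g \<psi>)"
| "ren g (Ex v \<phi>) =
     (let z = Suc (Max (insert 0 (g ` fvars \<phi>))) in Ex z (ren (g(v := z)) \<phi>))"

lemma tval_ren: "tval M \<sigma> (ren_tm g t) = tval M (\<sigma> \<circ> g) t"
proof (induction t)
  case (Fun f ts)
  then have "map (tval M \<sigma> \<circ> ren_tm g) ts = map (tval M (\<sigma> \<circ> g)) ts"
    unfolding map_eq_conv comp_apply by blast
  then show ?case by (simp only: ren_tm.simps tval.simps map_map)
qed auto

lemma sat_ren: "sat M \<sigma> (ren g \<phi>) = sat M (\<sigma> \<circ> g) \<phi>"
proof (induction \<phi> arbitrary: \<sigma> g)
  case (Rel r ts)
  have "map (tval M \<sigma> \<circ> ren_tm g) ts = map (tval M (\<sigma> \<circ> g)) ts"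
    by (intro map_cong) (auto simp: tval_ren)
  then show ?case by (simp only: ren.simps sat.simps map_map)
next
  case (Ex v \<phi>)
  define z where "z = Suc (Max (insert 0 (g ` fvars \<phi>)))"
  have z: "g u < z" if "u \<in> fvars \<phi>" for u
    using that by (simp add: z_def less_Suc_eq_le)
  have "sat M (\<sigma>(z := d)) (ren (g(v := z)) \<phi>) = sat M ((\<sigma> \<circ> g)(v := d)) \<phi>" for d
    unfolding Ex.IH by (rule sat_cong) (use z in fastforce)
  then show ?case unfolding ren.simps Let_def z_def[symmetric] sat.simps by blast
qed (auto simp: tval_ren)

lemma term_of_ren [simp]: "term_of L (ren_tm g t) = term_of L t"
  by (induction t) auto

lemma formula_of_ren [simp]: "formula_of L (ren g \<phi>) = formula_of L \<phi>"
  by (induction \<phi> arbitrary: g) (auto simp: Let_def)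

lemma tvars_ren: "tvars (ren_tm g t) = g ` tvars t"
  by (induction t) auto

lemma fvars_ren: "fvars (ren g \<phi>) \<subseteq> g ` fvars \<phi>"
proof (induction \<phi> arbitrary: g)
  case (Ex v \<phi>)
  define z where "z = Suc (Max (insert 0 (g ` fvars \<phi>)))"
  have "fvars (ren (g(v := z)) \<phi>) - {z} \<subseteq> g ` (fvars \<phi> - {v})"
  proof
    fix x assume "x \<in> fvars (ren (g(v := z)) \<phi>) - {z}"
    then obtain u where "u \<in> fvars \<phi>" "x = (g(v := z)) u" "x \<noteq> z"
      using Ex[of "g(v := z)"] by blast
    then show "x \<in> g ` (fvars \<phi> - {v})" by (cases "u = v") auto
  qed
  then show ?case by (simp add: z_def[symmetric])
qed (fastforce simp: tvars_ren)+

definition Conj :: "('f, 'r) fm list \<Rightarrow> ('f, 'r) fm" where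
  "Conj \<phi>s = foldr And \<phi>s (Eq (Var 0) (Var 0))"

lemma sat_Conj [simp]: "sat M \<sigma> (Conj \<phi>s) \<longleftrightarrow> (\<forall>\<phi>\<in>set \<phi>s. sat M \<sigma> \<phi>)"
  unfolding Conj_def by (induction \<phi>s) auto

lemma formula_of_Conj [simp]: "formula_of L (Conj \<phi>s) \<longleftrightarrow> (\<forall>\<phi>\<in>set \<phi>s. formula_of L \<phi>)"
  unfolding Conj_def by (induction \<phi>s) auto

lemma sat_foldr_Ex:
  "sat M \<sigma> (foldr Ex vs \<phi>) \<longleftrightarrow>
    (\<exists>\<tau>. (\<forall>v\<in>set vs. \<tau> v \<in> Dom M) \<and> (\<forall>v. v \<notin> set vs \<longrightarrow> \<tau> v = \<sigma> v) \<and> sat M \<tau> \<phi>)"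
proof (induction vs arbitrary: \<sigma>)
  case Nil
  have "(\<forall>v. \<tau> v = \<sigma> v) \<longleftrightarrow> \<tau> = \<sigma>" for \<tau> :: "nat \<Rightarrow> 'a" by auto
  then show ?case by simp
next
  case (Cons v vs)
  show ?case (is "?l = ?r")
  proof
    assume ?l
    then obtain d \<tau> where d: "d \<in> Dom M" "\<forall>v\<in>set vs. \<tau> v \<in> Dom M"
      "\<forall>w. w \<notin> set vs \<longrightarrow> \<tau> w = (\<sigma>(v := d)) w" "sat M \<tau> \<phi>"
      by (auto simp: Cons.IH)
    then have "\<tau> v \<in> Dom M" by (cases "v \<in> set vs") auto
    then show ?r using d by (intro exI[of _ \<tau>]) auto
  next
    assume ?r
    then obtain \<tau> where \<tau>: "\<forall>w\<in>set (v # vs). \<tau> w \<in> Dom M"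
      "\<forall>w. w \<notin> set (v # vs) \<longrightarrow> \<tau> w = \<sigma> w" "sat M \<tau> \<phi>" by blast
    then have "sat M (\<sigma>(v := \<tau> v)) (foldr Ex vs \<phi>)"
      unfolding Cons.IH by (intro exI[of _ \<tau>]) auto
    then show ?l using \<tau> by auto
  qed
qed

lemma formula_of_foldr_Ex [simp]: "formula_of L (foldr Ex vs \<phi>) = formula_of L \<phi>"
  by (induction vs) auto

lemma fvars_foldr_Ex [simp]: "fvars (foldr Ex vs \<phi>) = fvars \<phi> - set vs"
  by (induction vs) auto

definition satisfiable :: "('a, 'f, 'r) fo_structure \<Rightarrow> ('f, 'r) fm set \<Rightarrow> bool" where
  "satisfiable M \<Gamma> \<longleftrightarrow> (\<exists>\<sigma>. (\<forall>v. \<sigma> v \<in> Dom M) \<and> (\<forall>\<phi>\<in>\<Gamma>. sat M \<sigma> \<phi>))"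

definition elem_equiv ::
    "('f, 'r) language \<Rightarrow> ('a, 'f, 'r) fo_structure \<Rightarrow> ('b, 'f, 'r) fo_structure \<Rightarrow> bool" where
  "elem_equiv L M N \<longleftrightarrow> structure_for L M \<and> structure_for L N \<and>
     (\<forall>\<phi>. sentence_of L \<phi> \<longrightarrow> holds_at M \<phi> [] = holds_at N \<phi> [])"

lemma elem_equiv_sym: "elem_equiv L M N \<Longrightarrow> elem_equiv L N M"
  by (auto simp: elem_equiv_def)

lemma elem_equiv_trans: "elem_equiv L M N \<Longrightarrow> elem_equiv L N K \<Longrightarrow> elem_equiv L M K"
  by (auto simp: elem_equiv_def)

lemma model_of_complete_theory_iff:
  assumes "structure_for L M"
  shows "model_of L (complete_theory L M) N \<longleftrightarrow> elem_equiv L M N"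
proof
  assume N: "model_of L (complete_theory L M) N"
  have "holds_at M \<phi> [] = holds_at N \<phi> []" if "sentence_of L \<phi>" for \<phi>
  proof (cases "holds_at M \<phi> []")
    case True
    then show ?thesis using N that by (auto simp: model_of_def complete_theory_def)
  next
    case False
    then have "Neg \<phi> \<in> complete_theory L M"
      using that by (auto simp: complete_theory_def sentence_of_def holds_at_def)
    then show ?thesis using N False by (auto simp: model_of_def holds_at_def)
  qed
  then show "elem_equiv L M N" using N assms by (auto simp: elem_equiv_def model_of_def)
qed (auto simp: elem_equiv_def model_of_def complete_theory_def)

lemma holds_at_closure:
  assumes "Dom M \<noteq> {}" "fvars \<phi> \<subseteq> set vs"
  shows "holds_at M (foldr Ex vs \<phi>) [] \<longleftrightarrow> satisfiable M {\<phi>}"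
proof
  assume "holds_at M (foldr Ex vs \<phi>) []"
  then obtain \<tau> where \<tau>: "\<forall>v\<in>set vs. \<tau> v \<in> Dom M" "sat M \<tau> \<phi>"
    by (auto simp: holds_at_def sat_foldr_Ex)
  obtain d where d: "d \<in> Dom M" using assms(1) by auto
  have "sat M (\<lambda>v. if v \<in> set vs then \<tau> v else d) \<phi> = sat M \<tau> \<phi>"
    by (rule sat_cong) (use assms(2) in auto)
  then show "satisfiable M {\<phi>}" unfolding satisfiable_def
    using \<tau> d by (intro exI[of _ "\<lambda>v. if v \<in> set vs then \<tau> v else d"]) auto
next
  assume "satisfiable M {\<phi>}"
  then obtain \<tau> where \<tau>: "\<forall>v. \<tau> v \<in> Dom M" "sat M \<tau> \<phi>" by (auto simp: satisfiable_def)
  have "sat M (\<lambda>v. if v \<in> set vs then \<tau> v else [] ! v) \<phi> = sat M \<tau> \<phi>"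
    by (rule sat_cong) (use assms(2) in auto)
  then show "holds_at M (foldr Ex vs \<phi>) []"
    using \<tau> by (auto simp: holds_at_def sat_foldr_Ex intro!: exI[of _ "\<lambda>v. if v \<in> set vs then \<tau> v else [] ! v"])
qed

lemma satisfiable_transfer:
  assumes "elem_equiv L M N" "finite \<Gamma>" "\<And>\<phi>. \<phi> \<in> \<Gamma> \<Longrightarrow> formula_of L \<phi>" "satisfiable M \<Gamma>"
  shows "satisfiable N \<Gamma>"
proof -
  obtain \<phi>s where \<phi>s: "set \<phi>s = \<Gamma>" using finite_list[OF assms(2)] by auto
  obtain vs where vs: "set vs = fvars (Conj \<phi>s)" using finite_list[OF finite_fvars] by metis
  have eq: "satisfiable M {Conj \<phi>s} = satisfiable M \<Gamma>" "satisfiable N {Conj \<phi>s} = satisfiable N \<Gamma>"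
    using \<phi>s by (auto simp: satisfiable_def)
  have "sentence_of L (foldr Ex vs (Conj \<phi>s))"
    using assms(3) vs \<phi>s by (auto simp: sentence_of_def)
  moreover have "Dom M \<noteq> {}" "Dom N \<noteq> {}"
    using assms(1) by (auto simp: elem_equiv_def structure_for_def)
  ultimately show ?thesis
    using holds_at_closure[of M "Conj \<phi>s" vs] holds_at_closure[of N "Conj \<phi>s" vs] assms(1,4) vs eq
    by (auto simp: elem_equiv_def)
qed

text \<open>
  The value of \<open>xs ! v\<close> beyond the end of the list may lie outside the structure. Where a valuation
  has to take all its values in the structure, a default element is used instead.
\<close>

lemma holds_at_eq_sat:
  assumes "fvars \<phi> \<subseteq> {..<length xs}"
  shows "holds_at M \<phi> xs = sat M (\<lambda>v. if v < length xs then xs ! v else d) \<phi>"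
  unfolding holds_at_def by (rule sat_cong) (use assms in auto)

instance tm :: (countable) countable by countable_datatype
instance fm :: (countable, countable) countable by countable_datatype

lemma set_tm_subset: "term_of L t \<Longrightarrow> set_tm t \<subseteq> fst ` Funs L"
  by (induction t) (auto simp: image_iff, force+)

lemma set_fm_subset:
  "formula_of L \<phi> \<Longrightarrow> set1_fm \<phi> \<subseteq> fst ` Funs L \<and> set2_fm \<phi> \<subseteq> fst ` Rels L"
proof (induction \<phi>)
  case (Eq s t)
  then show ?case using set_tm_subset[of L s] set_tm_subset[of L t] by auto
next
  case (Rel r ts)
  then show ?case using set_tm_subset[of L] by (force simp: image_iff)
qed auto

text \<open>
  Replacing the symbols of the language by natural numbers embeds its formulas into a countable
  datatype, whatever the types of the symbols are.
\<close>

lemma countable_formulas: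
  assumes "countable_language L"
  shows "countable {\<phi>. formula_of L \<phi>}"
proof -
  define F where "F = fst ` Funs L"
  define P where "P = fst ` Rels L"
  have c: "countable F" "countable P" using assms by (auto simp: F_def P_def countable_language_def)
  have "\<phi> \<in> range (map_fm (from_nat_into F) (from_nat_into P))" if "formula_of L \<phi>" for \<phi>
  proof -
    have "map_fm (from_nat_into F) (from_nat_into P) (map_fm (to_nat_on F) (to_nat_on P) \<phi>) = map_fm id id \<phi>"
      unfolding fm.map_comp
      by (rule fm.map_cong0) (use set_fm_subset[OF that] c in \<open>auto simp: F_def P_def subset_iff\<close>)
    then show ?thesis by (metis fm.map_id rangeI)
  qed
  then have "{\<phi>. formula_of L \<phi>} \<subseteq> range (map_fm (from_nat_into F) (from_nat_into P))" by auto
  then show ?thesis by (rule countable_subset) simp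
qed

section \<open>Ultrapowers\<close>

text \<open>
  A minimal proper filter below the cofinite one; Zorn's lemma applies because the infimum of a
  chain of proper filters is proper.
\<close>

lemma ex_ultrafilter:
  "\<exists>U :: nat filter. U \<noteq> bot \<and> U \<le> sequentially \<and> (\<forall>P. eventually P U \<or> eventually (\<lambda>k. \<not> P k) U)"
proof -
  define \<F> where "\<F> = {G :: nat filter. G \<noteq> bot \<and> G \<le> sequentially}"
  define r where "r = {(b, a :: nat filter). a \<in> \<F> \<and> b \<in> \<F> \<and> a \<le> b}"
  have Field: "Field r = \<F>" by (auto simp: Field_def r_def)
  have "\<exists>m\<in>Field r. \<forall>a\<in>Field r. (m, a) \<in> r \<longrightarrow> a = m"
  proof (rule Zorns_po_lemma)
    show "Partial_order r"
      unfolding partial_order_on_def preorder_on_def Field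
      by (auto simp: r_def refl_on_def trans_def antisym_def)
  next
    fix C assume C: "C \<in> Chains r"
    show "\<exists>u\<in>Field r. \<forall>a\<in>C. (a, u) \<in> r"
    proof (cases "C = {}")
      case True
      then show ?thesis by (auto simp: Field \<F>_def intro!: exI[of _ sequentially])
    next
      case False
      have sub: "C \<subseteq> \<F>" using C by (auto simp: Chains_def r_def)
      have "eventually P (Inf C) \<longleftrightarrow> (\<exists>b\<in>C. eventually P b)" for P
        using False C by (intro eventually_Inf_base) (auto simp: Chains_def r_def)
      then have "Inf C \<noteq> bot" using sub by (auto simp: trivial_limit_def \<F>_def)
      moreover have "Inf C \<le> sequentially"
        using False sub by (metis (mono_tags, lifting) Inf_lower2 \<F>_def ex_in_conv mem_Collect_eq subsetD)
      ultimately have "Inf C \<in> \<F>" by (simp add: \<F>_def)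
      then show ?thesis unfolding Field
        using sub by (intro bexI[of _ "Inf C"]) (auto simp: r_def Inf_lower)
    qed
  qed
  then obtain U where U: "U \<in> \<F>" and max: "\<And>a. a \<in> \<F> \<Longrightarrow> a \<le> U \<Longrightarrow> a = U"
    unfolding Field by (auto simp: r_def)
  have "eventually P U \<or> eventually (\<lambda>k. \<not> P k) U" for P
  proof (rule disjCI)
    assume "\<not> (\<forall>\<^sub>F k in U. \<not> P k)"
    then have "inf U (principal {k. P k}) \<noteq> bot"
      by (simp add: trivial_limit_def eventually_inf_principal)
    then have "inf U (principal {k. P k}) \<in> \<F>"
      using U by (auto simp: \<F>_def intro: le_infI1)
    then have "inf U (principal {k. P k}) = U" by (rule max) simp
    moreover have "eventually P (inf U (principal {k. P k}))" by (simp add: eventually_inf_principal)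
    ultimately show "eventually P U" by (simp only:)
  qed
  then show ?thesis using U by (auto simp: \<F>_def)
qed

locale ultrapower =
  fixes L :: "('f, 'r) language" and N :: "(nat, 'f, 'r) fo_structure" and U :: "nat filter"
  assumes str: "structure_for L N"
    and proper: "U \<noteq> bot"
    and free: "U \<le> sequentially"
    and ultra: "eventually P U \<or> eventually (\<lambda>k. \<not> P k) U"
begin

lemma eventually_Not: "eventually (\<lambda>k. \<not> P k) U \<longleftrightarrow> \<not> eventually P U"
proof
  assume "\<forall>\<^sub>F k in U. \<not> P k"
  then show "\<not> eventually P U"
    using proper by (metis (mono_tags, lifting) eventually_elim2 eventually_const)
qed (use ultra in blast)

lemma eventually_ge: "eventually (\<lambda>k. j \<le> k) U"
  using free eventually_ge_at_top[of j] by (auto simp: le_filter_def)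

definition dec :: "nat set \<Rightarrow> nat \<Rightarrow> nat" where
  "dec A k = (THE x. prod_encode (k, x) \<in> A)"

text \<open>
  The class of a sequence is represented by the graph of one chosen member, coded as a set of
  natural numbers.
\<close>

definition cls :: "(nat \<Rightarrow> nat) \<Rightarrow> nat set" where
  "cls s = range (\<lambda>k. prod_encode
     (k, (SOME t. range t \<subseteq> Dom N \<and> eventually (\<lambda>k. t k = s k) U) k))"

definition M :: "(nat set, 'f, 'r) fo_structure" where
  "M = \<lparr>Dom = cls ` {s. range s \<subseteq> Dom N},
        Fn = (\<lambda>f xs. cls (\<lambda>k. Fn N f (map (\<lambda>x. dec x k) xs))),
        Rl = (\<lambda>r xs. eventually (\<lambda>k. Rl N r (map (\<lambda>x. dec x k) xs)) U)\<rparr>"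

lemma dec_cls:
  assumes "range s \<subseteq> Dom N"
  shows "range (dec (cls s)) \<subseteq> Dom N" "eventually (\<lambda>k. dec (cls s) k = s k) U"
proof -
  define t where "t = (SOME t. range t \<subseteq> Dom N \<and> eventually (\<lambda>k. t k = s k) U)"
  have "range t \<subseteq> Dom N \<and> eventually (\<lambda>k. t k = s k) U"
    unfolding t_def by (rule someI[of _ s]) (use assms in auto)
  moreover have "dec (cls s) = t"
    by (rule ext) (auto simp: dec_def cls_def t_def[symmetric] image_iff)
  ultimately show "range (dec (cls s)) \<subseteq> Dom N" "eventually (\<lambda>k. dec (cls s) k = s k) U" by auto
qed

lemma cls_cong:
  assumes "eventually (\<lambda>k. s k = t k) U"
  shows "cls s = cls t"
proof -
  have "eventually (\<lambda>k. u k = s k) U \<longleftrightarrow> eventually (\<lambda>k. u k = t k) U" for u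
    using assms by (auto elim: eventually_elim2)
  then show ?thesis by (simp add: cls_def)
qed

lemma Dom_M: "x \<in> Dom M \<longleftrightarrow> (\<exists>s. range s \<subseteq> Dom N \<and> x = cls s)"
  unfolding M_def by auto

lemma dec_in: "x \<in> Dom M \<Longrightarrow> dec x k \<in> Dom N"
  unfolding Dom_M using dec_cls(1) by blast

lemma cls_in: "(\<And>k. s k \<in> Dom N) \<Longrightarrow> cls s \<in> Dom M"
  unfolding Dom_M by (intro exI[of _ s]) auto

lemma cls_dec: "x \<in> Dom M \<Longrightarrow> cls (dec x) = x"
  unfolding Dom_M using dec_cls(2) cls_cong by blast

lemma eq_iff_dec: "x \<in> Dom M \<Longrightarrow> y \<in> Dom M \<Longrightarrow> x = y \<longleftrightarrow> eventually (\<lambda>k. dec x k = dec y k) U"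
  using cls_cong[of "dec x" "dec y"] cls_dec[of x] cls_dec[of y] by (cases "x = y") auto

lemma structure_M: "structure_for L M"
proof -
  obtain d where "d \<in> Dom N" using str unfolding structure_for_def by blast
  then have "Dom M \<noteq> {}" using cls_in[of "\<lambda>k. d"] by blast
  moreover have "Fn M f xs \<in> Dom M" if "(f, n) \<in> Funs L" "xs \<in> tuples M n" for f n xs
  proof -
    have "map (\<lambda>x. dec x k) xs \<in> tuples N n" for k
      using that dec_in by (auto simp: tuples_def)
    then have "Fn N f (map (\<lambda>x. dec x k) xs) \<in> Dom N" for k
      using Fn_in_Dom[OF str that(1)] by blast
    then have "cls (\<lambda>k. Fn N f (map (\<lambda>x. dec x k) xs)) \<in> Dom M" by (rule cls_in)
    then show ?thesis by (simp add: M_def)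
  qed
  ultimately show ?thesis unfolding structure_for_def by blast
qed

lemma Los_tm:
  assumes \<sigma>: "\<And>v. \<sigma> v \<in> Dom M" and "term_of L t"
  shows "eventually (\<lambda>k. dec (tval M \<sigma> t) k = tval N (\<lambda>v. dec (\<sigma> v) k) t) U"
  using assms(2)
proof (induction t)
  case (Fun f ts)
  let ?s = "\<lambda>k. Fn N f (map (\<lambda>x. dec x k) (map (tval M \<sigma>) ts))"
  have "map (\<lambda>x. dec x k) (map (tval M \<sigma>) ts) \<in> tuples N (length ts)" for k
    using Fun.prems tval_in_Dom[OF structure_M \<sigma>] dec_in by (auto simp: tuples_def)
  then have "?s k \<in> Dom N" for k
    using Fun.prems by (intro Fn_in_Dom[OF str]) auto
  then have 1: "eventually (\<lambda>k. dec (cls ?s) k = ?s k) U"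
    by (intro dec_cls) auto
  have "eventually (\<lambda>k. \<forall>t\<in>set ts. dec (tval M \<sigma> t) k = tval N (\<lambda>v. dec (\<sigma> v) k) t) U"
    using Fun by (auto simp: eventually_ball_finite_distrib)
  then have 2: "eventually (\<lambda>k. ?s k = tval N (\<lambda>v. dec (\<sigma> v) k) (Fun f ts)) U"
    by eventually_elim (auto intro!: arg_cong[where f = "Fn N f"])
  show ?case using 1 2
  proof eventually_elim
    case (elim k)
    then show ?case by (simp add: M_def)
  qed
qed auto

text \<open>
  The theorem of Los. The case of the quantifier is where choice is used: a witness is picked on each
  coordinate separately.
\<close>

lemma Los:
  assumes "\<And>v. \<sigma> v \<in> Dom M" and "formula_of L \<phi>"
  shows "sat M \<sigma> \<phi> \<longleftrightarrow> eventually (\<lambda>k. sat N (\<lambda>v. dec (\<sigma> v) k) \<phi>) U"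
  using assms
proof (induction \<phi> arbitrary: \<sigma>)
  case (Eq s t)
  have "eventually (\<lambda>k. dec (tval M \<sigma> s) k = tval N (\<lambda>v. dec (\<sigma> v) k) s \<and>
      dec (tval M \<sigma> t) k = tval N (\<lambda>v. dec (\<sigma> v) k) t) U"
    using Los_tm Eq by (auto simp: eventually_conj_iff)
  then have "eventually (\<lambda>k. dec (tval M \<sigma> s) k = dec (tval M \<sigma> t) k) U
     \<longleftrightarrow> eventually (\<lambda>k. sat N (\<lambda>v. dec (\<sigma> v) k) (Eq s t)) U"
    by (intro eventually_subst) (auto elim: eventually_mono)
  then show ?case using Eq eq_iff_dec tval_in_Dom[OF structure_M] by simp
next
  case (Rel r ts)
  have "eventually (\<lambda>k. \<forall>t\<in>set ts. dec (tval M \<sigma> t) k = tval N (\<lambda>v. dec (\<sigma> v) k) t) U"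
    using Rel Los_tm by (auto simp: eventually_ball_finite_distrib)
  then have "eventually (\<lambda>k. map (\<lambda>x. dec x k) (map (tval M \<sigma>) ts) = map (tval N (\<lambda>v. dec (\<sigma> v) k)) ts) U"
    by eventually_elim auto
  then have "eventually (\<lambda>k. Rl N r (map (\<lambda>x. dec x k) (map (tval M \<sigma>) ts))) U
     \<longleftrightarrow> eventually (\<lambda>k. Rl N r (map (tval N (\<lambda>v. dec (\<sigma> v) k)) ts)) U"
    by (intro eventually_subst) (erule eventually_mono, simp only:)
  then show ?case by (simp add: M_def)
next
  case (Neg \<phi>)
  then show ?case by (simp add: eventually_Not)
next
  case (And \<phi> \<psi>)
  then show ?case by (simp add: eventually_conj_iff)
next
  case (Ex v \<phi>)
  have upd: "(\<lambda>u. dec ((\<sigma>(v := x)) u) k) = (\<lambda>u. dec (\<sigma> u) k)(v := dec x k)" for x k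
    by auto
  show ?case
  proof
    assume "sat M \<sigma> (Ex v \<phi>)"
    then obtain x where x: "x \<in> Dom M" "sat M (\<sigma>(v := x)) \<phi>" by auto
    then have "eventually (\<lambda>k. sat N (\<lambda>u. dec ((\<sigma>(v := x)) u) k) \<phi>) U"
      using Ex by (subst (asm) Ex.IH) auto
    then show "eventually (\<lambda>k. sat N (\<lambda>u. dec (\<sigma> u) k) (Ex v \<phi>)) U"
      unfolding upd using x dec_in by (auto elim!: eventually_mono)
  next
    assume ev: "eventually (\<lambda>k. sat N (\<lambda>u. dec (\<sigma> u) k) (Ex v \<phi>)) U"
    define s where "s k = (if sat N (\<lambda>u. dec (\<sigma> u) k) (Ex v \<phi>)
      then SOME d. d \<in> Dom N \<and> sat N ((\<lambda>u. dec (\<sigma> u) k)(v := d)) \<phi> else dec (\<sigma> 0) k)" for k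
    have s: "s k \<in> Dom N \<and> (sat N (\<lambda>u. dec (\<sigma> u) k) (Ex v \<phi>) \<longrightarrow>
        sat N ((\<lambda>u. dec (\<sigma> u) k)(v := s k)) \<phi>)" for k
    proof (cases "sat N (\<lambda>u. dec (\<sigma> u) k) (Ex v \<phi>)")
      case True
      then have "\<exists>d. d \<in> Dom N \<and> sat N ((\<lambda>u. dec (\<sigma> u) k)(v := d)) \<phi>" by auto
      then have "s k \<in> Dom N \<and> sat N ((\<lambda>u. dec (\<sigma> u) k)(v := s k)) \<phi>"
        unfolding s_def if_P[OF True] by (rule someI_ex)
      then show ?thesis by blast
    qed (use Ex.prems dec_in in \<open>auto simp: s_def\<close>)
    then have "range s \<subseteq> Dom N" by auto
    note * = dec_cls(2)[OF this]
    have x: "cls s \<in> Dom M" using s cls_in by auto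
    have "eventually (\<lambda>k. sat N (\<lambda>u. dec ((\<sigma>(v := cls s)) u) k) \<phi>) U"
      unfolding upd using ev *
    proof eventually_elim
      case (elim k)
      then show ?case using s[of k] by simp
    qed
    then have "sat M (\<sigma>(v := cls s)) \<phi>"
      using Ex.prems x by (subst Ex.IH) auto
    then show "sat M \<sigma> (Ex v \<phi>)" using x by auto
  qed
qed

lemma elem_equiv_M: "elem_equiv L N M"
proof -
  obtain d where d: "d \<in> Dom M" using structure_M by (auto simp: structure_for_def)
  have "holds_at N \<phi> [] = holds_at M \<phi> []" if \<phi>: "sentence_of L \<phi>" for \<phi>
  proof -
    have "holds_at M \<phi> [] = sat M (\<lambda>_. d) \<phi>"
      unfolding holds_at_def by (rule sat_cong) (use \<phi> in \<open>auto simp: sentence_of_def\<close>)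
    also have "\<dots> = eventually (\<lambda>k. sat N (\<lambda>v. dec d k) \<phi>) U"
      using \<phi> d by (subst Los) (auto simp: sentence_of_def)
    also have "(\<lambda>k. sat N (\<lambda>v. dec d k) \<phi>) = (\<lambda>k. holds_at N \<phi> [])"
      unfolding holds_at_def by (intro ext sat_cong) (use \<phi> in \<open>auto simp: sentence_of_def\<close>)
    finally show ?thesis using proper by (simp add: eventually_const)
  qed
  then show ?thesis using str structure_M by (auto simp: elem_equiv_def)
qed

text \<open>
  An ultrapower realizes every countable, finitely satisfiable set of formulas, even one that
  involves all the variables at once: on the \<open>k\<close>-th coordinate one satisfies the first \<open>k\<close>
  formulas.
\<close>

lemma realizes:
  assumes "countable \<Gamma>" "\<And>\<phi>. \<phi> \<in> \<Gamma> \<Longrightarrow> formula_of L \<phi>"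
    "\<And>\<Delta>. finite \<Delta> \<Longrightarrow> \<Delta> \<subseteq> \<Gamma> \<Longrightarrow> satisfiable N \<Delta>"
  shows "satisfiable M \<Gamma>"
proof (cases "\<Gamma> = {}")
  case True
  then show ?thesis using structure_M by (auto simp: satisfiable_def structure_for_def ex_in_conv[symmetric])
next
  case False
  define \<phi> where "\<phi> = from_nat_into \<Gamma>"
  have \<phi>: "range \<phi> = \<Gamma>" using False assms(1) by (simp add: \<phi>_def)
  have "\<exists>\<sigma>. (\<forall>v. \<sigma> v \<in> Dom N) \<and> (\<forall>j\<le>k. sat N \<sigma> (\<phi> j))" for k
  proof -
    have "satisfiable N (\<phi> ` {..k})" using \<phi> by (intro assms(3)) auto
    then show ?thesis unfolding satisfiable_def by (metis atMost_iff imageI)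
  qed
  then obtain \<sigma> where \<sigma>: "\<And>k v. \<sigma> k v \<in> Dom N" "\<And>k j. j \<le> k \<Longrightarrow> sat N (\<sigma> k) (\<phi> j)" by metis
  define \<tau> where "\<tau> v = cls (\<lambda>k. \<sigma> k v)" for v
  have \<tau>: "\<tau> v \<in> Dom M" for v unfolding \<tau>_def using \<sigma> by (intro cls_in)
  have "sat M \<tau> (\<phi> j)" for j
  proof -
    have fj: "formula_of L (\<phi> j)" using assms(2) \<phi> by auto
    have "eventually (\<lambda>k. \<forall>v\<in>fvars (\<phi> j). dec (\<tau> v) k = \<sigma> k v) U"
      unfolding \<tau>_def using \<sigma>(1) by (subst eventually_ball_finite_distrib) (auto intro!: dec_cls)
    then have "eventually (\<lambda>k. sat N (\<lambda>v. dec (\<tau> v) k) (\<phi> j)) U"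
      using eventually_ge[of j]
    proof eventually_elim
      case (elim k)
      then have "sat N (\<lambda>v. dec (\<tau> v) k) (\<phi> j) = sat N (\<sigma> k) (\<phi> j)" by (intro sat_cong) auto
      then show ?case using \<sigma> elim by simp
    qed
    then show ?thesis using Los[OF \<tau> fj] by simp
  qed
  then show ?thesis using \<tau> \<phi> by (auto simp: satisfiable_def)
qed

text \<open>
  With parameters, the diagonal argument has to respect that a finite part of the type is realized on
  almost all coordinates only. On the coordinate \<open>i\<close>, one follows the realization of the first \<open>k\<close>
  formulas for the largest \<open>k \<le> i\<close> for which it still is a realization there.
\<close>

lemma saturated:
  assumes cL: "countable_language L"
  shows "aleph1_saturated L M"
  unfolding aleph1_saturated_def
proof (intro allI impI, elim conjE)
  fix A p
  assume A: "A \<subseteq> Dom M" "countable A"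
    and p: "p \<subseteq> {(\<phi>, as). formula_of L \<phi> \<and> set as \<subseteq> A \<and> fvars \<phi> \<subseteq> {..<Suc (length as)}}"
    and fin: "\<forall>q. finite q \<and> q \<subseteq> p \<longrightarrow> (\<exists>b\<in>Dom M. \<forall>(\<phi>, as)\<in>q. holds_at M \<phi> (b # as))"
  obtain d where d: "d \<in> Dom M" using structure_M by (auto simp: structure_for_def)
  have "countable ({\<phi>. formula_of L \<phi>} \<times> lists A)"
    using countable_formulas[OF cL] A by auto
  then have cp: "countable p" by (rule countable_subset[rotated]) (use p in auto)
  show "\<exists>b\<in>Dom M. \<forall>(\<phi>, as)\<in>p. holds_at M \<phi> (b # as)"
  proof (cases "p = {}")
    case True
    then show ?thesis using d by auto
  next
    case False
    define \<phi> where "\<phi> j = fst (from_nat_into p j)" for j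
    define as where "as j = snd (from_nat_into p j)" for j
    have pj: "(\<phi> j, as j) \<in> p" for j
      unfolding \<phi>_def as_def using False by (simp add: from_nat_into)
    have enum: "\<exists>j. x = (\<phi> j, as j)" if "x \<in> p" for x
      unfolding \<phi>_def as_def using that cp by (metis from_nat_into_to_nat_on prod.collapse)
    define val where "val j b v = (if v < Suc (length (as j)) then (b # as j) ! v else d)" for j b v
    have fj: "formula_of L (\<phi> j)" "set (as j) \<subseteq> A" "fvars (\<phi> j) \<subseteq> {..<Suc (length (as j))}" for j
      using p pj[of j] by auto
    have val: "val j b v \<in> Dom M" if "b \<in> Dom M" for j b v
    proof (cases "0 < v \<and> v < Suc (length (as j))")
      case True
      then have "as j ! (v - Suc 0) \<in> set (as j)" by (intro nth_mem) auto
      then show ?thesis using True fj(2)[of j] A by (auto simp: val_def nth_Cons')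
    qed (use that d in \<open>auto simp: val_def nth_Cons'\<close>)
    have hv: "holds_at M (\<phi> j) (b # as j) \<longleftrightarrow> sat M (val j b) (\<phi> j)" for j b
      unfolding val_def using holds_at_eq_sat[of "\<phi> j" "b # as j" M d] fj(3)[of j] by simp
    have "\<exists>b\<in>Dom M. \<forall>j\<le>k. holds_at M (\<phi> j) (b # as j)" for k
    proof -
      have "\<exists>b\<in>Dom M. \<forall>(\<phi>, as)\<in>(\<lambda>j. (\<phi> j, as j)) ` {..k}. holds_at M \<phi> (b # as)"
        using fin[rule_format, of "(\<lambda>j. (\<phi> j, as j)) ` {..k}"] pj by blast
      then show ?thesis by auto
    qed
    then obtain b where b: "\<And>k. b k \<in> Dom M" "\<And>k j. j \<le> k \<Longrightarrow> sat M (val j (b k)) (\<phi> j)"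
      unfolding hv by metis
    define E where "E k i \<longleftrightarrow> (\<forall>j\<le>k. sat N (\<lambda>v. dec (val j (b k) v) i) (\<phi> j))" for k i
    have E: "eventually (E k) U" for k
    proof -
      have "eventually (\<lambda>i. \<forall>j\<in>{..k}. sat N (\<lambda>v. dec (val j (b k) v) i) (\<phi> j)) U"
        using b Los[OF val[OF b(1)] fj(1)]
        by (subst eventually_ball_finite_distrib) auto
      then show ?thesis by (simp add: E_def[abs_def] Ball_def)
    qed
    define g where "g i = Max (insert 0 {k. k \<le> i \<and> E k i})" for i
    define c where "c = cls (\<lambda>i. dec (b (g i)) i)"
    have c: "c \<in> Dom M" unfolding c_def using b dec_in by (intro cls_in) auto
    have "range (\<lambda>i. dec (b (g i)) i) \<subseteq> Dom N" using b dec_in by auto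
    note cd = dec_cls(2)[OF this, folded c_def]
    have "sat M (val j c) (\<phi> j)" for j
    proof -
      have "eventually (\<lambda>i. sat N (\<lambda>v. dec (val j c v) i) (\<phi> j)) U"
        using cd E[of j] eventually_ge[of j]
      proof eventually_elim
        case (elim i)
        have "g i \<in> insert 0 {k. k \<le> i \<and> E k i}" unfolding g_def by (rule Max_in) auto
        moreover have "j \<le> g i" unfolding g_def using elim by (intro Max_ge) auto
        ultimately have "E (g i) i \<and> j \<le> g i" using elim by (cases "j = 0") auto
        then have "sat N (\<lambda>v. dec (val j (b (g i)) v) i) (\<phi> j)" by (auto simp: E_def)
        moreover have "(\<lambda>v. dec (val j (b (g i)) v) i) = (\<lambda>v. dec (val j c v) i)"
          using elim by (auto simp: val_def nth_Cons')
        ultimately show ?case by simp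
      qed
      then show ?thesis using Los[OF val[OF c] fj(1)] by simp
    qed
    then have "holds_at M (\<phi> j) (c # as j)" for j unfolding hv .
    then have "\<forall>(\<phi>, as)\<in>p. holds_at M \<phi> (c # as)" using enum by blast
    then show ?thesis using c by blast
  qed
qed

end

lemma holds_at_sentence: "sentence_of L \<phi> \<Longrightarrow> holds_at M \<phi> [] = sat M \<sigma> \<phi>"
  unfolding holds_at_def by (rule sat_cong) (auto simp: sentence_of_def)

section \<open>Elementary substructures and isomorphisms\<close>

lemma tval_Dom_update [simp]: "tval (M\<lparr>Dom := A\<rparr>) \<sigma> t = tval M \<sigma> t"
proof (induction t)
  case (Fun f ts)
  then have "map (tval (M\<lparr>Dom := A\<rparr>) \<sigma>) ts = map (tval M \<sigma>) ts" by simp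
  then show ?case by (simp only: tval.simps) simp
qed simp

text \<open>
  The criterion of Tarski and Vaught. That \<open>A\<close> is closed under the functions is the case of the
  formulas \<open>y = f(x)\<close>.
\<close>

lemma tarski_vaught:
  assumes str: "structure_for L M" and A: "A \<subseteq> Dom M" "A \<noteq> {}"
    and tv: "\<And>\<phi> v \<tau>. formula_of L \<phi> \<Longrightarrow> (\<And>u. \<tau> u \<in> A) \<Longrightarrow> sat M \<tau> (Ex v \<phi>) \<Longrightarrow>
      \<exists>d\<in>A. sat M (\<tau>(v := d)) \<phi>"
  shows "structure_for L (M\<lparr>Dom := A\<rparr>)"
    and "formula_of L \<phi> \<Longrightarrow> (\<And>u. \<tau> u \<in> A) \<Longrightarrow> sat (M\<lparr>Dom := A\<rparr>) \<tau> \<phi> = sat M \<tau> \<phi>"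
proof -
  obtain a where a: "a \<in> A" using A by auto
  have "Fn M f xs \<in> A" if f: "(f, n) \<in> Funs L" and xs: "length xs = n" "set xs \<subseteq> A" for f n xs
  proof -
    define \<tau> where "\<tau> i = (if i < n then xs ! i else a)" for i
    have \<tau>: "\<tau> u \<in> A" for u using xs a by (auto simp: \<tau>_def)
    have map: "map (tval M (\<tau>(n := d))) (map Var [0..<n]) = xs" for d
      using xs by (intro nth_equalityI) (auto simp: \<tau>_def)
    have fm: "formula_of L (Eq (Var n) (Fun f (map Var [0..<n])))" using f by auto
    have "Fn M f xs \<in> Dom M"
      using xs A by (intro Fn_in_Dom[OF str f]) (auto simp: tuples_def)
    then have "sat M \<tau> (Ex n (Eq (Var n) (Fun f (map Var [0..<n]))))"
      unfolding sat.simps tval.simps map by auto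
    then obtain d where "d \<in> A" "sat M (\<tau>(n := d)) (Eq (Var n) (Fun f (map Var [0..<n])))"
      using tv[OF fm, of \<tau> n] \<tau> by blast
    then show ?thesis unfolding sat.simps tval.simps map by simp
  qed
  then show "structure_for L (M\<lparr>Dom := A\<rparr>)"
    using A by (auto simp: structure_for_def tuples_def)
  show "sat (M\<lparr>Dom := A\<rparr>) \<tau> \<phi> = sat M \<tau> \<phi>" if "formula_of L \<phi>" "\<And>u. \<tau> u \<in> A"
    using that
  proof (induction \<phi> arbitrary: \<tau>)
    case (Rel r ts)
    have "map (tval (M\<lparr>Dom := A\<rparr>) \<tau>) ts = map (tval M \<tau>) ts" by simp
    then show ?case by (simp only: sat.simps) simp
  next
    case (Ex v \<phi>)
    have IH: "sat (M\<lparr>Dom := A\<rparr>) (\<tau>(v := d)) \<phi> = sat M (\<tau>(v := d)) \<phi>" if "d \<in> A" for d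
      by (rule Ex.IH) (use Ex.prems that in auto)
    have f: "formula_of L \<phi>" using Ex.prems by simp
    have "(\<exists>d\<in>A. sat M (\<tau>(v := d)) \<phi>) \<longleftrightarrow> sat M \<tau> (Ex v \<phi>)"
      using tv[OF f, of \<tau> v] Ex.prems(2) A by auto
    then show ?case using IH by simp
  qed auto
qed

lemma isomorphic_sat:
  assumes iso: "isomorphic L S Y" and str: "structure_for L S"
  obtains h where "bij_betw h (Dom S) (Dom Y)"
    "\<And>\<phi> \<tau>. formula_of L \<phi> \<Longrightarrow> (\<And>u. \<tau> u \<in> Dom S) \<Longrightarrow> sat S \<tau> \<phi> = sat Y (h \<circ> \<tau>) \<phi>"
proof -
  obtain h where h: "bij_betw h (Dom S) (Dom Y)"
    and Fn: "\<And>f n xs. (f, n) \<in> Funs L \<Longrightarrow> xs \<in> tuples S n \<Longrightarrow> h (Fn S f xs) = Fn Y f (map h xs)"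
    and Rl: "\<And>r n xs. (r, n) \<in> Rels L \<Longrightarrow> xs \<in> tuples S n \<Longrightarrow> Rl S r xs = Rl Y r (map h xs)"
    using iso unfolding isomorphic_def by blast
  have tup: "map (tval S \<tau>) ts \<in> tuples S (length ts)"
    if "\<And>u. \<tau> u \<in> Dom S" "\<forall>t\<in>set ts. term_of L t" for \<tau> ts
    using that tval_in_Dom[OF str that(1)] by (auto simp: tuples_def)
  have tm: "h (tval S \<tau> t) = tval Y (h \<circ> \<tau>) t" if \<tau>: "\<And>u. \<tau> u \<in> Dom S" and "term_of L t" for \<tau> t
    using that(2)
  proof (induction t)
    case (Fun f ts)
    then have "h (Fn S f (map (tval S \<tau>) ts)) = Fn Y f (map h (map (tval S \<tau>) ts))"
      using tup[OF \<tau>, of ts] by (intro Fn) auto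
    moreover have "map h (map (tval S \<tau>) ts) = map (tval Y (h \<circ> \<tau>)) ts"
      unfolding map_map map_eq_conv comp_apply[of h "tval S \<tau>"] using Fun.IH Fun.prems
      unfolding term_of.simps by blast
    ultimately show ?case by (simp only: tval.simps)
  qed simp
  have "sat S \<tau> \<phi> = sat Y (h \<circ> \<tau>) \<phi>" if "formula_of L \<phi>" "\<And>u. \<tau> u \<in> Dom S" for \<phi> \<tau>
    using that
  proof (induction \<phi> arbitrary: \<tau>)
    case (Eq s t)
    have "tval S \<tau> s = tval S \<tau> t \<longleftrightarrow> h (tval S \<tau> s) = h (tval S \<tau> t)"
      using h tval_in_Dom[OF str Eq(2)] Eq(1) by (auto simp: bij_betw_def inj_on_eq_iff)
    moreover have "h (tval S \<tau> s) = tval Y (h \<circ> \<tau>) s" "h (tval S \<tau> t) = tval Y (h \<circ> \<tau>) t"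
      using Eq by (auto intro!: tm[of \<tau>])
    ultimately show ?case by (simp only: sat.simps)
  next
    case (Rel r ts)
    have "Rl S r (map (tval S \<tau>) ts) = Rl Y r (map h (map (tval S \<tau>) ts))"
      using Rel tup[of \<tau> ts] by (intro Rl) auto
    moreover have "map h (map (tval S \<tau>) ts) = map (tval Y (h \<circ> \<tau>)) ts"
      unfolding map_map map_eq_conv comp_apply[of h "tval S \<tau>"] using Rel tm[of \<tau>] by auto
    ultimately show ?case by (simp only: sat.simps)
  next
    case (Ex v \<phi>)
    have "sat S (\<tau>(v := d)) \<phi> = sat Y ((h \<circ> \<tau>)(v := h d)) \<phi>" if "d \<in> Dom S" for d
      using Ex that by (subst Ex.IH) (auto simp: fun_upd_comp)
    moreover have "Dom Y = h ` Dom S" using h by (simp add: bij_betw_def)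
    ultimately show ?case unfolding sat.simps by (simp only: bex_simps cong: bex_cong)
  qed auto
  then show thesis using that h by blast
qed

lemma countable_copy:
  fixes S :: "('b, 'f, 'r) fo_structure"
  assumes str: "structure_for L S" and c: "countable (Dom S)"
  shows "\<exists>Y :: (nat, 'f, 'r) fo_structure. structure_for L Y \<and> isomorphic L S Y"
proof -
  define h where "h = to_nat_on (Dom S)"
  define g where "g = from_nat_into (Dom S)"
  have gh: "g (h x) = x" if "x \<in> Dom S" for x using that c by (simp add: g_def h_def)
  define Y :: "(nat, 'f, 'r) fo_structure" where
    "Y = \<lparr>Dom = h ` Dom S, Fn = (\<lambda>f ys. h (Fn S f (map g ys))), Rl = (\<lambda>r ys. Rl S r (map g ys))\<rparr>"
  have bij: "bij_betw h (Dom S) (Dom Y)"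
    unfolding bij_betw_def Y_def using inj_on_inverseI[of "Dom S" g h] gh by auto
  have inv: "map g (map h xs) = xs" if "xs \<in> tuples S n" for xs n
    using that gh by (intro nth_equalityI) (auto simp: tuples_def subset_iff)
  have "map g ys \<in> tuples S n" if "ys \<in> tuples Y n" for ys n
    using that gh by (auto simp: tuples_def Y_def)
  then have "structure_for L Y"
    using str Fn_in_Dom[OF str] by (auto simp: structure_for_def Y_def)
  moreover have "isomorphic L S Y"
    unfolding isomorphic_def using bij inv by (intro exI[of _ h]) (auto simp: Y_def)
  ultimately show ?thesis by blast
qed

text \<open>Uniqueness of the countable model, for countable structures with elements of any type.\<close>

lemma unique_countable_model:
  fixes N :: "(nat, 'f, 'r) fo_structure" and S :: "('b, 'f, 'r) fo_structure"
  assumes uniq: "\<And>N' :: (nat, 'f, 'r) fo_structure. elem_equiv L N N' \<Longrightarrow> isomorphic L N N'"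
    and S: "elem_equiv L N S" "countable (Dom S)"
  obtains h where "bij_betw h (Dom N) (Dom S)"
    "\<And>\<phi> \<tau>. formula_of L \<phi> \<Longrightarrow> (\<And>u. \<tau> u \<in> Dom N) \<Longrightarrow> sat N \<tau> \<phi> = sat S (h \<circ> \<tau>) \<phi>"
proof -
  have str: "structure_for L N" "structure_for L S" using S by (auto simp: elem_equiv_def)
  obtain Y :: "(nat, 'f, 'r) fo_structure" where Y: "structure_for L Y" "isomorphic L S Y"
    using countable_copy[OF str(2) S(2)] by blast
  obtain k where k: "bij_betw k (Dom S) (Dom Y)"
    and ks: "\<And>\<phi> \<tau>. formula_of L \<phi> \<Longrightarrow> (\<And>u. \<tau> u \<in> Dom S) \<Longrightarrow> sat S \<tau> \<phi> = sat Y (k \<circ> \<tau>) \<phi>"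
    using isomorphic_sat[OF Y(2) str(2)] by blast
  obtain d where d: "d \<in> Dom S" using str(2) unfolding structure_for_def by blast
  have "holds_at S \<phi> [] = holds_at Y \<phi> []" if \<phi>: "sentence_of L \<phi>" for \<phi>
  proof -
    have "holds_at S \<phi> [] = sat S (\<lambda>_. d) \<phi>" "holds_at Y \<phi> [] = sat Y (k \<circ> (\<lambda>_. d)) \<phi>"
      using holds_at_sentence[OF \<phi>] by blast+
    then show ?thesis using ks[of \<phi> "\<lambda>_. d"] \<phi> d by (simp add: sentence_of_def)
  qed
  then have "elem_equiv L S Y" using str Y by (auto simp: elem_equiv_def)
  then have "isomorphic L N Y" using S uniq elem_equiv_trans by blast
  then obtain h where h: "bij_betw h (Dom N) (Dom Y)"
    and hs: "\<And>\<phi> \<tau>. formula_of L \<phi> \<Longrightarrow> (\<And>u. \<tau> u \<in> Dom N) \<Longrightarrow> sat N \<tau> \<phi> = sat Y (h \<circ> \<tau>) \<phi>"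
    using isomorphic_sat[OF _ str(1)] by blast
  define k' where "k' = inv_into (Dom S) k"
  have k': "bij_betw k' (Dom Y) (Dom S)" using k by (simp add: k'_def bij_betw_inv_into)
  have kk': "k (k' y) = y" if "y \<in> Dom Y" for y
    using that k by (simp add: k'_def bij_betw_inv_into_right)
  show thesis
  proof (rule that)
    show "bij_betw (k' \<circ> h) (Dom N) (Dom S)" using bij_betw_trans[OF h k'] .
    fix \<phi> :: "('f, 'r) fm" and \<tau> :: "nat \<Rightarrow> nat" assume \<phi>: "formula_of L \<phi>" and \<tau>: "\<And>u. \<tau> u \<in> Dom N"
    have hY: "h (\<tau> u) \<in> Dom Y" for u using h \<tau> by (auto simp: bij_betw_def)
    have "sat S (k' \<circ> h \<circ> \<tau>) \<phi> = sat Y (k \<circ> (k' \<circ> h \<circ> \<tau>)) \<phi>"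
      using hY k' by (intro ks \<phi>) (auto simp: bij_betw_def)
    also have "k \<circ> (k' \<circ> h \<circ> \<tau>) = h \<circ> \<tau>" using hY kk' by auto
    finally show "sat N \<tau> \<phi> = sat S (k' \<circ> h \<circ> \<tau>) \<phi>" using hs[OF \<phi>, of \<tau>] \<tau> by (simp only:)
  qed
qed

section \<open>The theorem of Ryll-Nardzewski\<close>

text \<open>
  Compactness within a single structure, for sets of formulas in infinitely many variables and
  without parameters. This is the form in which saturation enters Henkin constructions.
\<close>

definition realizes_types :: "('f, 'r) language \<Rightarrow> ('a, 'f, 'r) fo_structure \<Rightarrow> bool" where
  "realizes_types L M \<longleftrightarrow> (\<forall>\<Gamma>. (\<forall>\<phi>\<in>\<Gamma>. formula_of L \<phi>) \<longrightarrow>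
     (\<forall>\<Delta>. finite \<Delta> \<and> \<Delta> \<subseteq> \<Gamma> \<longrightarrow> satisfiable M \<Delta>) \<longrightarrow> satisfiable M \<Gamma>)"

text \<open>
  The conditions are the formulas consistent with \<open>\<Gamma>\<close>, and the members of \<open>\<D>\<close> are dense sets of
  conditions. An increasing sequence of conditions that meets all of them is finitely satisfiable
  together with \<open>\<Gamma>\<close>, hence satisfied by one valuation.
\<close>

lemma generic_valuation:
  assumes rt: "realizes_types L M"
    and \<Gamma>: "\<And>\<phi>. \<phi> \<in> \<Gamma> \<Longrightarrow> formula_of L \<phi>" "satisfiable M \<Gamma>"
    and D: "countable \<D>"
    and dense: "\<And>D \<theta>. D \<in> \<D> \<Longrightarrow> formula_of L \<theta> \<Longrightarrow> satisfiable M (insert \<theta> \<Gamma>) \<Longrightarrow>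
      \<exists>\<psi>\<in>D. formula_of L \<psi> \<and> satisfiable M (insert (And \<theta> \<psi>) \<Gamma>)"
  shows "\<exists>\<sigma>. (\<forall>v. \<sigma> v \<in> Dom M) \<and> (\<forall>\<phi>\<in>\<Gamma>. sat M \<sigma> \<phi>) \<and> (\<forall>D\<in>\<D>. \<exists>\<psi>\<in>D. sat M \<sigma> \<psi>)"
proof (cases "\<D> = {}")
  case True
  then show ?thesis using \<Gamma> by (auto simp: satisfiable_def)
next
  case False
  define P where "P \<theta> \<longleftrightarrow> formula_of L \<theta> \<and> satisfiable M (insert \<theta> \<Gamma>)" for \<theta>
  define Q where "Q n \<theta> \<theta>' \<longleftrightarrow> (\<exists>\<psi>\<in>from_nat_into \<D> n. \<theta>' = And \<theta> \<psi>)" for n \<theta> \<theta>'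
  have "\<exists>\<Theta>. \<forall>n. P (\<Theta> n) \<and> Q n (\<Theta> n) (\<Theta> (Suc n))"
  proof (rule dependent_nat_choice)
    show "\<exists>\<theta>. P \<theta>"
      using \<Gamma>(2) by (intro exI[of _ "Eq (Var 0) (Var 0)"]) (auto simp: P_def satisfiable_def)
  next
    fix \<theta> n assume "P \<theta>"
    then show "\<exists>\<theta>'. P \<theta>' \<and> Q n \<theta> \<theta>'"
    proof -
      obtain \<psi> where "\<psi> \<in> from_nat_into \<D> n" "formula_of L \<psi>" "satisfiable M (insert (And \<theta> \<psi>) \<Gamma>)"
        using dense[of "from_nat_into \<D> n" \<theta>] from_nat_into[OF False, of n] \<open>P \<theta>\<close>
        unfolding P_def by blast
      then show ?thesis using \<open>P \<theta>\<close> unfolding P_def Q_def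
        by (intro exI[of _ "And \<theta> \<psi>"]) auto
    qed
  qed
  then obtain \<Theta> where P: "\<And>n. P (\<Theta> n)" and Q: "\<And>n. Q n (\<Theta> n) (\<Theta> (Suc n))" by blast
  have mono: "sat M \<sigma> (\<Theta> n) \<Longrightarrow> m \<le> n \<Longrightarrow> sat M \<sigma> (\<Theta> m)" for \<sigma> m n
  proof (induction n)
    case (Suc n)
    then show ?case using Q[of n] by (cases "m = Suc n") (auto simp: Q_def)
  qed simp
  have "satisfiable M (\<Gamma> \<union> range \<Theta>)"
  proof (rule rt[unfolded realizes_types_def, rule_format])
    show "formula_of L \<phi>" if "\<phi> \<in> \<Gamma> \<union> range \<Theta>" for \<phi> using that \<Gamma>(1) P by (auto simp: P_def)
    fix \<Delta> assume \<Delta>: "finite \<Delta> \<and> \<Delta> \<subseteq> \<Gamma> \<union> range \<Theta>"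
    then obtain I where I: "finite I" "\<Delta> - \<Gamma> = \<Theta> ` I"
      using finite_subset_image[of "\<Delta> - \<Gamma>" \<Theta> UNIV] by auto
    define n where "n = Max (insert 0 I)"
    have n: "i \<le> n" if "i \<in> I" for i using that I by (simp add: n_def)
    obtain \<sigma> where \<sigma>: "\<forall>v. \<sigma> v \<in> Dom M" "\<forall>\<phi>\<in>insert (\<Theta> n) \<Gamma>. sat M \<sigma> \<phi>"
      using P[of n] by (auto simp: P_def satisfiable_def)
    have "sat M \<sigma> \<phi>" if "\<phi> \<in> \<Delta>" for \<phi>
    proof (cases "\<phi> \<in> \<Gamma>")
      case False
      then have "\<phi> \<in> \<Theta> ` I" using that I by blast
      then obtain i where "i \<in> I" "\<phi> = \<Theta> i" by blast
      then show ?thesis using mono[of \<sigma> n i] \<sigma> n by auto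
    qed (use \<sigma> in auto)
    then show "satisfiable M \<Delta>" using \<sigma> by (auto simp: satisfiable_def)
  qed
  then obtain \<sigma> where \<sigma>: "\<forall>v. \<sigma> v \<in> Dom M" "\<forall>\<phi>\<in>\<Gamma> \<union> range \<Theta>. sat M \<sigma> \<phi>"
    by (auto simp: satisfiable_def)
  have "\<exists>\<psi>\<in>D. sat M \<sigma> \<psi>" if "D \<in> \<D>" for D
  proof -
    obtain n where "D = from_nat_into \<D> n" using from_nat_into_to_nat_on[OF D \<open>D \<in> \<D>\<close>, symmetric] by blast
    moreover obtain \<psi> where "\<psi> \<in> from_nat_into \<D> n" "\<Theta> (Suc n) = And (\<Theta> n) \<psi>"
      using Q[of n] by (auto simp: Q_def)
    moreover have "sat M \<sigma> (\<Theta> (Suc n))" using \<sigma> by auto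
    ultimately show ?thesis by auto
  qed
  then show ?thesis using \<sigma> by (intro exI[of _ \<sigma>]) auto
qed

text \<open>
  Henkin's construction, with the variables in the role of the new constants. The values of a generic
  valuation form an elementary substructure, because it is dense to refute an existential formula or
  to name a witness for it by a fresh variable. Further dense sets are left open to the application.
\<close>

lemma henkin_submodel:
  fixes M :: "('a, 'f, 'r) fo_structure"
  assumes cL: "countable_language L" and str: "structure_for L M" and rt: "realizes_types L M"
    and \<Gamma>: "\<And>\<phi>. \<phi> \<in> \<Gamma> \<Longrightarrow> formula_of L \<phi> \<and> fvars \<phi> \<subseteq> {..<n}" "satisfiable M \<Gamma>"
    and D: "countable \<D>"
    and dense: "\<And>D \<theta>. D \<in> \<D> \<Longrightarrow> formula_of L \<theta> \<Longrightarrow> satisfiable M (insert \<theta> \<Gamma>) \<Longrightarrow>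
      \<exists>\<psi>\<in>D. formula_of L \<psi> \<and> satisfiable M (insert (And \<theta> \<psi>) \<Gamma>)"
  obtains \<sigma> where "\<And>v. \<sigma> v \<in> Dom M" "\<And>\<phi>. \<phi> \<in> \<Gamma> \<Longrightarrow> sat M \<sigma> \<phi>"
    "\<And>D. D \<in> \<D> \<Longrightarrow> \<exists>\<psi>\<in>D. sat M \<sigma> \<psi>"
    "structure_for L (M\<lparr>Dom := range \<sigma>\<rparr>)"
    "\<And>\<phi> \<tau>. formula_of L \<phi> \<Longrightarrow> (\<And>u. \<tau> u \<in> range \<sigma>) \<Longrightarrow>
       sat (M\<lparr>Dom := range \<sigma>\<rparr>) \<tau> \<phi> = sat M \<tau> \<phi>"
proof -
  \<comment> \<open>The condition that \<open>w\<close> names a witness is written with a quantifier to avoid substitution.\<close>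
  define W where "W = (\<lambda>(\<phi> :: ('f, 'r) fm, v).
    insert (Neg (Ex v \<phi>)) {Ex v (And (Eq (Var v) (Var w)) \<phi>) | w. w \<noteq> v})"
  define \<W> where "\<W> = W ` ({\<phi>. formula_of L \<phi>} \<times> UNIV)"
  have cW: "countable \<W>" unfolding \<W>_def using countable_formulas[OF cL] by (intro countable_image countable_SIGMA) auto
  have "\<exists>\<psi>\<in>D. formula_of L \<psi> \<and> satisfiable M (insert (And \<theta> \<psi>) \<Gamma>)"
    if DW: "D \<in> \<D> \<union> \<W>" and \<theta>: "formula_of L \<theta>" "satisfiable M (insert \<theta> \<Gamma>)" for D \<theta>
  proof (cases "D \<in> \<D>")
    case False
    then obtain \<phi> v where \<phi>: "formula_of L \<phi>" and D': "D = W (\<phi>, v)" using DW by (auto simp: \<W>_def)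
    obtain \<sigma> where \<sigma>: "\<forall>v. \<sigma> v \<in> Dom M" "\<forall>\<phi>\<in>insert \<theta> \<Gamma>. sat M \<sigma> \<phi>"
      using \<theta> by (auto simp: satisfiable_def)
    show ?thesis
    proof (cases "sat M \<sigma> (Ex v \<phi>)")
      case False
      then have "satisfiable M (insert (And \<theta> (Neg (Ex v \<phi>))) \<Gamma>)"
        using \<sigma> by (auto simp: satisfiable_def)
      then show ?thesis using D' \<phi> by (intro bexI[of _ "Neg (Ex v \<phi>)"]) (auto simp: W_def)
    next
      case True
      then obtain d where d: "d \<in> Dom M" "sat M (\<sigma>(v := d)) \<phi>" by auto
      obtain w where w: "w \<notin> fvars \<theta> \<union> fvars \<phi> \<union> {v} \<union> {..<n}"
        using ex_new_if_finite[OF infinite_UNIV_nat, of "fvars \<theta> \<union> fvars \<phi> \<union> {v} \<union> {..<n}"] by auto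
      have "sat M (\<sigma>(w := d)) \<theta> = sat M \<sigma> \<theta>" by (rule sat_cong) (use w in auto)
      moreover have "sat M (\<sigma>(w := d)) \<psi> = sat M \<sigma> \<psi>" if "\<psi> \<in> \<Gamma>" for \<psi>
        by (rule sat_cong) (use w \<Gamma>(1)[OF that] in auto)
      moreover have "sat M ((\<sigma>(w := d))(v := d)) \<phi> = sat M (\<sigma>(v := d)) \<phi>"
        by (rule sat_cong) (use w in auto)
      ultimately have "satisfiable M (insert (And \<theta> (Ex v (And (Eq (Var v) (Var w)) \<phi>))) \<Gamma>)"
        unfolding satisfiable_def using d \<sigma> w by (intro exI[of _ "\<sigma>(w := d)"]) auto
      then show ?thesis using D' \<phi> w
        by (intro bexI[of _ "Ex v (And (Eq (Var v) (Var w)) \<phi>)"]) (auto simp: W_def)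
    qed
  qed (use dense \<theta> in blast)
  from generic_valuation[OF rt conjunct1[OF \<Gamma>(1)] \<Gamma>(2) countable_Un[OF D cW] this]
  obtain \<sigma> where \<sigma>: "\<And>v. \<sigma> v \<in> Dom M" "\<And>\<phi>. \<phi> \<in> \<Gamma> \<Longrightarrow> sat M \<sigma> \<phi>"
    and meets: "\<And>D. D \<in> \<D> \<union> \<W> \<Longrightarrow> \<exists>\<psi>\<in>D. sat M \<sigma> \<psi>" by blast
  have wit: "\<exists>w. sat M (\<sigma>(v := \<sigma> w)) \<phi>" if \<phi>: "formula_of L \<phi>" and ex: "sat M \<sigma> (Ex v \<phi>)" for \<phi> v
  proof -
    have "W (\<phi>, v) \<in> \<D> \<union> \<W>" using \<phi> by (auto simp: \<W>_def)
    then show ?thesis using meets ex by (fastforce simp: W_def)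
  qed
  have tv: "\<exists>d\<in>range \<sigma>. sat M (\<tau>(v := d)) \<phi>"
    if \<phi>: "formula_of L \<phi>" and \<tau>: "\<And>u. \<tau> u \<in> range \<sigma>" and ex: "sat M \<tau> (Ex v \<phi>)" for \<phi> v \<tau>
  proof -
    have "\<forall>u. \<exists>i. \<tau> u = \<sigma> i" using \<tau> by auto
    then obtain g where g: "\<And>u. \<tau> u = \<sigma> (g u)" by metis
    define z where "z = Suc (Max (insert 0 (g ` fvars \<phi>)))"
    have z: "g u < z" if "u \<in> fvars \<phi>" for u using that by (simp add: z_def less_Suc_eq_le)
    have eq: "sat M (\<sigma>(z := d)) (ren (g(v := z)) \<phi>) = sat M (\<tau>(v := d)) \<phi>" for d
      unfolding sat_ren by (rule sat_cong) (use z g in fastforce)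
    have "sat M \<sigma> (Ex z (ren (g(v := z)) \<phi>))" using ex eq by simp
    then show ?thesis using wit[of "ren (g(v := z)) \<phi>" z] \<phi> eq by auto
  qed
  have sub: "range \<sigma> \<subseteq> Dom M" "range \<sigma> \<noteq> {}" using \<sigma> by auto
  show thesis
    by (rule that[OF \<sigma> meets tarski_vaught[OF str sub tv]]) auto
qed

text \<open>
  A type over the empty set, in the variables below \<open>n\<close>, is given by a valuation realizing it.
\<close>

definition type_of ::
    "('f, 'r) language \<Rightarrow> ('a, 'f, 'r) fo_structure \<Rightarrow> nat \<Rightarrow> (nat \<Rightarrow> 'a) \<Rightarrow> ('f, 'r) fm set" where
  "type_of L M n \<sigma> = {\<psi>. formula_of L \<psi> \<and> fvars \<psi> \<subseteq> {..<n} \<and> sat M \<sigma> \<psi>}"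

definition entails :: "('a, 'f, 'r) fo_structure \<Rightarrow> ('f, 'r) fm \<Rightarrow> ('f, 'r) fm \<Rightarrow> bool" where
  "entails M \<theta> \<psi> \<longleftrightarrow> (\<forall>\<tau>. (\<forall>v. \<tau> v \<in> Dom M) \<longrightarrow> sat M \<tau> \<theta> \<longrightarrow> sat M \<tau> \<psi>)"

text \<open>
  If the condition \<open>\<theta>\<close> already forces the variables \<open>ws\<close> to realize the type, then so does what \<open>\<theta>\<close>
  says about these variables alone, and this is a formula isolating the type. The variables of \<open>\<theta>\<close>
  are first moved away by \<open>n\<close>, to make room for the variables of the type.
\<close>

lemma isolated_if_not_omittable:
  fixes M :: "('a, 'f, 'r) fo_structure"
  assumes \<theta>: "formula_of L \<theta>" "satisfiable M {\<theta>}"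
    and ws: "length ws = n"
    and forced: "\<And>\<psi>. \<psi> \<in> type_of L M n \<sigma> \<Longrightarrow> entails M \<theta> (ren ((!) ws) \<psi>)"
  shows "\<exists>\<theta>'\<in>type_of L M n \<sigma>. \<forall>\<psi>\<in>type_of L M n \<sigma>. entails M \<theta>' \<psi>"
proof -
  define \<chi> :: "('f, 'r) fm" where
    "\<chi> = And (ren (\<lambda>u. u + n) \<theta>) (Conj (map (\<lambda>i. Eq (Var i) (Var (ws ! i + n))) [0..<n]))"
  obtain vs where vs: "set vs = fvars \<chi> - {..<n}" using finite_list[of "fvars \<chi> - {..<n}"] by auto
  define \<theta>' where "\<theta>' = foldr Ex vs \<chi>"
  have f: "formula_of L \<theta>'" using \<theta> by (auto simp: \<theta>'_def \<chi>_def)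
  have v: "fvars \<theta>' \<subseteq> {..<n}" using vs by (auto simp: \<theta>'_def)
  have sat_\<chi>: "sat M \<tau> \<chi> \<longleftrightarrow> sat M (\<tau> \<circ> (\<lambda>u. u + n)) \<theta> \<and> (\<forall>i<n. \<tau> i = \<tau> (ws ! i + n))" for \<tau>
    by (auto simp: \<chi>_def sat_ren)
  have ent: "entails M \<theta>' \<psi>" if \<psi>: "\<psi> \<in> type_of L M n \<sigma>" for \<psi>
    unfolding entails_def
  proof (intro allI impI)
    fix \<tau> assume \<tau>: "\<forall>v. \<tau> v \<in> Dom M" "sat M \<tau> \<theta>'"
    then obtain \<tau>' where \<tau>': "\<forall>v\<in>set vs. \<tau>' v \<in> Dom M" "\<forall>v. v \<notin> set vs \<longrightarrow> \<tau>' v = \<tau> v" "sat M \<tau>' \<chi>"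
      by (auto simp: \<theta>'_def sat_foldr_Ex)
    define \<rho> where "\<rho> = \<tau>' \<circ> (\<lambda>u. u + n)"
    have "\<rho> u \<in> Dom M" for u using \<tau> \<tau>' by (cases "u + n \<in> set vs") (auto simp: \<rho>_def)
    moreover have "sat M \<rho> \<theta>" using \<tau>' sat_\<chi> by (simp add: \<rho>_def)
    ultimately have "sat M \<rho> (ren ((!) ws) \<psi>)" using forced[OF \<psi>] unfolding entails_def by blast
    then have s: "sat M (\<rho> \<circ> (!) ws) \<psi>" by (simp only: sat_ren)
    have "\<rho> (ws ! i) = \<tau> i" if "i < n" for i
    proof -
      have "\<tau>' i = \<tau>' (ws ! i + n)" using \<tau>'(3) that sat_\<chi> by blast
      moreover have "\<tau>' i = \<tau> i" using \<tau>'(2) vs that by auto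
      ultimately show ?thesis by (simp add: \<rho>_def)
    qed
    then have "sat M (\<rho> \<circ> (!) ws) \<psi> = sat M \<tau> \<psi>"
      using \<psi> by (intro sat_cong) (auto simp: type_of_def)
    then show "sat M \<tau> \<psi>" using s by simp
  qed
  obtain \<rho> where \<rho>: "\<forall>v. \<rho> v \<in> Dom M" "sat M \<rho> \<theta>" using \<theta>(2) by (auto simp: satisfiable_def)
  define \<tau> where "\<tau> i = (if i < n then \<rho> (ws ! i) else \<rho> (i - n))" for i
  have \<tau>: "\<forall>v. \<tau> v \<in> Dom M" using \<rho> by (auto simp: \<tau>_def)
  have "\<tau> \<circ> (\<lambda>u. u + n) = \<rho>" by (auto simp: \<tau>_def)
  then have "sat M \<tau> \<chi>" unfolding sat_\<chi> using \<rho> by (auto simp: \<tau>_def)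
  then have st: "sat M \<tau> \<theta>'" unfolding \<theta>'_def sat_foldr_Ex using \<tau> by (intro exI[of _ \<tau>]) simp
  have "\<theta>' \<in> type_of L M n \<sigma>"
  proof (rule ccontr)
    assume "\<theta>' \<notin> type_of L M n \<sigma>"
    then have "Neg \<theta>' \<in> type_of L M n \<sigma>" using f v by (auto simp: type_of_def)
    then show False using ent st \<tau> unfolding entails_def by (metis sat.simps(3))
  qed
  then show ?thesis using ent by blast
qed

text \<open>
  The heart of the theorem of Ryll-Nardzewski. For a type that is not isolated, it is dense to omit it
  at any given tuple of variables. So some countable elementary submodel of \<open>M\<close> omits it, whereas
  another one contains a realization, and these two models cannot be isomorphic.
\<close>

lemma types_isolated:
  fixes N :: "(nat, 'f, 'r) fo_structure" and M :: "('a, 'f, 'r) fo_structure"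
  assumes cL: "countable_language L"
    and uniq: "\<And>N' :: (nat, 'f, 'r) fo_structure. elem_equiv L N N' \<Longrightarrow> isomorphic L N N'"
    and NM: "elem_equiv L N M" and rt: "realizes_types L M"
    and \<sigma>: "\<And>v. \<sigma> v \<in> Dom M"
  shows "\<exists>\<theta>\<in>type_of L M n \<sigma>. \<forall>\<psi>\<in>type_of L M n \<sigma>. entails M \<theta> \<psi>"
proof (rule ccontr)
  assume contr: "\<not> ?thesis"
  let ?p = "type_of L M n \<sigma>"
  have str: "structure_for L M" "structure_for L N" using NM by (auto simp: elem_equiv_def)
  have copy: "\<exists>h. bij_betw h (Dom N) (range \<rho>) \<and>
      (\<forall>\<phi> \<tau>. formula_of L \<phi> \<longrightarrow> (\<forall>u. \<tau> u \<in> Dom N) \<longrightarrow> sat N \<tau> \<phi> = sat M (h \<circ> \<tau>) \<phi>)"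
    if \<rho>: "\<And>v. \<rho> v \<in> Dom M" and sX: "structure_for L (M\<lparr>Dom := range \<rho>\<rparr>)"
      and el: "\<And>\<phi> \<tau>. formula_of L \<phi> \<Longrightarrow> (\<And>u. \<tau> u \<in> range \<rho>) \<Longrightarrow>
         sat (M\<lparr>Dom := range \<rho>\<rparr>) \<tau> \<phi> = sat M \<tau> \<phi>" for \<rho> :: "nat \<Rightarrow> 'a"
  proof -
    have "holds_at (M\<lparr>Dom := range \<rho>\<rparr>) \<phi> [] = holds_at M \<phi> []" if \<phi>: "sentence_of L \<phi>" for \<phi>
    proof -
      have "holds_at (M\<lparr>Dom := range \<rho>\<rparr>) \<phi> [] = sat (M\<lparr>Dom := range \<rho>\<rparr>) \<rho> \<phi>"
        "holds_at M \<phi> [] = sat M \<rho> \<phi>"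
        using holds_at_sentence[OF \<phi>] by blast+
      then show ?thesis using el[of \<phi> \<rho>] \<phi> by (simp add: sentence_of_def)
    qed
    then have "elem_equiv L N (M\<lparr>Dom := range \<rho>\<rparr>)"
      using NM sX str by (auto simp: elem_equiv_def)
    then obtain h where h: "bij_betw h (Dom N) (Dom (M\<lparr>Dom := range \<rho>\<rparr>))"
      "\<And>\<phi> \<tau>. formula_of L \<phi> \<Longrightarrow> (\<And>u. \<tau> u \<in> Dom N) \<Longrightarrow> sat N \<tau> \<phi> = sat (M\<lparr>Dom := range \<rho>\<rparr>) (h \<circ> \<tau>) \<phi>"
      using unique_countable_model[OF uniq, where S = "M\<lparr>Dom := range \<rho>\<rparr>"] by auto
    have "sat N \<tau> \<phi> = sat M (h \<circ> \<tau>) \<phi>" if "formula_of L \<phi>" "\<forall>u. \<tau> u \<in> Dom N" for \<phi> \<tau>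
    proof -
      have "(h \<circ> \<tau>) u \<in> range \<rho>" for u using h(1) that(2) by (auto simp: bij_betw_def)
      then show ?thesis using h(2)[of \<phi> \<tau>] el[of \<phi> "h \<circ> \<tau>"] that by blast
    qed
    then show ?thesis using h(1) by (intro exI[of _ h]) auto
  qed
  have sp: "satisfiable M ?p" using \<sigma> by (auto simp: satisfiable_def type_of_def)
  obtain \<rho>1 where \<rho>1: "\<And>v. \<rho>1 v \<in> Dom M" "\<And>\<phi>. \<phi> \<in> ?p \<Longrightarrow> sat M \<rho>1 \<phi>"
    and str1: "structure_for L (M\<lparr>Dom := range \<rho>1\<rparr>)"
    and el1: "\<And>\<phi> \<tau>. formula_of L \<phi> \<Longrightarrow> (\<And>u. \<tau> u \<in> range \<rho>1) \<Longrightarrow>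
         sat (M\<lparr>Dom := range \<rho>1\<rparr>) \<tau> \<phi> = sat M \<tau> \<phi>"
    using henkin_submodel[OF cL str(1) rt _ sp, where \<D> = "{}" and n = n]
    by (auto simp: type_of_def)
  obtain h1 where h1: "bij_betw h1 (Dom N) (range \<rho>1)"
    "\<And>\<phi> \<tau>. formula_of L \<phi> \<Longrightarrow> \<forall>u. \<tau> u \<in> Dom N \<Longrightarrow> sat N \<tau> \<phi> = sat M (h1 \<circ> \<tau>) \<phi>"
    using copy[OF \<rho>1(1) str1 el1] by blast
  define O' where "O' ws = (\<lambda>\<psi>. Neg (ren ((!) ws) \<psi>)) ` ?p" for ws
  define \<D> where "\<D> = O' ` {ws. length ws = n}"
  have cD: "countable \<D>" unfolding \<D>_def by (intro countable_image) auto
  have dense: "\<exists>\<psi>\<in>D. formula_of L \<psi> \<and> satisfiable M (insert (And \<theta> \<psi>) {})"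
    if D: "D \<in> \<D>" and \<theta>: "formula_of L \<theta>" "satisfiable M (insert \<theta> {})" for D \<theta>
  proof (rule ccontr)
    assume no: "\<not> ?thesis"
    obtain ws where ws: "length ws = n" "D = O' ws" using D by (auto simp: \<D>_def)
    have "entails M \<theta> (ren ((!) ws) \<psi>)" if \<psi>: "\<psi> \<in> ?p" for \<psi>
    proof -
      have "Neg (ren ((!) ws) \<psi>) \<in> D" "formula_of L (Neg (ren ((!) ws) \<psi>))"
        using \<psi> ws by (auto simp: O'_def type_of_def)
      then have "\<not> satisfiable M {And \<theta> (Neg (ren ((!) ws) \<psi>))}" using no by blast
      then show ?thesis by (auto simp: satisfiable_def entails_def)
    qed
    then show False using isolated_if_not_omittable[OF \<theta> ws(1), of \<sigma>] contr by blast
  qed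
  have "satisfiable M {}" using \<sigma> by (auto simp: satisfiable_def)
  then obtain \<rho>2 where \<rho>2: "\<And>v. \<rho>2 v \<in> Dom M" and omit: "\<And>D. D \<in> \<D> \<Longrightarrow> \<exists>\<psi>\<in>D. sat M \<rho>2 \<psi>"
    and str2: "structure_for L (M\<lparr>Dom := range \<rho>2\<rparr>)"
    and el2: "\<And>\<phi> \<tau>. formula_of L \<phi> \<Longrightarrow> (\<And>u. \<tau> u \<in> range \<rho>2) \<Longrightarrow>
         sat (M\<lparr>Dom := range \<rho>2\<rparr>) \<tau> \<phi> = sat M \<tau> \<phi>"
    using henkin_submodel[OF cL str(1) rt _ _ cD dense, where n = n] by (auto simp del: Sup_insert)
  obtain h2 where h2: "bij_betw h2 (Dom N) (range \<rho>2)"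
    "\<And>\<phi> \<tau>. formula_of L \<phi> \<Longrightarrow> \<forall>u. \<tau> u \<in> Dom N \<Longrightarrow> sat N \<tau> \<phi> = sat M (h2 \<circ> \<tau>) \<phi>"
    using copy[OF \<rho>2(1) str2 el2] by blast
  define \<tau> where "\<tau> = inv_into (Dom N) h1 \<circ> \<rho>1"
  have h1\<tau>: "h1 \<circ> \<tau> = \<rho>1"
    using h1(1) by (auto simp: \<tau>_def bij_betw_inv_into_right)
  have \<tau>: "\<forall>u. \<tau> u \<in> Dom N"
    using h1(1) unfolding \<tau>_def by (metis bij_betw_def comp_apply inv_into_into rangeI)
  have "\<forall>u. \<exists>i. (h2 \<circ> \<tau>) u = \<rho>2 i" using \<tau> h2(1) by (auto simp: bij_betw_def)
  then obtain g where g: "\<And>u. (h2 \<circ> \<tau>) u = \<rho>2 (g u)" by metis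
  have "O' (map g [0..<n]) \<in> \<D>" by (auto simp: \<D>_def)
  then obtain \<psi> where \<psi>: "\<psi> \<in> ?p" "\<not> sat M (\<rho>2 \<circ> (!) (map g [0..<n])) \<psi>"
    using omit by (fastforce simp: O'_def sat_ren)
  have "sat M (\<rho>2 \<circ> (!) (map g [0..<n])) \<psi> = sat M (h2 \<circ> \<tau>) \<psi>"
    using \<psi> g by (intro sat_cong) (auto simp: type_of_def subset_iff)
  also have "\<dots> = sat M \<rho>1 \<psi>"
    using h1(2)[of \<psi> \<tau>] h2(2)[of \<psi> \<tau>] \<tau> \<psi> h1\<tau> by (auto simp: type_of_def)
  finally show False using \<rho>1(2) \<psi> by blast
qed

text \<open>
  Finitely many isolating formulas cover the structure, and a formula is determined up to
  equivalence by those among them that entail it.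
\<close>

lemma finitely_many_formulas:
  fixes N :: "(nat, 'f, 'r) fo_structure" and M :: "('a, 'f, 'r) fo_structure"
  assumes cL: "countable_language L"
    and uniq: "\<And>N' :: (nat, 'f, 'r) fo_structure. elem_equiv L N N' \<Longrightarrow> isomorphic L N N'"
    and NM: "elem_equiv L N M" and rt: "realizes_types L M"
  obtains \<Theta> where "finite \<Theta>"
    "\<And>\<psi> \<psi>' \<tau>. formula_of L \<psi> \<Longrightarrow> fvars \<psi> \<subseteq> {..<n} \<Longrightarrow> formula_of L \<psi>' \<Longrightarrow> fvars \<psi>' \<subseteq> {..<n} \<Longrightarrow>
      {\<theta> \<in> \<Theta>. entails M \<theta> \<psi>} = {\<theta> \<in> \<Theta>. entails M \<theta> \<psi>'} \<Longrightarrow> (\<And>v. \<tau> v \<in> Dom M) \<Longrightarrow>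
      sat M \<tau> \<psi> \<Longrightarrow> sat M \<tau> \<psi>'"
proof -
  define S where "S = {\<theta>. \<exists>\<sigma>. (\<forall>v. \<sigma> v \<in> Dom M) \<and> \<theta> \<in> type_of L M n \<sigma> \<and> (\<forall>\<psi>\<in>type_of L M n \<sigma>. entails M \<theta> \<psi>)}"
  have "\<not> satisfiable M (Neg ` S)"
  proof
    assume "satisfiable M (Neg ` S)"
    then obtain \<sigma> where \<sigma>: "\<And>v. \<sigma> v \<in> Dom M" "\<And>\<theta>. \<theta> \<in> S \<Longrightarrow> \<not> sat M \<sigma> \<theta>"
      by (auto simp: satisfiable_def)
    obtain \<theta> where "\<theta> \<in> type_of L M n \<sigma>" "\<forall>\<psi>\<in>type_of L M n \<sigma>. entails M \<theta> \<psi>"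
      using types_isolated[OF cL uniq NM rt, where \<sigma> = \<sigma> and n = n] \<sigma>(1) by blast
    then have "\<theta> \<in> S" "sat M \<sigma> \<theta>" using \<sigma>(1) by (auto simp: S_def type_of_def)
    then show False using \<sigma>(2) by blast
  qed
  moreover have "\<forall>\<phi>\<in>Neg ` S. formula_of L \<phi>" by (auto simp: S_def type_of_def)
  ultimately have "\<not> (\<forall>\<Delta>. finite \<Delta> \<and> \<Delta> \<subseteq> Neg ` S \<longrightarrow> satisfiable M \<Delta>)"
    using rt[unfolded realizes_types_def, THEN spec[of _ "Neg ` S"]] by blast
  then obtain \<Delta> where \<Delta>: "finite \<Delta>" "\<Delta> \<subseteq> Neg ` S" "\<not> satisfiable M \<Delta>"
    by auto
  then obtain \<Theta> where \<Theta>: "finite \<Theta>" "\<Theta> \<subseteq> S" "\<Delta> = Neg ` \<Theta>" by (meson finite_subset_image)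
  show thesis
  proof (rule that[OF \<Theta>(1)])
    fix \<psi> \<psi>' :: "('f, 'r) fm" and \<tau>
    assume \<psi>: "formula_of L \<psi>" "fvars \<psi> \<subseteq> {..<n}"
      and eq: "{\<theta> \<in> \<Theta>. entails M \<theta> \<psi>} = {\<theta> \<in> \<Theta>. entails M \<theta> \<psi>'}"
      and \<tau>: "\<And>v. \<tau> v \<in> Dom M" "sat M \<tau> \<psi>"
    have "\<exists>\<theta>\<in>\<Theta>. sat M \<tau> \<theta>" using \<Delta>(3) \<Theta>(3) \<tau>(1) by (auto simp: satisfiable_def)
    then obtain \<theta> where \<theta>: "\<theta> \<in> \<Theta>" "sat M \<tau> \<theta>" by blast
    then obtain \<sigma> where \<sigma>: "\<forall>v. \<sigma> v \<in> Dom M" "\<theta> \<in> type_of L M n \<sigma>" "\<forall>\<psi>\<in>type_of L M n \<sigma>. entails M \<theta> \<psi>"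
      using \<Theta>(2) by (auto simp: S_def)
    have "\<psi> \<in> type_of L M n \<sigma>"
    proof (rule ccontr)
      assume "\<psi> \<notin> type_of L M n \<sigma>"
      then have "Neg \<psi> \<in> type_of L M n \<sigma>" using \<psi> by (auto simp: type_of_def)
      then have "entails M \<theta> (Neg \<psi>)" using \<sigma> by blast
      then show False using \<theta> \<tau> by (auto simp: entails_def)
    qed
    then have "entails M \<theta> \<psi>'" using \<sigma>(3) \<theta>(1) eq by blast
    then show "sat M \<tau> \<psi>'" using \<theta> \<tau> by (auto simp: entails_def)
  qed
qed

section \<open>Consequences of countable categoricity\<close>

text \<open>
  The monster model is an ultrapower of the countable model over the natural numbers. Its elements are
  coded by sets of natural numbers, as the definition of the tree property demands.
\<close>

lemma monster_model_exists:
  assumes cL: "countable_language L" and str: "structure_for L R" and oc: "omega_categorical L R"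
  obtains N :: "(nat, 'f, 'r) fo_structure" and M :: "(nat set, 'f, 'r) fo_structure"
  where "elem_equiv L R N"
    "\<And>N' :: (nat, 'f, 'r) fo_structure. elem_equiv L N N' \<Longrightarrow> isomorphic L N N'"
    "elem_equiv L N M" "aleph1_saturated L M" "realizes_types L M"
proof -
  obtain N :: "(nat, 'f, 'r) fo_structure" where N: "elem_equiv L R N"
    and uniq: "\<And>N' :: (nat, 'f, 'r) fo_structure. elem_equiv L R N' \<Longrightarrow> isomorphic L N N'"
    using oc unfolding omega_categorical_def omega_categorical_theory_def
      model_of_complete_theory_iff[OF str] by blast
  obtain U :: "nat filter" where U: "U \<noteq> bot" "U \<le> sequentially"
    "\<And>P. eventually P U \<or> eventually (\<lambda>k. \<not> P k) U"
    using ex_ultrafilter by blast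
  interpret ultrapower L N U
    using N U by unfold_locales (auto simp: elem_equiv_def)
  have "realizes_types L M"
    unfolding realizes_types_def
  proof (intro allI impI)
    fix \<Gamma> :: "('f, 'r) fm set"
    assume \<Gamma>: "\<forall>\<phi>\<in>\<Gamma>. formula_of L \<phi>" "\<forall>\<Delta>. finite \<Delta> \<and> \<Delta> \<subseteq> \<Gamma> \<longrightarrow> satisfiable M \<Delta>"
    show "satisfiable M \<Gamma>"
    proof (rule realizes)
      show "countable \<Gamma>"
        by (rule countable_subset[OF _ countable_formulas[OF cL]]) (use \<Gamma> in auto)
      show "formula_of L \<phi>" if "\<phi> \<in> \<Gamma>" for \<phi> using \<Gamma> that by auto
      show "satisfiable N \<Delta>" if \<Delta>: "finite \<Delta>" "\<Delta> \<subseteq> \<Gamma>" for \<Delta>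
        by (rule satisfiable_transfer[OF elem_equiv_sym[OF elem_equiv_M] \<Delta>(1)]) (use \<Gamma> \<Delta> in auto)
    qed
  qed
  moreover have "isomorphic L N N'" if "elem_equiv L N N'" for N' :: "(nat, 'f, 'r) fo_structure"
    using uniq elem_equiv_trans[OF N that] by blast
  ultimately show thesis using that N elem_equiv_M saturated[OF cL] by blast
qed

lemma formula_classes:
  assumes cL: "countable_language L" and str: "structure_for L R" and oc: "omega_categorical L R"
  obtains K :: "('f, 'r) fm \<Rightarrow> ('f, 'r) fm set" where "finite (range K)"
    "\<And>\<psi> \<psi>' \<tau>. formula_of L \<psi> \<Longrightarrow> fvars \<psi> \<subseteq> {..<n} \<Longrightarrow> formula_of L \<psi>' \<Longrightarrow> fvars \<psi>' \<subseteq> {..<n} \<Longrightarrow>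
      K \<psi> = K \<psi>' \<Longrightarrow> \<forall>v. \<tau> v \<in> Dom R \<Longrightarrow> sat R \<tau> \<psi> = sat R \<tau> \<psi>'"
proof -
  obtain N :: "(nat, 'f, 'r) fo_structure" and M :: "(nat set, 'f, 'r) fo_structure"
    where N: "elem_equiv L R N"
      and uniq: "\<And>N' :: (nat, 'f, 'r) fo_structure. elem_equiv L N N' \<Longrightarrow> isomorphic L N N'"
      and M: "elem_equiv L N M" "realizes_types L M"
    using monster_model_exists[OF cL str oc] by metis
  obtain \<Theta> where \<Theta>: "finite \<Theta>"
    and det: "\<And>\<psi> \<psi>' \<tau>. formula_of L \<psi> \<Longrightarrow> fvars \<psi> \<subseteq> {..<n} \<Longrightarrow> formula_of L \<psi>' \<Longrightarrow> fvars \<psi>' \<subseteq> {..<n} \<Longrightarrow>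
      {\<theta> \<in> \<Theta>. entails M \<theta> \<psi>} = {\<theta> \<in> \<Theta>. entails M \<theta> \<psi>'} \<Longrightarrow> (\<And>v. \<tau> v \<in> Dom M) \<Longrightarrow>
      sat M \<tau> \<psi> \<Longrightarrow> sat M \<tau> \<psi>'"
    by (rule finitely_many_formulas[OF cL uniq M, of n], assumption, rule that, assumption, blast)
  define K where "K \<psi> = {\<theta> \<in> \<Theta>. entails M \<theta> \<psi>}" for \<psi>
  have RM: "elem_equiv L R M" using elem_equiv_trans[OF N M(1)] .
  have imp: "sat R \<tau> \<psi>'"
    if \<psi>: "formula_of L \<psi>" "fvars \<psi> \<subseteq> {..<n}" "formula_of L \<psi>'" "fvars \<psi>' \<subseteq> {..<n}"
      and eq: "K \<psi> = K \<psi>'" and \<tau>: "\<forall>v. \<tau> v \<in> Dom R" and s: "sat R \<tau> \<psi>" for \<psi> \<psi>' \<tau>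
  proof (rule ccontr)
    assume "\<not> sat R \<tau> \<psi>'"
    then have "satisfiable R {\<psi>, Neg \<psi>'}" using \<tau> s by (auto simp: satisfiable_def)
    then have "satisfiable M {\<psi>, Neg \<psi>'}"
      using \<psi> by (intro satisfiable_transfer[OF RM]) auto
    then obtain \<rho> where "\<And>v. \<rho> v \<in> Dom M" "sat M \<rho> \<psi>" "\<not> sat M \<rho> \<psi>'"
      by (auto simp: satisfiable_def)
    then show False using det[OF \<psi> eq[unfolded K_def], of \<rho>] by blast
  qed
  have "range K \<subseteq> Pow \<Theta>" by (auto simp: K_def)
  then have "finite (range K)" using \<Theta> by (meson finite_Pow_iff finite_subset)
  then show thesis using that[of K] imp by metis
qed

lemma formula_pigeonhole:
  fixes R :: "('a, 'f, 'r) fo_structure" and \<phi> :: "nat \<Rightarrow> ('f, 'r) fm"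
  assumes cL: "countable_language L" and str: "structure_for L R" and oc: "omega_categorical L R"
    and \<phi>: "\<And>i. formula_of L (\<phi> i)" "\<And>i. fvars (\<phi> i) \<subseteq> {..<n}"
  obtains i j where "i < j" "\<And>\<tau>. \<forall>v. \<tau> v \<in> Dom R \<Longrightarrow> sat R \<tau> (\<phi> i) = sat R \<tau> (\<phi> j)"
proof -
  obtain K :: "('f, 'r) fm \<Rightarrow> ('f, 'r) fm set" where K: "finite (range K)"
    and det: "\<And>\<psi> \<psi>' \<tau>. formula_of L \<psi> \<Longrightarrow> fvars \<psi> \<subseteq> {..<n} \<Longrightarrow> formula_of L \<psi>' \<Longrightarrow> fvars \<psi>' \<subseteq> {..<n} \<Longrightarrow>
      K \<psi> = K \<psi>' \<Longrightarrow> \<forall>v. \<tau> v \<in> Dom R \<Longrightarrow> sat R \<tau> \<psi> = sat R \<tau> \<psi>'"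
    by (rule formula_classes[OF cL str oc, of n]) (rule that)
  have "finite (range (K \<circ> \<phi>))" using K by (rule finite_subset[rotated]) auto
  then have "\<not> inj (K \<circ> \<phi>)" using finite_imageD infinite_UNIV_nat by blast
  then obtain i j where "i \<noteq> j" "K (\<phi> i) = K (\<phi> j)" by (auto simp: inj_def)
  then have "\<exists>i j. i < j \<and> K (\<phi> i) = K (\<phi> j)" by (metis nat_neq_iff)
  then obtain i j where ij: "i < j" "K (\<phi> i) = K (\<phi> j)" by blast
  show thesis by (rule that[OF ij(1) det[OF \<phi> \<phi> ij(2)]])
qed

definition definable :: "('f, 'r) language \<Rightarrow> ('a, 'f, 'r) fo_structure \<Rightarrow> 'a set \<Rightarrow> bool" where
  "definable L M D \<longleftrightarrow>
     (\<exists>\<phi>. formula_of L \<phi> \<and> fvars \<phi> \<subseteq> {0} \<and> D = {d \<in> Dom M. sat M (\<lambda>_. d) \<phi>})"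

lemma finite_definable:
  fixes R :: "('a, 'f, 'r) fo_structure"
  assumes cL: "countable_language L" and str: "structure_for L R" and oc: "omega_categorical L R"
  shows "finite {D. definable L R D}"
proof -
  obtain K :: "('f, 'r) fm \<Rightarrow> ('f, 'r) fm set" where K: "finite (range K)"
    and det: "\<And>\<psi> \<psi>' \<tau>. formula_of L \<psi> \<Longrightarrow> fvars \<psi> \<subseteq> {..<1} \<Longrightarrow> formula_of L \<psi>' \<Longrightarrow> fvars \<psi>' \<subseteq> {..<1} \<Longrightarrow>
      K \<psi> = K \<psi>' \<Longrightarrow> \<forall>v. \<tau> v \<in> Dom R \<Longrightarrow> sat R \<tau> \<psi> = sat R \<tau> \<psi>'"
    by (rule formula_classes[OF cL str oc, of 1]) (rule that)
  have l1: "{..<1::nat} = {0}" by auto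
  define F where "F = {\<phi>. formula_of L \<phi> \<and> fvars \<phi> \<subseteq> {0}}"
  define E where "E \<phi> = {d \<in> Dom R. sat R (\<lambda>_. d) \<phi>}" for \<phi>
  define G where "G k = E (SOME \<phi>. \<phi> \<in> F \<and> K \<phi> = k)" for k
  have "E \<phi> = G (K \<phi>)" if \<phi>: "\<phi> \<in> F" for \<phi>
  proof -
    define \<phi>' where "\<phi>' = (SOME \<phi>'. \<phi>' \<in> F \<and> K \<phi>' = K \<phi>)"
    have "\<phi>' \<in> F \<and> K \<phi>' = K \<phi>" unfolding \<phi>'_def by (rule someI[of _ \<phi>]) (use \<phi> in auto)
    then have "sat R (\<lambda>_. d) \<phi> = sat R (\<lambda>_. d) \<phi>'" if "d \<in> Dom R" for d
      using \<phi> that by (intro det) (auto simp: F_def l1)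
    then show ?thesis unfolding G_def \<phi>'_def[symmetric] E_def by auto
  qed
  then have "{D. definable L R D} \<subseteq> G ` range K"
    by (auto simp: definable_def F_def E_def)
  then show ?thesis using K by (meson finite_imageI finite_subset)
qed

lemma sat_ren_list:
  assumes "fvars \<phi> \<subseteq> {..<length vs}"
  shows "sat M \<sigma> (ren ((!) vs) \<phi>) \<longleftrightarrow> holds_at M \<phi> (map \<sigma> vs)"
  unfolding sat_ren holds_at_def by (rule sat_cong) (use assms in \<open>auto simp: subset_iff\<close>)

section \<open>Definable sets in rings\<close>

text \<open>
  Substitution of a term for the variable 0 of a formula without other free variables. It is
  expressed by a quantifier over a fresh variable, so that no capture has to be considered.
\<close>

definition inst :: "('f, 'r) fm \<Rightarrow> 'f tm \<Rightarrow> ('f, 'r) fm" where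
  "inst \<phi> t = (let z = Suc (Max (insert 0 (tvars t))) in Ex z (And (Eq (Var z) t) (ren (\<lambda>_. z) \<phi>)))"

lemma sat_inst:
  assumes "tval M \<sigma> t \<in> Dom M"
  shows "sat M \<sigma> (inst \<phi> t) \<longleftrightarrow> sat M (\<lambda>_. tval M \<sigma> t) \<phi>"
proof -
  define z where "z = Suc (Max (insert 0 (tvars t)))"
  have z: "v < z" if "v \<in> tvars t" for v using that by (simp add: z_def less_Suc_eq_le)
  have t: "tval M (\<sigma>(z := d)) t = tval M \<sigma> t" for d
    by (rule tval_cong) (use z in fastforce)
  have c: "(\<sigma>(z := d)) \<circ> (\<lambda>_. z) = (\<lambda>_. d)" for d by auto
  have "sat M \<sigma> (inst \<phi> t) \<longleftrightarrow> (\<exists>d\<in>Dom M. d = tval M \<sigma> t \<and> sat M (\<lambda>_. d) \<phi>)"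
    unfolding inst_def z_def[symmetric] Let_def sat.simps sat_ren t c by simp
  then show ?thesis using assms by auto
qed

lemma formula_of_inst [simp]: "formula_of L (inst \<phi> t) \<longleftrightarrow> term_of L t \<and> formula_of L \<phi>"
  by (simp add: inst_def Let_def)

lemma fvars_inst: "fvars (inst \<phi> t) \<subseteq> tvars t"
proof -
  have "fvars (ren (\<lambda>_. z) \<phi>) \<subseteq> {z}" for z using fvars_ren[of "\<lambda>_. z" \<phi>] by auto
  then show ?thesis by (auto simp: inst_def Let_def)
qed

text \<open>
  As there are only finitely many definable sets, this is the union of finitely many of them.
\<close>

lemma definable_UN:
  assumes "finite {D. definable L R D}" "\<And>i. definable L R (A i)" "structure_for L R"
  shows "definable L R (\<Union>i. A i)"
proof -
  have Un: "definable L R (D \<union> E)" if DE: "definable L R D" "definable L R E" for D E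
  proof -
    obtain \<phi> \<psi> where "formula_of L \<phi>" "fvars \<phi> \<subseteq> {0}" "D = {d \<in> Dom R. sat R (\<lambda>_. d) \<phi>}"
      "formula_of L \<psi>" "fvars \<psi> \<subseteq> {0}" "E = {d \<in> Dom R. sat R (\<lambda>_. d) \<psi>}"
      using DE unfolding definable_def by blast
    then show ?thesis unfolding definable_def
      by (intro exI[of _ "Neg (And (Neg \<phi>) (Neg \<psi>))"]) auto
  qed
  have "definable L R (\<Union>\<D>)" if "finite \<D>" "\<D> \<noteq> {}" "\<forall>D\<in>\<D>. definable L R D" for \<D>
    using that by (induction rule: finite_ne_induct) (auto intro: Un)
  moreover have "finite (range A)" by (rule finite_subset[OF _ assms(1)]) (use assms(2) in auto)
  ultimately show ?thesis using assms(2) by auto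
qed

locale ring_model =
  fixes L :: "('f ring_sym, 'r) language" and R :: "('a, 'f ring_sym, 'r) fo_structure"
  assumes rs: "ring_structure L R"
begin

abbreviation A :: "'a ring" where "A \<equiv> ring_reduct R"

lemma str: "structure_for L R" using rs by (simp add: ring_structure_def)

sublocale rng A using rs by (simp add: ring_structure_def)

lemma symbols: "(Zero, 0) \<in> Funs L" "(Plus, 2) \<in> Funs L" "(Minus, 1) \<in> Funs L" "(Times, 2) \<in> Funs L"
  using rs by (auto simp: ring_structure_def ring_symbols_def)

lemma carrier_A: "carrier A = Dom R" by (simp add: ring_reduct_def)

lemma terms:
  "tval R \<sigma> (Fun Zero []) = \<zero>\<^bsub>A\<^esub>"
  "tval R \<sigma> (Fun Plus [s, t]) = tval R \<sigma> s \<oplus>\<^bsub>A\<^esub> tval R \<sigma> t"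
  "tval R \<sigma> (Fun Times [s, t]) = tval R \<sigma> s \<otimes>\<^bsub>A\<^esub> tval R \<sigma> t"
  "tval R \<sigma> s \<in> Dom R \<Longrightarrow> tval R \<sigma> (Fun Minus [s]) = \<ominus>\<^bsub>A\<^esub> tval R \<sigma> s"
  using rs by (auto simp: ring_structure_def) (auto simp: ring_reduct_def)

lemma term_of_ring [simp]:
  "term_of L (Fun Zero [])" "term_of L (Fun Plus [s, t]) = (term_of L s \<and> term_of L t)"
  "term_of L (Fun Times [s, t]) = (term_of L s \<and> term_of L t)"
  "term_of L (Fun Minus [s]) = term_of L s"
  using symbols by (auto simp: numeral_2_eq_2)

lemma definable_zero: "definable L R {\<zero>\<^bsub>A\<^esub>}"
  unfolding definable_def
  by (intro exI[of _ "Eq (Var 0) (Fun Zero [])"])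
     (use zero_closed in \<open>auto simp del: tval.simps(2) simp: terms carrier_A[symmetric] simp del: term_of.simps(2)\<close>)

lemma definable_sum:
  assumes "definable L R D" "definable L R E"
  shows "definable L R {d \<oplus>\<^bsub>A\<^esub> e | d e. d \<in> D \<and> e \<in> E}"
proof -
  obtain \<phi> \<psi> where \<phi>: "formula_of L \<phi>" "fvars \<phi> \<subseteq> {0}" and D: "D = {d \<in> Dom R. sat R (\<lambda>_. d) \<phi>}"
    and \<psi>: "formula_of L \<psi>" "fvars \<psi> \<subseteq> {0}" and E: "E = {d \<in> Dom R. sat R (\<lambda>_. d) \<psi>}"
    using assms unfolding definable_def by blast
  define \<chi> :: "('f ring_sym, 'r) fm" where
    "\<chi> = Ex 1 (Ex 2 (And (And (inst \<phi> (Var 1)) (inst \<psi> (Var 2))) (Eq (Var 0) (Fun Plus [Var 1, Var 2]))))"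
  have "formula_of L \<chi>" using \<phi> \<psi> by (simp add: \<chi>_def del: term_of.simps(2))
  moreover have "fvars \<chi> \<subseteq> {0}"
    using fvars_inst[of \<phi> "Var 1"] fvars_inst[of \<psi> "Var 2"] by (auto simp: \<chi>_def)
  moreover have "sat R (\<lambda>_. d) \<chi> \<longleftrightarrow> (\<exists>x\<in>D. \<exists>y\<in>E. d = x \<oplus>\<^bsub>A\<^esub> y)" for d
    unfolding \<chi>_def sat.simps terms D E by (auto simp: sat_inst)
  moreover have "x \<oplus>\<^bsub>A\<^esub> y \<in> Dom R" if "x \<in> D" "y \<in> E" for x y
    using that add.m_closed[of x y] by (auto simp: D E carrier_A)
  ultimately show ?thesis unfolding definable_def by (intro exI[of _ \<chi>]) auto
qed

lemma definable_square_zero: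
  assumes "definable L R Q"
  shows "definable L R {c \<in> carrier A. c \<otimes>\<^bsub>A\<^esub> c \<in> Q \<and> (\<forall>x\<in>carrier A. c \<otimes>\<^bsub>A\<^esub> x \<otimes>\<^bsub>A\<^esub> c \<in> Q)}"
proof -
  obtain \<phi> where \<phi>: "formula_of L \<phi>" "fvars \<phi> \<subseteq> {0}" and Q: "Q = {d \<in> Dom R. sat R (\<lambda>_. d) \<phi>}"
    using assms unfolding definable_def by blast
  define s :: "'f ring_sym tm" where "s = Fun Times [Var 0, Var 0]"
  define t :: "'f ring_sym tm" where "t = Fun Times [Fun Times [Var 0, Var 1], Var 0]"
  define \<chi> where "\<chi> = And (inst \<phi> s) (Neg (Ex 1 (Neg (inst \<phi> t))))"
  have "formula_of L \<chi>" using \<phi> by (simp add: \<chi>_def s_def t_def del: term_of.simps(2))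
  moreover have "fvars \<chi> \<subseteq> {0}"
    using fvars_inst[of \<phi> s] fvars_inst[of \<phi> t] by (auto simp: \<chi>_def s_def t_def)
  moreover have "sat R (\<lambda>_. c) \<chi> \<longleftrightarrow> c \<otimes>\<^bsub>A\<^esub> c \<in> Q \<and> (\<forall>x\<in>carrier A. c \<otimes>\<^bsub>A\<^esub> x \<otimes>\<^bsub>A\<^esub> c \<in> Q)"
    if c: "c \<in> carrier A" for c
  proof -
    have 1: "tval R (\<lambda>_. c) s = c \<otimes>\<^bsub>A\<^esub> c" by (simp only: s_def terms) simp
    have 2: "tval R ((\<lambda>_. c)(1 := x)) t = c \<otimes>\<^bsub>A\<^esub> x \<otimes>\<^bsub>A\<^esub> c" for x by (simp only: t_def terms) simp
    have 3: "c \<otimes>\<^bsub>A\<^esub> c \<in> Dom R" using c m_closed[OF c c] by (simp add: carrier_A)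
    have 4: "c \<otimes>\<^bsub>A\<^esub> x \<otimes>\<^bsub>A\<^esub> c \<in> Dom R" if "x \<in> Dom R" for x
      using c that m_closed by (simp add: carrier_A)
    have "sat R (\<lambda>_. c) (inst \<phi> s) \<longleftrightarrow> c \<otimes>\<^bsub>A\<^esub> c \<in> Q"
      using 3 by (simp add: sat_inst 1 Q)
    moreover have "sat R ((\<lambda>_. c)(1 := x)) (inst \<phi> t) \<longleftrightarrow> c \<otimes>\<^bsub>A\<^esub> x \<otimes>\<^bsub>A\<^esub> c \<in> Q" if "x \<in> Dom R" for x
      unfolding sat_inst[of R "(\<lambda>_. c)(1 := x)" t \<phi>, unfolded 2, OF 4[OF that]] Q
      using 4[OF that] by blast
    ultimately show ?thesis unfolding \<chi>_def sat.simps carrier_A by blast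
  qed
  ultimately show ?thesis unfolding definable_def carrier_A by (intro exI[of _ \<chi>]) auto
qed

end

text \<open>
  An array that, with \<open>Q\<close> definable, is a finite piece of an instance of the tree property of the
  second kind for the formula \<open>u x v - b \<in> Q\<close>: the elements \<open>x i j\<close> of one row are separated modulo
  \<open>Q\<close> by \<open>x \<mapsto> u i x v i\<close>, whereas the maps belonging to the other rows do not see them.
\<close>

definition separating_array ::
    "('a, 'm) ring_scheme \<Rightarrow> 'a set \<Rightarrow> nat \<Rightarrow> (nat \<Rightarrow> 'a) \<Rightarrow> (nat \<Rightarrow> 'a) \<Rightarrow> (nat \<Rightarrow> nat \<Rightarrow> 'a) \<Rightarrow> bool" where
  "separating_array A Q n u v x \<longleftrightarrow>
     (\<forall>i<n. u i \<in> carrier A \<and> v i \<in> carrier A \<and> (\<forall>j<n. x i j \<in> carrier A)) \<and>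
     (\<forall>i<n. \<forall>l<n. \<forall>j<n. l \<noteq> i \<longrightarrow> u i \<otimes>\<^bsub>A\<^esub> x l j \<otimes>\<^bsub>A\<^esub> v i \<in> Q) \<and>
     (\<forall>i<n. \<forall>j<n. \<forall>j'<n. j \<noteq> j' \<longrightarrow>
        u i \<otimes>\<^bsub>A\<^esub> x i j \<otimes>\<^bsub>A\<^esub> v i \<ominus>\<^bsub>A\<^esub> u i \<otimes>\<^bsub>A\<^esub> x i j' \<otimes>\<^bsub>A\<^esub> v i \<notin> Q)"

context rng begin

lemma sandwich_add:
  "\<lbrakk>u \<in> carrier R; v \<in> carrier R; x \<in> carrier R; y \<in> carrier R\<rbrakk> \<Longrightarrow>
    u \<otimes> (x \<oplus> y) \<otimes> v = u \<otimes> x \<otimes> v \<oplus> u \<otimes> y \<otimes> v"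
  by (simp add: r_distr l_distr m_closed)

lemma l_null [simp]: "x \<in> carrier R \<Longrightarrow> \<zero> \<otimes> x = \<zero>"
proof -
  assume x: "x \<in> carrier R"
  then have "\<zero> \<otimes> x \<oplus> \<zero> \<otimes> x = \<zero> \<otimes> x \<oplus> \<zero>"
    using l_distr[of \<zero> \<zero> x] m_closed by simp
  then show ?thesis using x m_closed by (simp del: r_zero)
qed

lemma r_null [simp]: "x \<in> carrier R \<Longrightarrow> x \<otimes> \<zero> = \<zero>"
proof -
  assume x: "x \<in> carrier R"
  then have "x \<otimes> \<zero> \<oplus> x \<otimes> \<zero> = x \<otimes> \<zero> \<oplus> \<zero>"
    using r_distr[of \<zero> \<zero> x] m_closed by simp
  then show ?thesis using x m_closed by (simp del: r_zero)
qed

text \<open>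
  A path \<open>s\<close> picks at most one element from each row; their sum realizes the path, since the map of row
  \<open>i\<close> does not see the summands from other rows.
\<close>

lemma separating_array_path:
  assumes Q: "additive_subgroup Q R" and arr: "separating_array R Q n u v x"
    and s: "distinct (map fst s)" "set s \<subseteq> {..<n} \<times> {..<n}"
  shows "\<exists>z\<in>carrier R. (\<forall>(i, j)\<in>set s. u i \<otimes> z \<otimes> v i \<ominus> u i \<otimes> x i j \<otimes> v i \<in> Q) \<and>
    (\<forall>i<n. i \<notin> fst ` set s \<longrightarrow> u i \<otimes> z \<otimes> v i \<in> Q)"
  using s
proof (induction s)
  case Nil
  have "\<zero> \<in> Q" using additive_subgroup.zero_closed[OF Q] .
  then show ?case using arr by (intro bexI[of _ \<zero>]) (auto simp: separating_array_def)
next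
  case (Cons p s)
  obtain i0 j0 where p: "p = (i0, j0)" by fastforce
  have p0: "i0 < n" "j0 < n" "i0 \<notin> fst ` set s" using Cons.prems p by auto
  obtain z where z: "z \<in> carrier R" "\<forall>(i, j)\<in>set s. u i \<otimes> z \<otimes> v i \<ominus> u i \<otimes> x i j \<otimes> v i \<in> Q"
    "\<forall>i<n. i \<notin> fst ` set s \<longrightarrow> u i \<otimes> z \<otimes> v i \<in> Q"
    using Cons by auto
  have c: "u i \<in> carrier R" "v i \<in> carrier R" "x i j \<in> carrier R" if "i < n" "j < n" for i j
    using arr that by (auto simp: separating_array_def)
  note cl = m_closed z(1)
  have sum: "u i \<otimes> (z \<oplus> x i0 j0) \<otimes> v i = u i \<otimes> z \<otimes> v i \<oplus> u i \<otimes> x i0 j0 \<otimes> v i" if "i < n" for i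
    using c p0 that z by (intro sandwich_add) auto
  have "u i \<otimes> (z \<oplus> x i0 j0) \<otimes> v i \<ominus> u i \<otimes> x i j \<otimes> v i \<in> Q" if ij: "(i, j) \<in> set (p # s)" for i j
  proof (cases "(i, j) = p")
    case True
    then have "u i \<otimes> (z \<oplus> x i0 j0) \<otimes> v i \<ominus> u i \<otimes> x i j \<otimes> v i = u i \<otimes> z \<otimes> v i"
      using p p0 c cl by (simp add: sum a_minus_def a_assoc r_neg)
    then show ?thesis using z(3) p0 True p by auto
  next
    case False
    then have ij': "(i, j) \<in> set s" using ij by auto
    then have n: "i < n" "j < n" "i \<noteq> i0" using Cons.prems p0 by (auto simp: image_iff)
    then have q: "u i \<otimes> x i0 j0 \<otimes> v i \<in> Q" using arr p0 by (auto simp: separating_array_def)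
    have "u i \<otimes> (z \<oplus> x i0 j0) \<otimes> v i \<ominus> u i \<otimes> x i j \<otimes> v i
        = (u i \<otimes> z \<otimes> v i \<ominus> u i \<otimes> x i j \<otimes> v i) \<oplus> u i \<otimes> x i0 j0 \<otimes> v i"
      using n p0 c cl by (simp add: sum a_minus_def a_ac)
    then show ?thesis using additive_subgroup.a_closed[OF Q] q z(2) ij' by auto
  qed
  moreover have "u i \<otimes> (z \<oplus> x i0 j0) \<otimes> v i \<in> Q" if "i < n" "i \<notin> fst ` set (p # s)" for i
    using that sum[OF that(1)] additive_subgroup.a_closed[OF Q] z(3) arr p p0
    by (auto simp: separating_array_def)
  moreover have "z \<oplus> x i0 j0 \<in> carrier R" using z c p0 by auto
  ultimately show ?case by (intro bexI[of _ "z \<oplus> x i0 j0"]) auto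
qed

end

context ring_model begin

text \<open>
  The parameters of an infinite array are obtained from saturation. Let \<open>C s\<close> express that the finite
  path \<open>s\<close> is consistent, and \<open>I i j j'\<close> that two formulas of row \<open>i\<close> contradict each other. Separating
  arrays satisfy any finite number of these sentences, hence parameters in the monster model satisfy
  all of them at once. Computations with sums take place in the given ring only, so that nothing about
  addition has to be carried over to the monster model.
\<close>

lemma bounded_arrays:
  assumes cL: "countable_language L" and oc: "omega_categorical L R" and ntp: "NTP2 L R"
    and Q: "definable L R Q" "additive_subgroup Q A"
  shows "\<exists>n. \<forall>u v x. \<not> separating_array A Q n u v x"
proof (rule ccontr)
  assume "\<not> ?thesis"
  then have big: "\<exists>u v x. separating_array A Q n u v x" for n by blast
  obtain N :: "(nat, 'f ring_sym, 'r) fo_structure" and M :: "(nat set, 'f ring_sym, 'r) fo_structure"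
    where RN: "elem_equiv L R N" and NM: "elem_equiv L N M"
      and M: "aleph1_saturated L M" "realizes_types L M"
    using monster_model_exists[OF cL str oc] by metis
  have RM: "elem_equiv L R M" using elem_equiv_trans[OF RN NM] .
  obtain \<phi> where \<phi>: "formula_of L \<phi>" "fvars \<phi> \<subseteq> {0}" and QD: "Q = {d \<in> Dom R. sat R (\<lambda>_. d) \<phi>}"
    using Q(1) unfolding definable_def by blast
  define t :: "'f ring_sym tm" where
    "t = Fun Plus [Fun Times [Fun Times [Var 1, Var 0], Var 2], Fun Minus [Var 3]]"
  define \<Phi> where "\<Phi> = inst \<phi> t"
  have f\<Phi>: "formula_of L \<Phi>" using \<phi> by (simp add: \<Phi>_def t_def del: term_of.simps(2))
  have v\<Phi>: "fvars \<Phi> \<subseteq> {..<4}" unfolding \<Phi>_def using fvars_inst[of \<phi> t] by (auto simp: t_def)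
  have sat\<Phi>: "sat R \<sigma> \<Phi> \<longleftrightarrow> \<sigma> 1 \<otimes>\<^bsub>A\<^esub> \<sigma> 0 \<otimes>\<^bsub>A\<^esub> \<sigma> 2 \<ominus>\<^bsub>A\<^esub> \<sigma> 3 \<in> Q"
    if \<sigma>: "\<And>v. \<sigma> v \<in> Dom R" for \<sigma>
  proof -
    have "tval R \<sigma> (Fun Minus [Var 3]) = \<ominus>\<^bsub>A\<^esub> \<sigma> 3" using \<sigma> by (subst terms) auto
    then have t: "tval R \<sigma> t = \<sigma> 1 \<otimes>\<^bsub>A\<^esub> \<sigma> 0 \<otimes>\<^bsub>A\<^esub> \<sigma> 2 \<ominus>\<^bsub>A\<^esub> \<sigma> 3"
      unfolding t_def terms a_minus_def by (simp only: tval.simps)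
    have "\<sigma> v \<in> carrier A" for v using \<sigma> by (simp add: carrier_A)
    then have "tval R \<sigma> t \<in> Dom R"
      unfolding t carrier_A[symmetric] by (intro minus_closed m_closed)
    then show ?thesis unfolding \<Phi>_def by (simp add: sat_inst QD t)
  qed
  \<comment> \<open>Distinct positive variables for the parameters; the variable 0 is kept for the realization.\<close>
  define vu :: "nat \<Rightarrow> nat" where "vu i = 3 * i + 1" for i
  define vv :: "nat \<Rightarrow> nat" where "vv i = 3 * i + 2" for i
  define vb :: "nat \<Rightarrow> nat \<Rightarrow> nat" where "vb i j = 3 * prod_encode (i, j) + 3" for i j
  define F where "F i j = ren ((!) [0, vu i, vv i, vb i j]) \<Phi>" for i j
  have fF: "formula_of L (F i j)" for i j using f\<Phi> by (simp add: F_def)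
  have satF: "sat R \<sigma> (F i j) \<longleftrightarrow> holds_at R \<Phi> [\<sigma> 0, \<sigma> (vu i), \<sigma> (vv i), \<sigma> (vb i j)]" for \<sigma> i j
    unfolding F_def by (subst sat_ren_list) (use v\<Phi> in auto)
  have satFM: "sat M \<sigma> (F i j) \<longleftrightarrow> holds_at M \<Phi> [\<sigma> 0, \<sigma> (vu i), \<sigma> (vv i), \<sigma> (vb i j)]" for \<sigma> i j
    unfolding F_def by (subst sat_ren_list) (use v\<Phi> in auto)
  define C where "C s = Ex 0 (Conj (map (\<lambda>(i, j). F i j) s))" for s
  define I where "I i j j' = Neg (Ex 0 (And (F i j) (F i j')))" for i j j'
  define \<Gamma> where "\<Gamma> = C ` {s. distinct (map fst s)} \<union> {I i j j' | i j j'. j \<noteq> j'}"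
  have f\<Gamma>: "formula_of L \<psi>" if "\<psi> \<in> \<Gamma>" for \<psi>
    using that fF by (auto simp: \<Gamma>_def C_def I_def)
  have "satisfiable M \<Gamma>"
  proof (rule M(2)[unfolded realizes_types_def, rule_format])
    fix \<Delta> assume \<Delta>: "finite \<Delta> \<and> \<Delta> \<subseteq> \<Gamma>"
    define \<Gamma>n where "\<Gamma>n n = C ` {s. distinct (map fst s) \<and> set s \<subseteq> {..<n} \<times> {..<n}}
      \<union> {I i j j' | i j j'. j \<noteq> j' \<and> i < n \<and> j < n \<and> j' < n}" for n :: nat
    have mono: "\<Gamma>n m \<subseteq> \<Gamma>n n" if "m \<le> n" for m n
    proof -
      have "{..<m} \<times> {..<m} \<subseteq> {..<n} \<times> {..<n}" using that by auto
      then show ?thesis using that unfolding \<Gamma>n_def by (intro Un_mono image_mono) (auto, fastforce)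
    qed
    have "\<exists>n. \<psi> \<in> \<Gamma>n n" if \<psi>: "\<psi> \<in> \<Gamma>" for \<psi>
    proof -
      consider s where "distinct (map fst s)" "\<psi> = C s" | i j j' where "j \<noteq> j'" "\<psi> = I i j j'"
        using \<psi> by (auto simp: \<Gamma>_def)
      then show ?thesis
      proof cases
        case 1
        define n where "n = Suc (Max (insert 0 (fst ` set s \<union> snd ` set s)))"
        have "k < n" if "k \<in> fst ` set s \<union> snd ` set s" for k
          using that by (simp add: n_def less_Suc_eq_le)
        then have "set s \<subseteq> {..<n} \<times> {..<n}" by force
        then show ?thesis using 1 unfolding \<Gamma>n_def by blast
      next
        case 2
        then show ?thesis unfolding \<Gamma>n_def by (intro exI[of _ "Suc (i + j + j')"]) force
      qed
    qed
    then obtain m where m: "\<And>\<psi>. \<psi> \<in> \<Gamma> \<Longrightarrow> \<psi> \<in> \<Gamma>n (m \<psi>)" by metis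
    define n where "n = Max (insert 0 (m ` \<Delta>))"
    have "m \<psi> \<le> n" if "\<psi> \<in> \<Delta>" for \<psi> using that \<Delta> by (simp add: n_def)
    then have \<Delta>n: "\<Delta> \<subseteq> \<Gamma>n n" using m mono \<Delta> by blast
    obtain u v x where arr: "separating_array A Q n u v x" using big by blast
    have c: "u i \<in> carrier A" "v i \<in> carrier A" "x i j \<in> carrier A" if "i < n" "j < n" for i j
      using arr that by (auto simp: separating_array_def)
    obtain d where d: "d \<in> Dom R" using str by (auto simp: structure_for_def)
    define \<sigma> where "\<sigma> k = (if k mod 3 = 1 \<and> k div 3 < n then u (k div 3)
      else if k mod 3 = 2 \<and> k div 3 < n then v (k div 3)
      else case prod_decode ((k - 3) div 3) of (i, j) \<Rightarrow>
        if i < n \<and> j < n then u i \<otimes>\<^bsub>A\<^esub> x i j \<otimes>\<^bsub>A\<^esub> v i else d)" for k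
    have \<sigma>: "\<sigma> k \<in> Dom R" for k
      using c d m_closed by (auto simp: \<sigma>_def carrier_A split: prod.split)
    have "vu i mod 3 = 1" "vu i div 3 = i" "vv i mod 3 = 2" "vv i div 3 = i" for i
      by (simp_all add: vu_def vv_def, presburger+)
    moreover have "vb i j mod 3 = 0" "(vb i j - 3) div 3 = prod_encode (i, j)" for i j
      by (simp_all add: vb_def)
    ultimately have \<sigma>v: "\<sigma> (vu i) = u i" "\<sigma> (vv i) = v i" "\<sigma> (vb i j) = u i \<otimes>\<^bsub>A\<^esub> x i j \<otimes>\<^bsub>A\<^esub> v i"
      if "i < n" "j < n" for i j
      using that by (simp_all add: \<sigma>_def)
    have pos: "vu i \<noteq> 0" "vv i \<noteq> 0" "vb i j \<noteq> 0" for i j by (auto simp: vu_def vv_def vb_def)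
    have satR: "sat R (\<sigma>(0 := z)) (F i j) \<longleftrightarrow>
        u i \<otimes>\<^bsub>A\<^esub> z \<otimes>\<^bsub>A\<^esub> v i \<ominus>\<^bsub>A\<^esub> u i \<otimes>\<^bsub>A\<^esub> x i j \<otimes>\<^bsub>A\<^esub> v i \<in> Q"
      if "i < n" "j < n" "z \<in> Dom R" for i j z
    proof -
      let ?xs = "[z, u i, v i, u i \<otimes>\<^bsub>A\<^esub> x i j \<otimes>\<^bsub>A\<^esub> v i]"
      have "sat R (\<sigma>(0 := z)) (F i j) \<longleftrightarrow> holds_at R \<Phi> ?xs"
        unfolding satF by (simp add: fun_upd_same pos \<sigma>v[OF that(1,2)] fun_upd_other[OF pos(1)] fun_upd_other[OF pos(2)] fun_upd_other[OF pos(3)] del: fun_upd_apply)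
      also have "\<dots> \<longleftrightarrow> sat R (\<lambda>k. if k < length ?xs then ?xs ! k else d) \<Phi>"
        by (rule holds_at_eq_sat) (use v\<Phi> in \<open>simp add: numeral_eq_Suc\<close>)
      also have "\<dots> \<longleftrightarrow> u i \<otimes>\<^bsub>A\<^esub> z \<otimes>\<^bsub>A\<^esub> v i \<ominus>\<^bsub>A\<^esub> u i \<otimes>\<^bsub>A\<^esub> x i j \<otimes>\<^bsub>A\<^esub> v i \<in> Q"
        using c that d m_closed
        by (subst sat\<Phi>) (auto simp: carrier_A nth_Cons' numeral_eq_Suc)
      finally show ?thesis .
    qed
    have "sat R \<sigma> \<psi>" if "\<psi> \<in> \<Gamma>n n" for \<psi>
    proof -
      consider s where "distinct (map fst s)" "set s \<subseteq> {..<n} \<times> {..<n}" "\<psi> = C s"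
        | i j j' where "j \<noteq> j'" "i < n" "j < n" "j' < n" "\<psi> = I i j j'"
        using \<open>\<psi> \<in> \<Gamma>n n\<close> by (auto simp: \<Gamma>n_def)
      then show ?thesis
      proof cases
        case 1
        obtain z where z: "z \<in> carrier A"
          "\<forall>(i, j)\<in>set s. u i \<otimes>\<^bsub>A\<^esub> z \<otimes>\<^bsub>A\<^esub> v i \<ominus>\<^bsub>A\<^esub> u i \<otimes>\<^bsub>A\<^esub> x i j \<otimes>\<^bsub>A\<^esub> v i \<in> Q"
          using separating_array_path[OF Q(2) arr 1(1,2)] by blast
        have "sat R (\<sigma>(0 := z)) (F i j)" if "(i, j) \<in> set s" for i j
          using that satR[of i j z] z 1(2) by (auto simp: carrier_A)
        then have "\<exists>z\<in>Dom R. \<forall>(i, j)\<in>set s. sat R (\<sigma>(0 := z)) (F i j)" using z by (auto simp: carrier_A)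
        then show ?thesis using 1(3) by (auto simp: C_def)
      next
        case 2
        have False if z: "z \<in> Dom R" "sat R (\<sigma>(0 := z)) (F i j)" "sat R (\<sigma>(0 := z)) (F i j')" for z
        proof -
          let ?b = "\<lambda>j. u i \<otimes>\<^bsub>A\<^esub> x i j \<otimes>\<^bsub>A\<^esub> v i"
          let ?w = "u i \<otimes>\<^bsub>A\<^esub> z \<otimes>\<^bsub>A\<^esub> v i"
          have "?w \<ominus>\<^bsub>A\<^esub> ?b j \<in> Q" "?w \<ominus>\<^bsub>A\<^esub> ?b j' \<in> Q" using satR z 2 by blast+
          then have "(?w \<ominus>\<^bsub>A\<^esub> ?b j') \<oplus>\<^bsub>A\<^esub> (\<ominus>\<^bsub>A\<^esub> (?w \<ominus>\<^bsub>A\<^esub> ?b j)) \<in> Q"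
            using Q(2) additive_subgroup.a_closed additive_subgroup.a_inv_closed by metis
          moreover have "?w \<in> carrier A" "?b j \<in> carrier A" "?b j' \<in> carrier A"
            using c 2 z m_closed by (auto simp: carrier_A)
          then have "(?w \<ominus>\<^bsub>A\<^esub> ?b j') \<oplus>\<^bsub>A\<^esub> (\<ominus>\<^bsub>A\<^esub> (?w \<ominus>\<^bsub>A\<^esub> ?b j)) = ?b j \<ominus>\<^bsub>A\<^esub> ?b j'"
            by (simp add: a_minus_def minus_add a_ac r_neg2 r_neg1)
          ultimately show False using arr 2 by (auto simp: separating_array_def)
        qed
        then show ?thesis using 2(5) by (auto simp: I_def)
      qed
    qed
    then have "satisfiable R \<Delta>" using \<Delta>n \<sigma> by (auto simp: satisfiable_def)
    then show "satisfiable M \<Delta>"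
      by (rule satisfiable_transfer[OF RM, rotated 2]) (use \<Delta> f\<Gamma> in auto)
  qed (use f\<Gamma> in auto)
  then obtain \<sigma> where \<sigma>: "\<And>v. \<sigma> v \<in> Dom M" "\<And>\<psi>. \<psi> \<in> \<Gamma> \<Longrightarrow> sat M \<sigma> \<psi>"
    by (auto simp: satisfiable_def)
  define a where "a i j = [\<sigma> (vu i), \<sigma> (vv i), \<sigma> (vb i j)]" for i j
  have pos: "vu i \<noteq> 0" "vv i \<noteq> 0" "vb i j \<noteq> 0" for i j by (auto simp: vu_def vv_def vb_def)
  have satM: "sat M (\<sigma>(0 := z)) (F i j) \<longleftrightarrow> holds_at M \<Phi> (z # a i j)" for z i j
    unfolding satFM a_def
    by (simp add: fun_upd_same fun_upd_other[OF pos(1)] fun_upd_other[OF pos(2)] fun_upd_other[OF pos(3)] del: fun_upd_apply)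
  have incon: "\<not> (holds_at M \<Phi> (z # a i j) \<and> holds_at M \<Phi> (z # a i j'))"
    if "z \<in> Dom M" "j \<noteq> j'" for z i j j'
  proof -
    have "sat M \<sigma> (I i j j')" using that by (intro \<sigma>) (auto simp: \<Gamma>_def)
    then show ?thesis using that(1) unfolding I_def sat.simps satM by blast
  qed
  have con: "\<exists>z\<in>Dom M. \<forall>(i, j)\<in>set s. holds_at M \<Phi> (z # a i j)" if "distinct (map fst s)" for s
  proof -
    have "sat M \<sigma> (C s)" using that by (intro \<sigma>) (auto simp: \<Gamma>_def)
    then obtain z where z: "z \<in> Dom M" "\<forall>\<psi>\<in>set (map (\<lambda>(i, j). F i j) s). sat M (\<sigma>(0 := z)) \<psi>"
      unfolding C_def sat.simps sat_Conj by blast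
    have "sat M (\<sigma>(0 := z)) (F i j)" if "(i, j) \<in> set s" for i j using z(2) that by force
    then show ?thesis using z(1) satM by blast
  qed
  have a3: "a i j \<in> tuples M 3" for i j using \<sigma> by (simp add: a_def tuples_def)
  have "has_TP2 L (complete_theory L R)"
    unfolding has_TP2_def
  proof (intro exI conjI allI)
    show "monster_model L (complete_theory L R) M"
      unfolding monster_model_def model_of_complete_theory_iff[OF str] using M RM by blast
    show "formula_of L \<Phi>" by fact
    show "fvars \<Phi> \<subseteq> {..<1 + 3}" using v\<Phi> by simp
    show "a i j \<in> tuples M 3" for i j by fact
    show "k_inconsistent_family M 1 \<Phi> 2 (\<lambda>j. a i j)" for i
      unfolding k_inconsistent_family_def
    proof (intro allI impI notI)
      fix J :: "nat set" assume J: "finite J \<and> card J = 2" and c: "consistent_family M 1 \<Phi> (\<lambda>j. a i j) J"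
      obtain j j' where jj: "J = {j, j'}" "j \<noteq> j'" using J by (meson card_2_iff)
      obtain b where b: "b \<in> tuples M 1" "\<forall>j\<in>J. holds_at M \<Phi> (b @ a i j)"
        using c unfolding consistent_family_def by blast
      obtain z where "b = [z]" "z \<in> Dom M" using b(1) by (auto simp: tuples_def length_Suc_conv)
      then show False using incon[of z j j' i] b(2) jj by auto
    qed
    show "consistent_family M 1 \<Phi> (\<lambda>i. a i (\<eta> i)) UNIV" for \<eta>
    proof -
      define p where "p = range (\<lambda>i. (\<Phi>, a i (\<eta> i)))"
      have "\<exists>b\<in>Dom M. \<forall>(\<phi>, as)\<in>p. holds_at M \<phi> (b # as)"
      proof (rule M(1)[unfolded aleph1_saturated_def, rule_format, of "range \<sigma>"], intro conjI allI impI)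
        show "range \<sigma> \<subseteq> Dom M" "countable (range \<sigma>)" using \<sigma> by auto
        show "p \<subseteq> {(\<phi>, as). formula_of L \<phi> \<and> set as \<subseteq> range \<sigma> \<and> fvars \<phi> \<subseteq> {..<Suc (length as)}}"
          using f\<Phi> v\<Phi> by (auto simp: p_def a_def)
        fix q assume q: "finite q \<and> q \<subseteq> p"
        then obtain S where S: "finite S" "q = (\<lambda>i. (\<Phi>, a i (\<eta> i))) ` S"
          unfolding p_def by (meson finite_subset_image)
        define s where "s = map (\<lambda>i. (i, \<eta> i)) (sorted_list_of_set S)"
        have "distinct (map fst s)" by (simp add: s_def comp_def)
        from con[OF this] obtain z where z: "z \<in> Dom M" "\<forall>(i, j)\<in>set s. holds_at M \<Phi> (z # a i j)" by blast
        have "holds_at M \<Phi> (z # a i (\<eta> i))" if "i \<in> S" for i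
          using z(2) that S(1) by (auto simp: s_def)
        then show "\<exists>b\<in>Dom M. \<forall>(\<phi>, as)\<in>q. holds_at M \<phi> (b # as)" using z(1) S(2) by auto
      qed
      then obtain b where b: "b \<in> Dom M" "\<forall>i. holds_at M \<Phi> (b # a i (\<eta> i))" by (auto simp: p_def)
      then show ?thesis unfolding consistent_family_def
        by (intro bexI[of _ "[b]"]) (auto simp: tuples_def)
    qed
  qed
  then show False using ntp by (simp add: NTP2_def)
qed

end

section \<open>Ideals and products in rings without unit\<close>

text \<open>
  The elements that generate an ideal whose square is contained in \<open>Q\<close>.
\<close>

definition square_zero :: "('a, 'm) ring_scheme \<Rightarrow> 'a set \<Rightarrow> 'a set" where
  "square_zero A Q = {c \<in> carrier A. c \<otimes>\<^bsub>A\<^esub> c \<in> Q \<and> (\<forall>x\<in>carrier A. c \<otimes>\<^bsub>A\<^esub> x \<otimes>\<^bsub>A\<^esub> c \<in> Q)}"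

text \<open>
  The additive closure is graded by the length of the sums, because it is the single stages that are
  definable along with \<open>S\<close>.
\<close>

fun sums_of_length :: "('a, 'm) ring_scheme \<Rightarrow> 'a set \<Rightarrow> nat \<Rightarrow> 'a set" where
  "sums_of_length A S 0 = {\<zero>\<^bsub>A\<^esub>}"
| "sums_of_length A S (Suc l) = {d \<oplus>\<^bsub>A\<^esub> e | d e. d \<in> sums_of_length A S l \<and> e \<in> S}"

definition additive_span :: "('a, 'm) ring_scheme \<Rightarrow> 'a set \<Rightarrow> 'a set" where
  "additive_span A S = (\<Union>l. sums_of_length A S l)"

definition mprod :: "('a, 'm) ring_scheme \<Rightarrow> 'a list \<Rightarrow> 'a" where
  "mprod A xs = foldl (\<otimes>\<^bsub>A\<^esub>) (hd xs) (tl xs)"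

lemma additive_span_induct [consumes 1, case_names zero add]:
  assumes "z \<in> additive_span A S" "P \<zero>\<^bsub>A\<^esub>"
    "\<And>d e. d \<in> additive_span A S \<Longrightarrow> P d \<Longrightarrow> e \<in> S \<Longrightarrow> P (d \<oplus>\<^bsub>A\<^esub> e)"
  shows "P z"
proof -
  have "z \<in> sums_of_length A S l \<Longrightarrow> P z" for l
  proof (induction l arbitrary: z)
    case (Suc l)
    then obtain d e where "z = d \<oplus>\<^bsub>A\<^esub> e" "d \<in> sums_of_length A S l" "e \<in> S" by auto
    moreover have "d \<in> additive_span A S" using \<open>d \<in> sums_of_length A S l\<close> unfolding additive_span_def by blast
    ultimately show ?case using assms(3)[of d e] Suc.IH[of d] by simp
  qed (use assms(2) in simp)
  moreover obtain l where "z \<in> sums_of_length A S l" using assms(1) unfolding additive_span_def by blast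
  ultimately show ?thesis by this
qed

lemma additive_span_zero: "\<zero>\<^bsub>A\<^esub> \<in> additive_span A S"
  unfolding additive_span_def by (rule UN_I[of 0]) simp_all

lemma additive_span_add: "d \<in> additive_span A S \<Longrightarrow> e \<in> S \<Longrightarrow> d \<oplus>\<^bsub>A\<^esub> e \<in> additive_span A S"
  unfolding additive_span_def
proof (elim UN_E)
  fix l assume "d \<in> sums_of_length A S l" "e \<in> S"
  then have "d \<oplus>\<^bsub>A\<^esub> e \<in> sums_of_length A S (Suc l)" by auto
  then show "d \<oplus>\<^bsub>A\<^esub> e \<in> (\<Union>l. sums_of_length A S l)" by (intro UN_I[of "Suc l"]) simp_all
qed

context rng begin

lemma l_minus: "\<lbrakk>x \<in> carrier R; y \<in> carrier R\<rbrakk> \<Longrightarrow> (\<ominus> x) \<otimes> y = \<ominus> (x \<otimes> y)"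
proof -
  assume xy: "x \<in> carrier R" "y \<in> carrier R"
  then have "(\<ominus> x) \<otimes> y \<oplus> x \<otimes> y = \<zero>"
    using l_distr[of "\<ominus> x" x y] by (simp add: l_neg)
  then show ?thesis using xy by (simp add: m_closed minus_equality)
qed

lemma r_minus: "\<lbrakk>x \<in> carrier R; y \<in> carrier R\<rbrakk> \<Longrightarrow> x \<otimes> (\<ominus> y) = \<ominus> (x \<otimes> y)"
proof -
  assume xy: "x \<in> carrier R" "y \<in> carrier R"
  then have "x \<otimes> (\<ominus> y) \<oplus> x \<otimes> y = \<zero>"
    using r_distr[of "\<ominus> y" y x] by (simp add: l_neg)
  then show ?thesis using xy by (simp add: m_closed minus_equality)
qed

lemma neg_zero [simp]: "\<ominus> \<zero> = \<zero>"
  by (rule minus_equality) auto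

text \<open>
  The rules by which the method \<open>algebra\<close> decides identities in rings without unit.
\<close>

lemmas rng_simprules [algebra rng "zero R" "add R" "a_inv R" "a_minus R" "monoid.mult R"] =
  a_closed zero_closed a_inv_closed minus_closed m_closed
  a_assoc l_zero l_neg a_comm m_assoc l_distr minus_eq
  r_zero r_neg r_neg2 r_neg1 minus_add minus_minus neg_zero
  a_lcomm r_distr l_null r_null l_minus r_minus

lemma l_distr_minus: "\<lbrakk>x \<in> carrier R; y \<in> carrier R; z \<in> carrier R\<rbrakk> \<Longrightarrow> (x \<ominus> y) \<otimes> z = x \<otimes> z \<ominus> y \<otimes> z"
  by (simp add: a_minus_def l_distr l_minus)

lemma r_distr_minus: "\<lbrakk>x \<in> carrier R; y \<in> carrier R; z \<in> carrier R\<rbrakk> \<Longrightarrow> z \<otimes> (x \<ominus> y) = z \<otimes> x \<ominus> z \<otimes> y"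
  by (simp add: a_minus_def r_distr r_minus)

lemma minus_eq_zero_iff: "\<lbrakk>x \<in> carrier R; y \<in> carrier R\<rbrakk> \<Longrightarrow> x \<ominus> y = \<zero> \<longleftrightarrow> x = y"
proof
  assume c: "x \<in> carrier R" "y \<in> carrier R" and "x \<ominus> y = \<zero>"
  have "x = (x \<ominus> y) \<oplus> y" using c by algebra
  then show "x = y" using \<open>x \<ominus> y = \<zero>\<close> c by simp
qed (simp add: a_minus_def r_neg)

lemma additive_subgroup_intro:
  assumes "H \<subseteq> carrier R" "\<zero> \<in> H" "\<And>x y. x \<in> H \<Longrightarrow> y \<in> H \<Longrightarrow> x \<oplus> y \<in> H" "\<And>x. x \<in> H \<Longrightarrow> \<ominus> x \<in> H"
  shows "additive_subgroup H R"
proof (intro additive_subgroupI add.subgroupI)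
  show "H \<noteq> {}" using assms(2) by auto
qed (use assms in \<open>auto simp: a_inv_def\<close>)

lemma subgroup_facts:
  assumes "additive_subgroup H R"
  shows "H \<subseteq> carrier R" "\<zero> \<in> H" "\<And>x y. x \<in> H \<Longrightarrow> y \<in> H \<Longrightarrow> x \<oplus> y \<in> H"
    "\<And>x. x \<in> H \<Longrightarrow> \<ominus> x \<in> H" "\<And>x y. x \<in> H \<Longrightarrow> y \<in> H \<Longrightarrow> x \<ominus> y \<in> H"
  using additive_subgroup.a_subset[OF assms] additive_subgroup.zero_closed[OF assms]
    additive_subgroup.a_closed[OF assms] additive_subgroup.a_inv_closed[OF assms]
  by (auto simp: a_minus_def)

lemma ideal_facts:
  assumes "two_sided_ideal R J"
  shows "additive_subgroup J R" "J \<subseteq> carrier R"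
    "\<And>x a. x \<in> carrier R \<Longrightarrow> a \<in> J \<Longrightarrow> x \<otimes> a \<in> J" "\<And>x a. x \<in> carrier R \<Longrightarrow> a \<in> J \<Longrightarrow> a \<otimes> x \<in> J"
  using assms subgroup_facts(1) by (auto simp: two_sided_ideal_def)

lemma zero_ideal: "two_sided_ideal R {\<zero>}"
  unfolding two_sided_ideal_def by (auto intro!: additive_subgroup_intro)

lemma additive_span_closed: "S \<subseteq> carrier R \<Longrightarrow> additive_span R S \<subseteq> carrier R"
proof
  fix z assume S: "S \<subseteq> carrier R" and "z \<in> additive_span R S"
  from this(2) show "z \<in> carrier R" by (induction rule: additive_span_induct) (use S in auto)
qed

lemma additive_span_ideal:
  assumes S: "S \<subseteq> carrier R" and neg: "\<And>c. c \<in> S \<Longrightarrow> \<ominus> c \<in> S"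
    and mult: "\<And>c x. c \<in> S \<Longrightarrow> x \<in> carrier R \<Longrightarrow> x \<otimes> c \<in> S \<and> c \<otimes> x \<in> S"
  shows "two_sided_ideal R (additive_span R S)"
proof -
  note cl = additive_span_closed[OF S]
  have add: "w \<oplus> z \<in> additive_span R S" if "z \<in> additive_span R S" "w \<in> additive_span R S" for w z
    using that(1)
  proof (induction rule: additive_span_induct)
    case zero
    then show ?case using that(2) cl by auto
  next
    case (add d e)
    then have "w \<oplus> (d \<oplus> e) = (w \<oplus> d) \<oplus> e" using that(2) cl S by (intro a_assoc[symmetric]) auto
    then show ?case using additive_span_add add by metis
  qed
  have neg': "\<ominus> z \<in> additive_span R S" if "z \<in> additive_span R S" for z
    using that
  proof (induction rule: additive_span_induct)
    case zero
    then show ?case using additive_span_zero[of R S] by simp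
  next
    case (add d e)
    then have "\<ominus> (d \<oplus> e) = \<ominus> d \<oplus> \<ominus> e" using cl S by (intro minus_add) auto
    then show ?case using additive_span_add add neg by metis
  qed
  have "x \<otimes> z \<in> additive_span R S \<and> z \<otimes> x \<in> additive_span R S" if "z \<in> additive_span R S" and x: "x \<in> carrier R" for x z
    using that(1)
  proof (induction rule: additive_span_induct)
    case zero
    then show ?case using additive_span_zero[of R S] x by simp
  next
    case (add d e)
    then have "x \<otimes> (d \<oplus> e) = x \<otimes> d \<oplus> x \<otimes> e" "(d \<oplus> e) \<otimes> x = d \<otimes> x \<oplus> e \<otimes> x"
      using cl S x by (auto intro!: r_distr l_distr)
    then show ?case using additive_span_add add mult[OF add.hyps(2) x] by metis
  qed
  then show ?thesis unfolding two_sided_ideal_def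
    using cl add neg' additive_span_zero by (auto intro!: additive_subgroup_intro)
qed

lemma square_zero_closed: "square_zero R Q \<subseteq> carrier R"
  by (auto simp: square_zero_def)

lemma additive_span_square_zero_ideal:
  assumes Q: "two_sided_ideal R Q"
  shows "two_sided_ideal R (additive_span R (square_zero R Q))"
proof (rule additive_span_ideal[OF square_zero_closed])
  note QS = subgroup_facts[OF ideal_facts(1)[OF Q]] and QI = ideal_facts[OF Q]
  fix c assume c: "c \<in> square_zero R Q"
  then have cR: "c \<in> carrier R" and cc: "c \<otimes> c \<in> Q" and cxc: "\<And>x. x \<in> carrier R \<Longrightarrow> c \<otimes> x \<otimes> c \<in> Q"
    by (auto simp: square_zero_def)
  show "\<ominus> c \<in> square_zero R Q"
    using cR cc cxc by (simp add: square_zero_def l_minus r_minus m_closed)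
  fix x assume x: "x \<in> carrier R"
  have "x \<otimes> c \<otimes> (x \<otimes> c) \<in> Q" "c \<otimes> x \<otimes> (c \<otimes> x) \<in> Q"
    using QI(3)[OF x cxc[OF x]] QI(4)[OF x cxc[OF x]] cR x by (simp_all add: m_assoc m_closed)
  moreover have "x \<otimes> c \<otimes> y \<otimes> (x \<otimes> c) \<in> Q" "c \<otimes> x \<otimes> y \<otimes> (c \<otimes> x) \<in> Q" if y: "y \<in> carrier R" for y
    using QI(3)[OF x cxc[of "y \<otimes> x"]] QI(4)[OF x cxc[of "x \<otimes> y"]] cR x y by (simp_all add: m_assoc m_closed)
  ultimately show "x \<otimes> c \<in> square_zero R Q \<and> c \<otimes> x \<in> square_zero R Q"
    using cR x by (simp add: square_zero_def m_closed)
qed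

lemma mprod_snoc: "xs \<noteq> [] \<Longrightarrow> mprod R (xs @ [y]) = mprod R xs \<otimes> y"
  by (simp add: mprod_def)

lemma mprod_single [simp]: "mprod R [x] = x"
  by (simp add: mprod_def)

lemma mprod_closed: "xs \<noteq> [] \<Longrightarrow> set xs \<subseteq> carrier R \<Longrightarrow> mprod R xs \<in> carrier R"
proof (induction xs rule: rev_nonempty_induct)
  case (snoc y ys)
  then show ?case by (simp add: mprod_snoc m_closed)
qed simp

lemma mprod_append:
  assumes "xs \<noteq> []" "set xs \<subseteq> carrier R" "ys \<noteq> []" "set ys \<subseteq> carrier R"
  shows "mprod R (xs @ ys) = mprod R xs \<otimes> mprod R ys"
  using assms(3,4)
proof (induction ys rule: rev_nonempty_induct)
  case (single y)
  then show ?case using assms by (simp add: mprod_snoc)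
next
  case (snoc y ys)
  then have "mprod R (xs @ ys @ [y]) = mprod R (xs @ ys) \<otimes> y"
    using mprod_snoc[of "xs @ ys" y] by simp
  then show ?case using snoc assms mprod_closed by (simp add: mprod_snoc m_assoc)
qed

lemma mprod_Cons: "x \<in> carrier R \<Longrightarrow> ys \<noteq> [] \<Longrightarrow> set ys \<subseteq> carrier R \<Longrightarrow> mprod R (x # ys) = x \<otimes> mprod R ys"
  using mprod_append[of "[x]" ys] by simp

lemma mprod_mult_Cons:
  assumes "u \<in> carrier R" "x \<in> carrier R" "set zs \<subseteq> carrier R"
  shows "mprod R ((u \<otimes> x) # zs) = u \<otimes> mprod R (x # zs)"
proof (cases "zs = []")
  case False
  then show ?thesis using assms mprod_closed[OF False] by (simp add: mprod_Cons m_closed m_assoc)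
qed simp

lemma mprod_in_ideal:
  assumes T: "two_sided_ideal R T" and "set xs \<subseteq> carrier R" "x \<in> set xs" "x \<in> T"
  shows "mprod R xs \<in> T"
proof -
  note I = ideal_facts[OF T]
  obtain as bs where xs: "xs = as @ x # bs" using assms(3) by (meson split_list)
  have b: "mprod R (x # bs) \<in> T"
    using assms(2,4) I mprod_closed[of bs] by (cases "bs = []") (auto simp: xs mprod_Cons)
  show ?thesis
    using assms(2) b I mprod_closed[of as] mprod_append[of as "x # bs"] by (cases "as = []") (auto simp: xs)
qed

text \<open>
  Generating sets of ideals are avoided: \<open>J\<close> is the left annihilator of the ideal generated by \<open>c\<close>, and
  \<open>K\<close> is the right annihilator of \<open>J\<close>. Both are ideals containing \<open>c\<close>, and \<open>J K = 0\<close>, so that their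
  intersection has square zero.
\<close>

lemma square_zero_ideal:
  assumes c: "c \<in> square_zero R {\<zero>}"
  obtains T where "two_sided_ideal R T" "c \<in> T" "\<And>a b. a \<in> T \<Longrightarrow> b \<in> T \<Longrightarrow> a \<otimes> b = \<zero>"
proof -
  have cR: "c \<in> carrier R" and cc: "c \<otimes> c = \<zero>" and cxc: "\<And>x. x \<in> carrier R \<Longrightarrow> c \<otimes> x \<otimes> c = \<zero>"
    using c by (auto simp: square_zero_def)
  define J where "J = {t \<in> carrier R. t \<otimes> c = \<zero> \<and> (\<forall>x\<in>carrier R. t \<otimes> x \<otimes> c = \<zero>)}"
  define K where "K = {t \<in> carrier R. \<forall>j\<in>J. j \<otimes> t = \<zero>}"
  have J: "two_sided_ideal R J"
    unfolding two_sided_ideal_def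
  proof (intro conjI additive_subgroup_intro ballI)
    fix a x assume a: "a \<in> J" and x: "x \<in> carrier R"
    show "x \<otimes> a \<in> J" using a x cR by (auto simp: J_def m_assoc m_closed)
    have "a \<otimes> x \<otimes> y \<otimes> c = \<zero>" if "y \<in> carrier R" for y
    proof -
      have "a \<otimes> x \<otimes> y \<otimes> c = a \<otimes> (x \<otimes> y) \<otimes> c" using a x cR that by (simp add: J_def m_assoc m_closed)
      then show ?thesis using a x that by (simp add: J_def m_closed)
    qed
    then show "a \<otimes> x \<in> J" using a x cR by (auto simp: J_def m_closed)
  qed (use cR in \<open>auto simp: J_def l_distr l_minus m_closed\<close>)
  note JI = ideal_facts[OF J]
  have K: "two_sided_ideal R K"
    unfolding two_sided_ideal_def
  proof (intro conjI additive_subgroup_intro ballI)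
    fix a x assume a: "a \<in> K" and x: "x \<in> carrier R"
    have "j \<otimes> (x \<otimes> a) = (j \<otimes> x) \<otimes> a" if "j \<in> J" for j
      using that JI a x by (intro m_assoc[symmetric]) (auto simp: K_def)
    then show "x \<otimes> a \<in> K" using a x JI by (auto simp: K_def m_closed)
    have "j \<otimes> (a \<otimes> x) = (j \<otimes> a) \<otimes> x" if "j \<in> J" for j
      using that JI a x by (intro m_assoc[symmetric]) (auto simp: K_def)
    then show "a \<otimes> x \<in> K" using a x by (auto simp: K_def m_closed)
  qed (use JI in \<open>auto simp: K_def r_distr r_minus subset_iff\<close>)
  note KI = ideal_facts[OF K]
  have "two_sided_ideal R (J \<inter> K)"
    unfolding two_sided_ideal_def
    using JI KI subgroup_facts[OF JI(1)] subgroup_facts[OF KI(1)]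
    by (auto intro!: additive_subgroup_intro)
  moreover have "c \<in> J \<inter> K" using cR cc cxc by (auto simp: J_def K_def)
  ultimately show thesis using that by (auto simp: K_def)
qed

text \<open>
  As there is no unit, there is no power with exponent 0, and \<open>pw x k\<close> stands for the power of \<open>x\<close> with
  exponent \<open>k + 1\<close>.
\<close>

primrec pw :: "'a \<Rightarrow> nat \<Rightarrow> 'a" where
  "pw x 0 = x"
| "pw x (Suc k) = pw x k \<otimes> x"

lemma pw_closed [simp]: "x \<in> carrier R \<Longrightarrow> pw x k \<in> carrier R"
  by (induction k) (auto simp: m_closed)

lemma pw_mult: "x \<in> carrier R \<Longrightarrow> pw x j \<otimes> pw x k = pw x (Suc (j + k))"
  by (induction k) (auto simp: m_assoc[symmetric])

text \<open>
  Modulo a square-zero ideal containing \<open>c\<close>, the powers of \<open>d + c\<close> are those of \<open>d\<close>. So a power of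
  \<open>d + c\<close> lies in this ideal, and its square vanishes.
\<close>

lemma additive_span_nil:
  assumes "z \<in> additive_span R (square_zero R {\<zero>})"
  shows "\<exists>k. pw z k = \<zero>"
  using assms
proof (induction rule: additive_span_induct)
  case zero
  then show ?case by (intro exI[of _ 0]) simp
next
  case (add d c)
  have dR: "d \<in> carrier R" using add.hyps(1) additive_span_closed[OF square_zero_closed] by auto
  obtain T where T: "two_sided_ideal R T" "c \<in> T" "\<And>a b. a \<in> T \<Longrightarrow> b \<in> T \<Longrightarrow> a \<otimes> b = \<zero>"
    using square_zero_ideal[OF add.hyps(2)] by blast
  note I = ideal_facts[OF T(1)] and S = subgroup_facts[OF ideal_facts(1)[OF T(1)]]
  have cR: "c \<in> carrier R" using T I by auto
  define y where "y = d \<oplus> c"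
  have yR: "y \<in> carrier R" using dR cR by (simp add: y_def)
  have diff: "pw y k \<ominus> pw d k \<in> T" for k
  proof (induction k)
    case 0
    have "d \<oplus> c \<ominus> d = c" using dR cR by algebra
    then show ?case using T by (simp add: y_def)
  next
    case (Suc k)
    have "pw y (Suc k) \<ominus> pw d (Suc k) = (pw y k \<ominus> pw d k) \<otimes> d \<oplus> pw y k \<otimes> c"
    proof -
      have "pw y (Suc k) = pw y k \<otimes> d \<oplus> pw y k \<otimes> c"
        using r_distr[of d c "pw y k"] dR cR yR by (simp add: y_def)
      moreover have "pw y k \<in> carrier R" "pw d k \<in> carrier R" using dR yR by auto
      ultimately show ?thesis using dR cR unfolding pw.simps(2)[of d] by algebra
    qed
    then show ?case using Suc I S dR yR T by auto
  qed
  obtain k where "pw d k = \<zero>" using add.IH by blast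
  then have "pw y k \<in> T" using diff[of k] yR by (simp add: a_minus_def)
  then have "pw y k \<otimes> pw y k = \<zero>" using T by auto
  then have "pw y (Suc (k + k)) = \<zero>" using pw_mult[OF yR] by simp
  then show ?case unfolding y_def by blast
qed

section \<open>Cosets and Neumann's lemma\<close>

definition coset :: "'a set \<Rightarrow> 'a \<Rightarrow> 'a set" where
  "coset H x = {y \<in> carrier R. y \<ominus> x \<in> H}"

lemma coset_eq_iff:
  assumes H: "additive_subgroup H R" and "x \<in> carrier R" "y \<in> carrier R"
  shows "coset H x = coset H y \<longleftrightarrow> x \<ominus> y \<in> H"
proof
  note S = subgroup_facts[OF H]
  assume "coset H x = coset H y"
  moreover have "x \<in> coset H x" using assms S by (simp add: coset_def a_minus_def r_neg)
  ultimately show "x \<ominus> y \<in> H" by (auto simp: coset_def)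
next
  note S = subgroup_facts[OF H]
  assume xy: "x \<ominus> y \<in> H"
  have "z \<ominus> x \<in> H \<longleftrightarrow> z \<ominus> y \<in> H" if z: "z \<in> carrier R" for z
  proof -
    have "z \<ominus> y = (z \<ominus> x) \<oplus> (x \<ominus> y)" "z \<ominus> x = (z \<ominus> y) \<ominus> (x \<ominus> y)"
      using assms(2,3) z by algebra+
    then show ?thesis using S xy by metis
  qed
  then show "coset H x = coset H y" by (auto simp: coset_def)
qed

end

lemma card_image_coarser:
  assumes "finite (f ` S)" "\<And>x y. x \<in> S \<Longrightarrow> y \<in> S \<Longrightarrow> f x = f y \<Longrightarrow> g x = g y"
  shows "finite (g ` S)" "card (g ` S) \<le> card (f ` S)"
proof -
  define h where "h v = g (SOME x. x \<in> S \<and> f x = v)" for v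
  have "g x = h (f x)" if "x \<in> S" for x
  proof -
    have "(SOME y. y \<in> S \<and> f y = f x) \<in> S \<and> f (SOME y. y \<in> S \<and> f y = f x) = f x"
      by (rule someI[of _ x]) (use that in auto)
    then show ?thesis unfolding h_def using assms(2) that by metis
  qed
  then have eq: "g ` S = h ` (f ` S)" by (auto simp: image_image)
  show "finite (g ` S)" "card (g ` S) \<le> card (f ` S)"
    unfolding eq using assms(1) by (auto intro: card_image_le)
qed

context rng begin

text \<open>
  A family of homomorphisms \<open>\<beta> _ v\<close>, closed under addition, all of whose images are small, maps a
  subgroup of small index into one small subgroup. This is a variant, for one-sided bounds, of the
  argument by which B. H. Neumann showed that groups with conjugacy classes of bounded size have a
  finite commutator subgroup.

  The induction is on a bound \<open>m\<close> for the images of \<open>H\<close> modulo \<open>B\<close>. Let \<open>v0\<close> attain the bound, and pass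
  to the kernel \<open>H'\<close> of \<open>\<beta> _ v0\<close> modulo \<open>B\<close> and to the sum \<open>B'\<close> of \<open>B\<close> and the image. If the bound did
  not drop for \<open>v\<close>, then \<open>\<beta> _ v\<close> would assume all its values modulo \<open>B\<close> already on \<open>H'\<close>, without
  meeting \<open>B'\<close> outside \<open>B\<close>. The same then holds for \<open>v0 + v\<close>, which agrees with \<open>v\<close> on \<open>H'\<close>, and the
  difference of the two shows that \<open>\<beta> _ v0\<close> vanishes modulo \<open>B\<close>.
\<close>

lemma neumann_lemma:
  assumes T: "additive_subgroup T R"
    and V: "\<And>v w. v \<in> V \<Longrightarrow> w \<in> V \<Longrightarrow> v \<oplus> w \<in> V"
    and cl: "\<And>x v. x \<in> T \<Longrightarrow> v \<in> V \<Longrightarrow> \<beta> x v \<in> carrier R"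
    and addl: "\<And>x y v. x \<in> T \<Longrightarrow> y \<in> T \<Longrightarrow> v \<in> V \<Longrightarrow> \<beta> (x \<ominus> y) v = \<beta> x v \<ominus> \<beta> y v"
    and addr: "\<And>x v w. x \<in> T \<Longrightarrow> v \<in> V \<Longrightarrow> w \<in> V \<Longrightarrow> \<beta> x (v \<oplus> w) = \<beta> x v \<oplus> \<beta> x w"
  shows "\<lbrakk>additive_subgroup H R; H \<subseteq> T; finite (coset H ` T); card (coset H ` T) \<le> a;
      additive_subgroup B R; finite B; card B \<le> b;
      \<And>v. v \<in> V \<Longrightarrow> finite (coset B ` (\<lambda>x. \<beta> x v) ` H) \<and> card (coset B ` (\<lambda>x. \<beta> x v) ` H) \<le> m\<rbrakk> \<Longrightarrow>
    \<exists>H' B'. additive_subgroup H' R \<and> H' \<subseteq> T \<and> finite (coset H' ` T) \<and> card (coset H' ` T) \<le> a * fact m \<and>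
      additive_subgroup B' R \<and> finite B' \<and> card B' \<le> b * fact m \<and> (\<forall>x\<in>H'. \<forall>v\<in>V. \<beta> x v \<in> B')"
proof (induction m arbitrary: H B a b)
  case 0
  have "V = {}"
  proof (rule ccontr)
    assume "V \<noteq> {}"
    then obtain v where "v \<in> V" by auto
    then have "coset B ` (\<lambda>x. \<beta> x v) ` H = {}" using 0(8)[of v] by auto
    then show False using subgroup_facts(2)[OF 0(1)] by auto
  qed
  then show ?case using 0 by (intro exI[of _ H] exI[of _ B]) auto
next
  case (Suc m)
  note HS = subgroup_facts[OF Suc.prems(1)] and BS = subgroup_facts[OF Suc.prems(5)] and HT = Suc.prems(2)
  have \<beta>c: "\<beta> x v \<in> carrier R" if "x \<in> H" "v \<in> V" for x v using cl that HT by auto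
  have \<beta>0: "\<beta> \<zero> v = \<zero>" if "v \<in> V" for v
    using addl[of \<zero> \<zero> v] that HS(2) HT \<beta>c[OF HS(2) that] by (auto simp: a_minus_def r_neg)
  have bnd: "finite (coset B ` (\<lambda>x. \<beta> x v) ` H)" "card (coset B ` (\<lambda>x. \<beta> x v) ` H) \<le> Suc m" if "v \<in> V" for v
    using Suc.prems(8)[OF that] by auto
  show ?case
  proof (cases "\<forall>v\<in>V. card (coset B ` (\<lambda>x. \<beta> x v) ` H) \<le> m")
    case True
    have "\<exists>H' B'. additive_subgroup H' R \<and> H' \<subseteq> T \<and> finite (coset H' ` T) \<and> card (coset H' ` T) \<le> a * fact m \<and>
      additive_subgroup B' R \<and> finite B' \<and> card B' \<le> b * fact m \<and> (\<forall>x\<in>H'. \<forall>v\<in>V. \<beta> x v \<in> B')"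
      by (rule Suc.IH[OF Suc.prems(1-7)]) (use True bnd in auto)
    moreover have "k * fact m \<le> k * fact (Suc m)" for k :: nat by (simp add: fact_mono_nat)
    ultimately show ?thesis by (meson le_trans)
  next
    case False
    then obtain v0 where v0: "v0 \<in> V" "card (coset B ` (\<lambda>x. \<beta> x v0) ` H) = Suc m"
      using bnd(2) by (metis le_SucE)
    show ?thesis
    proof (cases "m = 0")
      case True
      have "\<beta> x v \<in> B" if "x \<in> H" "v \<in> V" for x v
      proof -
        let ?C = "coset B ` (\<lambda>x. \<beta> x v) ` H"
        have "card ?C \<le> Suc 0" using bnd(2)[OF that(2)] True by simp
        then have "\<forall>p\<in>?C. \<forall>q\<in>?C. p = q" by (simp only: card_le_Suc0_iff_eq[OF bnd(1)[OF that(2)]])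
        moreover have "coset B (\<beta> x v) \<in> ?C" "coset B (\<beta> \<zero> v) \<in> ?C" using that HS(2) by blast+
        ultimately have "coset B (\<beta> x v) = coset B (\<beta> \<zero> v)" by blast
        then show ?thesis using that \<beta>0 \<beta>c by (simp add: coset_eq_iff[OF Suc.prems(5)] a_minus_def)
      qed
      then show ?thesis using Suc.prems True by (intro exI[of _ H] exI[of _ B]) auto
    next
      case m: False
      define H' where "H' = {x \<in> H. \<beta> x v0 \<in> B}"
      define B' where "B' = \<Union> (coset B ` (\<lambda>x. \<beta> x v0) ` H)"
      have B'_iff: "y \<in> B' \<longleftrightarrow> y \<in> carrier R \<and> (\<exists>x\<in>H. y \<ominus> \<beta> x v0 \<in> B)" for y
        by (auto simp: B'_def coset_def)
      have H': "additive_subgroup H' R"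
      proof (rule additive_subgroup_intro)
        have min: "x \<ominus> y \<in> H'" if "x \<in> H'" "y \<in> H'" for x y
        proof -
          have "x \<in> H" "y \<in> H" "\<beta> x v0 \<in> B" "\<beta> y v0 \<in> B" using that by (auto simp: H'_def)
          moreover from this have "\<beta> (x \<ominus> y) v0 = \<beta> x v0 \<ominus> \<beta> y v0" using HT v0(1) by (intro addl) auto
          ultimately show ?thesis using HS(5) BS(5) by (simp add: H'_def)
        qed
        show z: "\<zero> \<in> H'" using HS BS \<beta>0 v0 by (auto simp: H'_def)
        show n: "\<ominus> x \<in> H'" if "x \<in> H'" for x
        proof -
          have "x \<in> carrier R" using that HS(1) by (auto simp: H'_def)
          then have "\<zero> \<ominus> x = \<ominus> x" by algebra
          then show ?thesis using min[OF z that] by simp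
        qed
        show "x \<oplus> y \<in> H'" if "x \<in> H'" "y \<in> H'" for x y
        proof -
          have "x \<in> carrier R" "y \<in> carrier R" using that HS(1) by (auto simp: H'_def)
          then have "x \<ominus> (\<ominus> y) = x \<oplus> y" by algebra
          then show ?thesis using min[OF that(1) n[OF that(2)]] by simp
        qed
      qed (use HS in \<open>auto simp: H'_def\<close>)
      have B': "additive_subgroup B' R"
      proof (rule additive_subgroup_intro)
        have min: "y \<ominus> z \<in> B'" if yz: "y \<in> B'" "z \<in> B'" for y z
        proof -
          obtain p q where pq: "p \<in> H" "q \<in> H" "y \<ominus> \<beta> p v0 \<in> B" "z \<ominus> \<beta> q v0 \<in> B" "y \<in> carrier R" "z \<in> carrier R"
            using yz by (auto simp: B'_iff)
          have c: "\<beta> p v0 \<in> carrier R" "\<beta> q v0 \<in> carrier R" using pq \<beta>c v0(1) by auto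
          have "\<beta> (p \<ominus> q) v0 = \<beta> p v0 \<ominus> \<beta> q v0"
            by (rule addl[OF subsetD[OF HT pq(1)] subsetD[OF HT pq(2)] v0(1)])
          then have "(y \<ominus> z) \<ominus> \<beta> (p \<ominus> q) v0 = (y \<ominus> \<beta> p v0) \<ominus> (z \<ominus> \<beta> q v0)"
            using pq(5,6) c by algebra
          then have "(y \<ominus> z) \<ominus> \<beta> (p \<ominus> q) v0 \<in> B" using BS(5)[OF pq(3,4)] by simp
          then show ?thesis unfolding B'_iff using pq(5,6) HS(5)[OF pq(1,2)] by blast
        qed
        show z: "\<zero> \<in> B'"
          using BS HS \<beta>0[OF v0(1)] by (auto simp: B'_iff a_minus_def r_neg intro!: bexI[of _ \<zero>])
        show n: "\<ominus> x \<in> B'" if "x \<in> B'" for x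
        proof -
          have "x \<in> carrier R" using that by (simp add: B'_iff)
          then have "\<zero> \<ominus> x = \<ominus> x" by algebra
          then show ?thesis using min[OF z that] by simp
        qed
        show "x \<oplus> y \<in> B'" if "x \<in> B'" "y \<in> B'" for x y
        proof -
          have "x \<in> carrier R" "y \<in> carrier R" using that by (simp_all add: B'_iff)
          then have "x \<ominus> (\<ominus> y) = x \<oplus> y" by algebra
          then show ?thesis using min[OF that(1) n[OF that(2)]] by simp
        qed
      qed (auto simp: B'_iff)
      have BB': "B \<subseteq> B'"
        using BS HS \<beta>0[OF v0(1)] by (auto simp: B'_iff a_minus_def subset_iff intro!: bexI[of _ \<zero>])
      have cb: "coset B y = (\<lambda>b. y \<oplus> b) ` B" if y: "y \<in> carrier R" for y
      proof (intro equalityI subsetI)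
        fix z assume "z \<in> coset B y"
        then show "z \<in> (\<lambda>b. y \<oplus> b) ` B"
        proof (intro image_eqI[of _ _ "z \<ominus> y"])
          assume z: "z \<in> coset B y"
          then have "z \<in> carrier R" by (simp add: coset_def)
          then show "z = y \<oplus> (z \<ominus> y)" using y by algebra
        qed (simp add: coset_def)
      next
        fix z assume "z \<in> (\<lambda>b. y \<oplus> b) ` B"
        then obtain c where c: "c \<in> B" "z = y \<oplus> c" by auto
        then have "c \<in> carrier R" using BS by auto
        moreover have "y \<oplus> c \<ominus> y = c" using y calculation by algebra
        ultimately show "z \<in> coset B y" using y c by (simp add: coset_def)
      qed
      have "finite B' \<and> card B' \<le> b * Suc m"
      proof -
        have fc: "finite C \<and> card C \<le> b" if C: "C \<in> coset B ` (\<lambda>x. \<beta> x v0) ` H" for C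
        proof -
          obtain x where "x \<in> H" "C = coset B (\<beta> x v0)" using C by auto
          then have "C = (\<lambda>b. \<beta> x v0 \<oplus> b) ` B" using cb \<beta>c v0 by simp
          then show ?thesis using Suc.prems(6,7) card_image_le[of B] by (metis finite_imageI le_trans)
        qed
        have "card B' \<le> (\<Sum>C\<in>coset B ` (\<lambda>x. \<beta> x v0) ` H. card C)"
          unfolding B'_def by (rule card_Union_le_sum_card)
        also have "\<dots> \<le> (\<Sum>C\<in>coset B ` (\<lambda>x. \<beta> x v0) ` H. b)" using fc by (intro sum_mono) auto
        also have "\<dots> = b * Suc m" using v0 by simp
        finally have "card B' \<le> b * Suc m" .
        moreover have "finite B'" unfolding B'_def by (rule finite_Union[OF bnd(1)[OF v0(1)]]) (use fc in blast)
        ultimately show ?thesis by blast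
      qed
      then have B'fin: "finite B'" "card B' \<le> b * Suc m" by auto
      have "finite (coset H' ` T) \<and> card (coset H' ` T) \<le> a * Suc m"
      proof -
        note TS = subgroup_facts[OF T]
        \<comment> \<open>A coset of \<open>H'\<close> is determined by the coset of \<open>H\<close> and the value of \<open>\<beta> _ v0\<close> at the difference to a representative of it.\<close>
        define r where "r x = (SOME y. y \<in> T \<and> coset H y = coset H x)" for x
        have r: "r x \<in> T \<and> coset H (r x) = coset H x" if "x \<in> T" for x
          unfolding r_def by (rule someI[of _ x]) (use that in auto)
        then have rH: "x \<ominus> r x \<in> H" if "x \<in> T" for x
          using that TS r[OF that] coset_eq_iff[OF Suc.prems(1), of x "r x"] by auto
        define f where "f x = (coset H x, coset B (\<beta> (x \<ominus> r x) v0))" for x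
        have "f ` T \<subseteq> coset H ` T \<times> coset B ` (\<lambda>x. \<beta> x v0) ` H" using rH by (auto simp: f_def)
        moreover have fin: "finite (coset H ` T \<times> coset B ` (\<lambda>x. \<beta> x v0) ` H)"
          using Suc.prems(3) bnd(1)[OF v0(1)] by simp
        ultimately have f: "finite (f ` T)" "card (f ` T) \<le> card (coset H ` T \<times> coset B ` (\<lambda>x. \<beta> x v0) ` H)"
          by (auto intro: finite_subset card_mono)
        have "card (coset H ` T \<times> coset B ` (\<lambda>x. \<beta> x v0) ` H) \<le> a * Suc m"
          unfolding card_cartesian_product v0(2) using Suc.prems(4) by (rule mult_le_mono1)
        moreover have "coset H' x = coset H' y" if xy: "x \<in> T" "y \<in> T" "f x = f y" for x y
        proof -
          have c: "coset H x = coset H y" "r x = r y" using xy by (auto simp: f_def r_def)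
          let ?r = "r x"
          have xr: "x \<ominus> ?r \<in> H" "y \<ominus> ?r \<in> H" using rH[OF xy(1)] rH[OF xy(2)] c(2) by simp_all
          have "coset B (\<beta> (x \<ominus> ?r) v0) = coset B (\<beta> (y \<ominus> ?r) v0)"
            using xy(3) c(2) by (simp add: f_def)
          then have "\<beta> (x \<ominus> ?r) v0 \<ominus> \<beta> (y \<ominus> ?r) v0 \<in> B"
            using coset_eq_iff[OF Suc.prems(5) \<beta>c[OF xr(1) v0(1)] \<beta>c[OF xr(2) v0(1)]] by blast
          then have "\<beta> ((x \<ominus> ?r) \<ominus> (y \<ominus> ?r)) v0 \<in> B"
            using addl[OF subsetD[OF HT xr(1)] subsetD[OF HT xr(2)] v0(1)] by simp
          moreover have "x \<in> carrier R" "y \<in> carrier R" "?r \<in> carrier R" using xy TS(1) r[OF xy(1)] by auto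
          then have "(x \<ominus> ?r) \<ominus> (y \<ominus> ?r) = x \<ominus> y" by algebra
          moreover have "x \<ominus> y \<in> H" using c(1) coset_eq_iff[OF Suc.prems(1)] xy TS(1) by auto
          ultimately have "x \<ominus> y \<in> H'" by (simp add: H'_def)
          then show ?thesis using coset_eq_iff[OF H'] xy TS(1) by auto
        qed
        ultimately show ?thesis using card_image_coarser[OF f(1), of "coset H'"] f(2) by (meson le_trans)
      qed
      then have H'ind: "finite (coset H' ` T)" "card (coset H' ` T) \<le> a * Suc m" by auto
      have small: "finite (coset B' ` (\<lambda>x. \<beta> x v) ` H') \<and> card (coset B' ` (\<lambda>x. \<beta> x v) ` H') \<le> m"
        if v: "v \<in> V" for v
      proof -
        let ?Y = "\<lambda>w. (\<lambda>x. \<beta> x w) ` H'"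
        have HH: "H' \<subseteq> H" by (auto simp: H'_def)
        have Yc: "?Y w \<subseteq> carrier R" if "w \<in> V" for w using \<beta>c HH that by auto
        have coarse: "coset B' x = coset B' y" if "x \<in> ?Y v" "y \<in> ?Y v" "coset B x = coset B y" for x y
        proof -
          have "x \<in> carrier R" "y \<in> carrier R" using that(1,2) Yc[OF v] by blast+
          then show ?thesis using that(3) coset_eq_iff[OF B'] coset_eq_iff[OF Suc.prems(5)] BB' by auto
        qed
        have sub: "coset B ` ?Y w \<subseteq> coset B ` (\<lambda>x. \<beta> x w) ` H" for w using HH by auto
        have f1: "finite (coset B ` ?Y w)" "card (coset B ` ?Y w) \<le> Suc m" if "w \<in> V" for w
        proof -
          show "finite (coset B ` ?Y w)" using finite_subset[OF sub bnd(1)[OF that]] .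
          show "card (coset B ` ?Y w) \<le> Suc m"
            using card_mono[OF bnd(1)[OF that] sub[of w]] bnd(2)[OF that] by simp
        qed
        have f2: "finite (coset B' ` ?Y v)" "card (coset B' ` ?Y v) \<le> card (coset B ` ?Y v)"
          using card_image_coarser[OF f1(1)[OF v], of "coset B'"] coarse by blast+
        have "card (coset B' ` ?Y v) \<noteq> Suc m"
        proof
          assume eq: "card (coset B' ` ?Y v) = Suc m"
          then have c1: "card (coset B ` ?Y v) = Suc m" using f2(2) f1(2)[OF v] by simp
          have inj: "x \<in> B" if x: "x \<in> ?Y v" "x \<in> B'" for x
          proof (rule ccontr)
            assume nB: "x \<notin> B"
            have z: "\<zero> \<in> ?Y v" using \<beta>0[OF v] subgroup_facts(2)[OF H'] by (metis image_eqI)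
            have xR: "x \<in> carrier R" using x Yc[OF v] by auto
            have "coset B x \<noteq> coset B \<zero>" using nB coset_eq_iff[OF Suc.prems(5) xR] xR by (simp add: a_minus_def)
            moreover have "coset B' x = coset B' \<zero>" using x coset_eq_iff[OF B' xR] xR by (simp add: a_minus_def)
            then have "coset B' ` ?Y v = coset B' ` (?Y v - {y \<in> ?Y v. coset B y = coset B x})"
            proof -
              assume e: "coset B' x = coset B' \<zero>"
              have "coset B' y \<in> coset B' ` (?Y v - {y \<in> ?Y v. coset B y = coset B x})" if y: "y \<in> ?Y v" for y
              proof (cases "coset B y = coset B x")
                case True
                then have "coset B' y = coset B' \<zero>" using coarse[OF y x(1)] e by simp
                then show ?thesis using z \<open>coset B x \<noteq> coset B \<zero>\<close> by (intro image_eqI[of _ _ \<zero>]) auto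
              qed (use y in auto)
              then show ?thesis by blast
            qed
            moreover have "coset B ` (?Y v - {y \<in> ?Y v. coset B y = coset B x}) \<subseteq> coset B ` ?Y v - {coset B x}" by auto
            then have "card (coset B ` (?Y v - {y \<in> ?Y v. coset B y = coset B x})) \<le> m"
            proof -
              assume s: "coset B ` (?Y v - {y \<in> ?Y v. coset B y = coset B x}) \<subseteq> coset B ` ?Y v - {coset B x}"
              have "card (coset B ` ?Y v - {coset B x}) = m"
                using card_Diff_singleton[of "coset B x" "coset B ` ?Y v"] c1 x(1) by auto
              then show ?thesis using card_mono[OF _ s] f1(1)[OF v] by simp
            qed
            moreover have "finite (coset B ` (?Y v - {y \<in> ?Y v. coset B y = coset B x}))"
              by (rule finite_subset[OF _ f1(1)[OF v]]) auto
            then have "card (coset B' ` (?Y v - {y \<in> ?Y v. coset B y = coset B x})) \<le> card (coset B ` (?Y v - {y \<in> ?Y v. coset B y = coset B x}))"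
              by (rule card_image_coarser(2)) (use coarse in blast)
            ultimately show False using eq by simp
          qed
          \<comment> \<open>The sum \<open>w\<close> of \<open>v0\<close> and \<open>v\<close> has the same values as \<open>v\<close> on \<open>H'\<close>, hence also no others on \<open>H\<close>.\<close>
          define w where "w = v0 \<oplus> v"
          have w: "w \<in> V" using V v0 v by (simp add: w_def)
          have "coset B (\<beta> x w) = coset B (\<beta> x v)" if x: "x \<in> H'" for x
          proof -
            have x': "x \<in> H" "\<beta> x v0 \<in> B" using x by (auto simp: H'_def)
            have c: "\<beta> x v0 \<in> carrier R" "\<beta> x v \<in> carrier R" using x' v0(1) v \<beta>c by auto
            have "\<beta> x w = \<beta> x v0 \<oplus> \<beta> x v" unfolding w_def by (rule addr[OF subsetD[OF HT x'(1)] v0(1) v])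
            then have "\<beta> x w \<ominus> \<beta> x v = \<beta> x v0" using c by algebra
            then show ?thesis using x' coset_eq_iff[OF Suc.prems(5)] \<beta>c v w by simp
          qed
          then have Yw: "coset B ` ?Y w = coset B ` ?Y v" unfolding image_image by (rule image_cong[OF refl])
          have eqw: "coset B ` ?Y u = coset B ` (\<lambda>x. \<beta> x u) ` H" if "u \<in> V" "coset B ` ?Y u = coset B ` ?Y v" for u
          proof (rule card_subset_eq[OF bnd(1)[OF that(1)] sub])
            show "card (coset B ` ?Y u) = card (coset B ` (\<lambda>x. \<beta> x u) ` H)"
              using card_mono[OF bnd(1)[OF that(1)] sub[of u]] bnd(2)[OF that(1)] c1 that(2) by simp
          qed
          have "\<beta> t v0 \<in> B" if t: "t \<in> H" for t
          proof -
            have "coset B (\<beta> t w) \<in> coset B ` ?Y v"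
              unfolding Yw[symmetric] eqw[OF w Yw] by (intro imageI t)
            moreover have "coset B (\<beta> t v) \<in> coset B ` ?Y v"
              unfolding eqw[OF v refl] by (intro imageI t)
            ultimately obtain p q where pq: "p \<in> H'" "q \<in> H'" "coset B (\<beta> t w) = coset B (\<beta> p v)"
              "coset B (\<beta> t v) = coset B (\<beta> q v)" by (elim imageE) simp
            have pqH: "p \<in> H" "q \<in> H" using pq by (auto simp: H'_def)
            have d: "\<beta> t w \<ominus> \<beta> p v \<in> B" "\<beta> t v \<ominus> \<beta> q v \<in> B"
              using pq pqH coset_eq_iff[OF Suc.prems(5)] \<beta>c t v w by auto
            have c: "\<beta> t v0 \<in> carrier R" "\<beta> t v \<in> carrier R" "\<beta> p v \<in> carrier R" "\<beta> q v \<in> carrier R"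
              using \<beta>c t v v0 pqH by auto
            have tw: "\<beta> t w = \<beta> t v0 \<oplus> \<beta> t v"
              unfolding w_def by (rule addr[OF subsetD[OF HT t] v0(1) v])
            have pqv: "\<beta> (p \<ominus> q) v = \<beta> p v \<ominus> \<beta> q v"
              by (rule addl[OF subsetD[OF HT pqH(1)] subsetD[OF HT pqH(2)] v])
            have e: "\<beta> t v0 = ((\<beta> t w \<ominus> \<beta> p v) \<ominus> (\<beta> t v \<ominus> \<beta> q v)) \<oplus> \<beta> (p \<ominus> q) v"
              unfolding tw pqv using c by algebra
            have e': "\<beta> (p \<ominus> q) v = \<beta> t v0 \<ominus> ((\<beta> t w \<ominus> \<beta> p v) \<ominus> (\<beta> t v \<ominus> \<beta> q v))"
              unfolding tw pqv using c by algebra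
            have "\<beta> t v0 \<ominus> \<beta> t v0 = \<zero>" using c(1) by algebra
            then have "\<beta> t v0 \<in> B'" using t c(1) BS(2) by (auto simp: B'_iff intro!: bexI[of _ t])
            then have "\<beta> (p \<ominus> q) v \<in> B'"
              unfolding e' using subsetD[OF BB' BS(5)[OF d]] by (rule subgroup_facts(5)[OF B'])
            moreover have "p \<ominus> q \<in> H'" using pq(1,2) by (rule subgroup_facts(5)[OF H'])
            ultimately have "\<beta> (p \<ominus> q) v \<in> B" using inj[of "\<beta> (p \<ominus> q) v"] by simp
            then show ?thesis unfolding e by (rule BS(3)[OF BS(5)[OF d]])
          qed
          then have "coset B ` (\<lambda>x. \<beta> x v0) ` H \<subseteq> {coset B \<zero>}"
          proof -
            assume inB: "\<And>t. t \<in> H \<Longrightarrow> \<beta> t v0 \<in> B"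
            have "coset B (\<beta> t v0) = coset B \<zero>" if t: "t \<in> H" for t
            proof -
              have "\<beta> t v0 \<ominus> \<zero> = \<beta> t v0" using \<beta>c[OF t v0(1)] by algebra
              then show ?thesis using coset_eq_iff[OF Suc.prems(5) \<beta>c[OF t v0(1)] zero_closed] inB[OF t] by simp
            qed
            then show ?thesis by (simp add: image_subset_iff)
          qed
          then have "Suc m \<le> card {coset B \<zero>}" unfolding v0(2)[symmetric] by (intro card_mono) auto
          then show False using m by simp
        qed
        then show ?thesis using f2 f1(2)[OF v] by auto
      qed
      have "\<exists>H'' B''. additive_subgroup H'' R \<and> H'' \<subseteq> T \<and> finite (coset H'' ` T) \<and> card (coset H'' ` T) \<le> a * Suc m * fact m \<and>
        additive_subgroup B'' R \<and> finite B'' \<and> card B'' \<le> b * Suc m * fact m \<and> (\<forall>x\<in>H''. \<forall>v\<in>V. \<beta> x v \<in> B'')"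
        by (rule Suc.IH[OF H' _ H'ind B' B'fin]) (use HT small in \<open>auto simp: H'_def\<close>)
      moreover have "k * Suc m * fact m = k * fact (Suc m)" for k :: nat by (simp only: fact_Suc mult.assoc of_nat_id)
      ultimately show ?thesis by metis
    qed
  qed
qed

end

section \<open>Sums of square-zero ideals\<close>

context rng begin

text \<open>
  A multiplicatively closed set \<open>N\<close> of nilpotent elements acts nilpotently on a finite module \<open>Y / H\<close>:
  as long as the products \<open>x z1 \<dots> zk\<close> stay outside \<open>H\<close>, the sets \<open>x z1 \<dots> zk N\<close> of cosets decrease
  strictly. For if \<open>y z N\<close> contained \<open>y z\<close>, then \<open>y z = y z w\<close> for some nilpotent \<open>w\<close>, and \<open>y z\<close> would
  vanish.
\<close>

lemma nil_action:
  assumes N: "N \<subseteq> carrier R" "\<And>z w. z \<in> N \<Longrightarrow> w \<in> N \<Longrightarrow> z \<otimes> w \<in> N" "\<And>z. z \<in> N \<Longrightarrow> \<exists>k. pw z k = \<zero>"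
    and Y: "Y \<subseteq> carrier R" "\<And>x z. x \<in> Y \<Longrightarrow> z \<in> N \<Longrightarrow> x \<otimes> z \<in> Y"
    and H: "additive_subgroup H R" "\<And>x z. x \<in> H \<Longrightarrow> z \<in> N \<Longrightarrow> x \<otimes> z \<in> H"
    and fin: "finite (coset H ` Y)" "card (coset H ` Y) \<le> length zs"
    and x: "x \<in> Y" and zs: "set zs \<subseteq> N"
  shows "mprod R (x # zs) \<in> H"
proof (rule ccontr)
  assume out: "mprod R (x # zs) \<notin> H"
  note HS = subgroup_facts[OF H(1)]
  define f where "f y = (\<lambda>z. coset H (y \<otimes> z)) ` N" for y
  have f_sub: "f y \<subseteq> coset H ` Y" if "y \<in> Y" for y using that Y(2) by (auto simp: f_def)
  have f_fin: "finite (f y)" if "y \<in> Y" for y using finite_subset[OF f_sub[OF that] fin(1)] .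
  have H_closed: "mprod R (y # ws) \<in> H" if "y \<in> H" "set ws \<subseteq> N" for y ws
    using that H(2) by (induction ws arbitrary: y) (auto simp: mprod_def)
  have drop: "card (f (y \<otimes> z)) < card (f y)" if y: "y \<in> Y" and z: "z \<in> N" and yz: "y \<otimes> z \<notin> H" for y z
  proof (rule psubset_card_mono[OF f_fin[OF y]], rule psubsetI)
    have yR: "y \<in> carrier R" and zR: "z \<in> carrier R" using y z Y N by auto
    have "coset H (y \<otimes> z \<otimes> w) \<in> f y" if w: "w \<in> N" for w
    proof -
      have "y \<otimes> z \<otimes> w = y \<otimes> (z \<otimes> w)" using yR zR w N(1) by (intro m_assoc) auto
      then show ?thesis using N(2)[OF z w] by (simp add: f_def)
    qed
    then show "f (y \<otimes> z) \<subseteq> f y" by (auto simp: f_def[of "y \<otimes> z"])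
    show "f (y \<otimes> z) \<noteq> f y"
    proof
      assume "f (y \<otimes> z) = f y"
      moreover have "coset H (y \<otimes> z) \<in> f y" using z by (auto simp: f_def)
      ultimately obtain w where w: "w \<in> N" "coset H (y \<otimes> z) = coset H (y \<otimes> z \<otimes> w)"
        by (auto simp: f_def[of "y \<otimes> z"])
      have wR: "w \<in> carrier R" using w N by auto
      define t where "t = y \<otimes> z"
      have tR: "t \<in> carrier R" using yR zR by (simp add: t_def m_closed)
      have tw: "t \<ominus> t \<otimes> w \<in> H"
        using w(2) coset_eq_iff[OF H(1) tR m_closed[OF tR wR]] by (simp add: t_def)
      have "t \<ominus> t \<otimes> pw w k \<in> H" for k
      proof (induction k)
        case (Suc k)
        have pR: "pw w k \<in> carrier R" using wR by simp
        have "t \<ominus> t \<otimes> pw w (Suc k) = (t \<ominus> t \<otimes> w) \<oplus> (t \<ominus> t \<otimes> pw w k) \<otimes> w"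
          unfolding pw.simps(2) using tR wR pR by algebra
        then show ?case using HS(3)[OF tw H(2)[OF Suc w(1)]] by simp
      qed (use tw in simp)
      moreover obtain k where "pw w k = \<zero>" using N(3)[OF w(1)] by blast
      ultimately have "t \<ominus> t \<otimes> \<zero> \<in> H" by metis
      moreover have "t \<ominus> t \<otimes> \<zero> = t" using tR by algebra
      ultimately show False using yz by (simp add: t_def)
    qed
  qed
  have "mprod R (y # ws) \<notin> H \<Longrightarrow> y \<in> Y \<Longrightarrow> set ws \<subseteq> N \<Longrightarrow> N \<noteq> {} \<Longrightarrow> length ws < card (f y)" for y ws
  proof (induction ws arbitrary: y)
    case Nil
    then have "f y \<noteq> {}" by (simp add: f_def)
    then show ?case using f_fin[OF Nil(2)] by (simp add: card_gt_0_iff)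
  next
    case (Cons w ws)
    have e: "mprod R (y # w # ws) = mprod R ((y \<otimes> w) # ws)" by (simp add: mprod_def)
    have w: "w \<in> N" using Cons.prems by simp
    have "length ws < card (f (y \<otimes> w))"
      using Cons.prems e Y(2)[OF Cons.prems(2) w] by (intro Cons.IH) auto
    moreover have "y \<otimes> w \<notin> H" using Cons.prems(1,3) e H_closed[of "y \<otimes> w" ws] by auto
    ultimately show ?case using drop[OF Cons.prems(2) w] by simp
  qed
  note len = this[OF out x zs]
  have "N \<noteq> {}"
  proof
    assume "N = {}"
    then have "zs = []" using zs by simp
    then have "coset H ` Y = {}" using fin by simp
    then show False using x by simp
  qed
  then have "length zs < card (coset H ` Y)"
    using len card_mono[OF fin(1) f_sub[OF x]] by simp
  then show False using fin(2) by simp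
qed

text \<open>
  Otherwise one could choose, for each row \<open>i\<close> independently, elements \<open>u\<close> and \<open>v\<close> and then \<open>n\<close> elements
  of \<open>T i\<close> separated by them, which is a separating array.
\<close>

lemma finite_row:
  assumes arr: "\<forall>u v x. \<not> separating_array R {\<zero>} n u v x"
    and T: "\<And>j. j < n \<Longrightarrow> T j \<subseteq> carrier R" "\<And>i. i < n \<Longrightarrow> U i \<subseteq> carrier R" "\<And>i. i < n \<Longrightarrow> V i \<subseteq> carrier R"
    and orth: "\<And>i l u v x. i < n \<Longrightarrow> l < n \<Longrightarrow> l \<noteq> i \<Longrightarrow> u \<in> U i \<Longrightarrow> v \<in> V i \<Longrightarrow> x \<in> T l \<Longrightarrow> u \<otimes> x \<otimes> v = \<zero>"
  shows "\<exists>i<n. \<forall>u\<in>U i. \<forall>v\<in>V i. finite ((\<lambda>x. u \<otimes> x \<otimes> v) ` T i) \<and> card ((\<lambda>x. u \<otimes> x \<otimes> v) ` T i) \<le> n"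
proof (rule ccontr)
  assume "\<not> ?thesis"
  then have "\<forall>i. \<exists>u v. i < n \<longrightarrow> u \<in> U i \<and> v \<in> V i \<and>
      (infinite ((\<lambda>x. u \<otimes> x \<otimes> v) ` T i) \<or> \<not> card ((\<lambda>x. u \<otimes> x \<otimes> v) ` T i) \<le> n)"
    by blast
  then obtain u v where uv: "\<And>i. i < n \<Longrightarrow> u i \<in> U i" "\<And>i. i < n \<Longrightarrow> v i \<in> V i"
    and big: "\<And>i. i < n \<Longrightarrow> infinite ((\<lambda>x. u i \<otimes> x \<otimes> v i) ` T i) \<or> \<not> card ((\<lambda>x. u i \<otimes> x \<otimes> v i) ` T i) \<le> n"
    by metis
  have "\<exists>x. \<forall>j<n. x j \<in> T i \<and> (\<forall>j'<n. j \<noteq> j' \<longrightarrow> u i \<otimes> x j \<otimes> v i \<noteq> u i \<otimes> x j' \<otimes> v i)" if i: "i < n" for i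
  proof -
    let ?W = "(\<lambda>x. u i \<otimes> x \<otimes> v i) ` T i"
    obtain Y where Y: "Y \<subseteq> ?W" "card Y = n" "finite Y"
      using big[OF i] obtain_subset_with_card_n[of n ?W] infinite_arbitrarily_large[of ?W n]
      by (metis linorder_le_cases)
    then obtain h where h: "bij_betw h {..<n} Y" using bij_betw_iff_card[of "{..<n}" Y] by auto
    have "\<exists>y. y \<in> T i \<and> u i \<otimes> y \<otimes> v i = h j" if j: "j < n" for j
    proof -
      have "h j \<in> ?W" using h Y j by (auto simp: bij_betw_def)
      then show ?thesis by auto
    qed
    then obtain x where x: "\<And>j. j < n \<Longrightarrow> x j \<in> T i \<and> u i \<otimes> x j \<otimes> v i = h j" by metis
    have "u i \<otimes> x j \<otimes> v i \<noteq> u i \<otimes> x j' \<otimes> v i" if "j < n" "j' < n" "j \<noteq> j'" for j j'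
      using x[OF that(1)] x[OF that(2)] h that by (auto simp: bij_betw_def inj_on_def)
    then show ?thesis using x by blast
  qed
  then obtain x where x: "\<And>i j. i < n \<Longrightarrow> j < n \<Longrightarrow> x i j \<in> T i"
    "\<And>i j j'. i < n \<Longrightarrow> j < n \<Longrightarrow> j' < n \<Longrightarrow> j \<noteq> j' \<Longrightarrow> u i \<otimes> x i j \<otimes> v i \<noteq> u i \<otimes> x i j' \<otimes> v i"
    by metis
  have c: "u i \<in> carrier R" "v i \<in> carrier R" "x i j \<in> carrier R" if "i < n" "j < n" for i j
    using uv x(1) T that by blast+
  have "u i \<otimes> x i j \<otimes> v i \<ominus> u i \<otimes> x i j' \<otimes> v i \<noteq> \<zero>" if ij: "i < n" "j < n" "j' < n" "j \<noteq> j'" for i j j'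
    using x(2)[OF ij] c[OF ij(1,2)] c[OF ij(1,3)] by (simp add: minus_eq_zero_iff m_closed)
  then have "separating_array R {\<zero>} n u v x"
    unfolding separating_array_def using c orth uv x(1) by simp
  then show False using arr by blast
qed

text \<open>
  Neumann's lemma, for fixed \<open>u\<close>, yields a finite subgroup \<open>B'\<close> such that the elements \<open>x\<close> of \<open>T\<close> with
  \<open>u x V \<subseteq> B'\<close> form a right ideal \<open>G\<close> of bounded index. So \<open>N\<close> acts nilpotently on \<open>T / G\<close>, and a long
  product takes \<open>x\<close> into \<open>G\<close>. Then \<open>c = u x z1 \<dots> zq\<close> is such that \<open>c V\<close> is small, and the annihilator of
  \<open>c\<close> in \<open>V\<close> is again of bounded index.
\<close>

lemma bounded_row_nilpotent:
  assumes N: "N \<subseteq> carrier R" "\<And>z w. z \<in> N \<Longrightarrow> w \<in> N \<Longrightarrow> z \<otimes> w \<in> N" "\<And>z. z \<in> N \<Longrightarrow> \<exists>k. pw z k = \<zero>"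
    and T: "two_sided_ideal R T" and V: "two_sided_ideal R V" and u: "u \<in> carrier R"
    and bnd: "\<And>v. v \<in> V \<Longrightarrow> finite ((\<lambda>x. u \<otimes> x \<otimes> v) ` T) \<and> card ((\<lambda>x. u \<otimes> x \<otimes> v) ` T) \<le> n"
    and x: "x \<in> T" and v: "v \<in> V"
    and zs: "length zs = fact n" "set zs \<subseteq> N" and ws: "length ws = fact n" "set ws \<subseteq> N"
  shows "u \<otimes> mprod R (x # zs) \<otimes> mprod R (v # ws) = \<zero>"
proof -
  note TI = ideal_facts[OF T] and VI = ideal_facts[OF V]
  note TS = subgroup_facts[OF TI(1)] and VS = subgroup_facts[OF VI(1)]
  define \<beta> where "\<beta> x v = u \<otimes> x \<otimes> v" for x v
  have z0: "additive_subgroup {\<zero>} R" using ideal_facts(1)[OF zero_ideal] .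
  have "coset T ` T \<subseteq> {coset T \<zero>}"
  proof -
    have "coset T x = coset T \<zero>" if "x \<in> T" for x
      using that TS(1,2,5) coset_eq_iff[OF TI(1), of x \<zero>] by auto
    then show ?thesis by blast
  qed
  then have c1: "finite (coset T ` T)" "card (coset T ` T) \<le> 1"
    using card_mono[of "{coset T \<zero>}" "coset T ` T"] finite_subset by auto
  have "\<exists>H' B'. additive_subgroup H' R \<and> H' \<subseteq> T \<and> finite (coset H' ` T) \<and> card (coset H' ` T) \<le> 1 * fact n \<and>
      additive_subgroup B' R \<and> finite B' \<and> card B' \<le> 1 * fact n \<and> (\<forall>x\<in>H'. \<forall>v\<in>V. \<beta> x v \<in> B')"
  proof (rule neumann_lemma[where H = T and B = "{\<zero>}"])
    fix v assume v: "v \<in> V"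
    have inj: "card (coset {\<zero>} ` (\<lambda>x. \<beta> x v) ` T) \<le> card ((\<lambda>x. \<beta> x v) ` T)"
      using bnd[OF v] by (intro card_image_le) (simp add: \<beta>_def)
    show "finite (coset {\<zero>} ` (\<lambda>x. \<beta> x v) ` T) \<and> card (coset {\<zero>} ` (\<lambda>x. \<beta> x v) ` T) \<le> n"
      using bnd[OF v] inj by (auto simp: \<beta>_def)
  next
    fix x y v assume "x \<in> T" "y \<in> T" "v \<in> V"
    then have "x \<in> carrier R" "y \<in> carrier R" "v \<in> carrier R" using TS VS by auto
    then show "\<beta> (x \<ominus> y) v = \<beta> x v \<ominus> \<beta> y v" unfolding \<beta>_def using u by algebra
  next
    fix x v w assume "x \<in> T" "v \<in> V" "w \<in> V"
    then have "x \<in> carrier R" "v \<in> carrier R" "w \<in> carrier R" using TS VS by auto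
    then show "\<beta> x (v \<oplus> w) = \<beta> x v \<oplus> \<beta> x w" unfolding \<beta>_def using u by algebra
  next
    fix x v assume "x \<in> T" "v \<in> V"
    then show "\<beta> x v \<in> carrier R" unfolding \<beta>_def using u TS VS by (auto intro!: m_closed)
  qed (use TI z0 VS c1 in auto)
  then obtain H' B' where H': "additive_subgroup H' R" "H' \<subseteq> T" "finite (coset H' ` T)" "card (coset H' ` T) \<le> fact n"
    and B': "additive_subgroup B' R" "finite B'" "card B' \<le> fact n"
    and HB: "\<And>x v. x \<in> H' \<Longrightarrow> v \<in> V \<Longrightarrow> u \<otimes> x \<otimes> v \<in> B'"
    unfolding \<beta>_def mult_1 by blast
  note BS = subgroup_facts[OF B'(1)]
  define G where "G = {x \<in> T. \<forall>v\<in>V. u \<otimes> x \<otimes> v \<in> B'}"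
  have G: "additive_subgroup G R"
  proof (rule additive_subgroup_intro)
    show "\<zero> \<in> G" using TS(2) VS(1) BS(2) u by (auto simp: G_def subset_iff)
    fix x assume x: "x \<in> G"
    have xR: "x \<in> carrier R" using x TS by (auto simp: G_def)
    have "u \<otimes> (\<ominus> x) \<otimes> v = \<ominus> (u \<otimes> x \<otimes> v)" if "v \<in> carrier R" for v using xR u that by algebra
    then show "\<ominus> x \<in> G" using x TS(4) BS(4) VS(1) by (auto simp: G_def subset_iff)
    fix y assume y: "y \<in> G"
    have yR: "y \<in> carrier R" using y TS by (auto simp: G_def)
    have "u \<otimes> (x \<oplus> y) \<otimes> v = u \<otimes> x \<otimes> v \<oplus> u \<otimes> y \<otimes> v" if "v \<in> carrier R" for v
      using xR yR u that by algebra
    then show "x \<oplus> y \<in> G" using x y TS(3) BS(3) VS(1) by (auto simp: G_def subset_iff)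
  qed (use TS in \<open>auto simp: G_def\<close>)
  have HG: "H' \<subseteq> G" using H'(2) HB by (auto simp: G_def)
  have coarse: "coset G x = coset G y" if "x \<in> T" "y \<in> T" "coset H' x = coset H' y" for x y
  proof -
    have "x \<in> carrier R" "y \<in> carrier R" using that TS(1) by auto
    then show ?thesis using that(3) HG coset_eq_iff[OF H'(1)] coset_eq_iff[OF G] by auto
  qed
  have cG: "finite (coset G ` T)" "card (coset G ` T) \<le> card (coset H' ` T)"
    by (rule card_image_coarser[OF H'(3)], rule coarse, assumption+)+
  have "mprod R (x # zs) \<in> G"
  proof (rule nil_action[where N = N and Y = T])
    show "finite (coset G ` T)" "card (coset G ` T) \<le> length zs"
      using cG H'(4) zs(1) by simp_all
    fix x z assume x: "x \<in> G" and z: "z \<in> N"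
    have R: "x \<in> carrier R" "z \<in> carrier R" using x z TS(1) N(1) by (auto simp: G_def)
    have "u \<otimes> (x \<otimes> z) \<otimes> v = u \<otimes> x \<otimes> (z \<otimes> v)" if "v \<in> carrier R" for v
      using R u that by (simp add: m_assoc m_closed)
    then show "x \<otimes> z \<in> G" using x R TI(4) VI(3) VS(1) by (auto simp: G_def subset_iff)
  qed (use N TI G x zs in auto)
  then have xB: "u \<otimes> mprod R (x # zs) \<otimes> v \<in> B'" if "v \<in> V" for v using that by (simp add: G_def)
  define c where "c = u \<otimes> mprod R (x # zs)"
  have cR: "c \<in> carrier R"
    unfolding c_def using u x zs TS(1) N(1) by (intro m_closed mprod_closed) auto
  define K where "K = {v \<in> V. c \<otimes> v = \<zero>}"
  have K: "additive_subgroup K R"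
    by (rule additive_subgroup_intro) (use VS cR in \<open>auto simp: K_def r_distr r_minus subset_iff\<close>)
  have cV: "(\<lambda>v. c \<otimes> v) ` V \<subseteq> B'" using xB by (auto simp: c_def)
  have kcoarse: "coset K v = coset K w" if "v \<in> V" "w \<in> V" "c \<otimes> v = c \<otimes> w" for v w
  proof -
    have R: "v \<in> carrier R" "w \<in> carrier R" using that VS(1) by auto
    have "c \<otimes> (v \<ominus> w) = c \<otimes> v \<ominus> c \<otimes> w" using R cR by (simp add: r_distr_minus)
    then have "c \<otimes> (v \<ominus> w) = \<zero>" using R cR that(3) by (simp add: minus_eq_zero_iff m_closed)
    then show ?thesis using that VS(5) coset_eq_iff[OF K R] by (simp add: K_def)
  qed
  have f: "finite ((\<lambda>v. c \<otimes> v) ` V)" "card ((\<lambda>v. c \<otimes> v) ` V) \<le> fact n"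
    using finite_subset[OF cV B'(2)] card_mono[OF B'(2) cV] B'(3) by auto
  have cK: "finite (coset K ` V)" "card (coset K ` V) \<le> card ((\<lambda>v. c \<otimes> v) ` V)"
    by (rule card_image_coarser[OF f(1)], rule kcoarse, assumption+)+
  have "mprod R (v # ws) \<in> K"
  proof (rule nil_action[where N = N and Y = V])
    show "finite (coset K ` V)" "card (coset K ` V) \<le> length ws"
      using cK f(2) ws(1) by simp_all
    fix v z assume v: "v \<in> K" and z: "z \<in> N"
    have R: "v \<in> carrier R" "z \<in> carrier R" using v z VS(1) N(1) by (auto simp: K_def)
    have "c \<otimes> (v \<otimes> z) = c \<otimes> v \<otimes> z" using R cR by (simp add: m_assoc)
    then show "v \<otimes> z \<in> K" using v R VI(4) by (simp add: K_def)
  qed (use N VI K v ws in auto)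
  then show ?thesis by (simp add: K_def c_def)
qed

lemma foldl_mult: "c \<in> carrier R \<Longrightarrow> set ps \<subseteq> carrier R \<Longrightarrow> ps \<noteq> [] \<Longrightarrow> foldl (\<otimes>) c ps = c \<otimes> mprod R ps"
  using mprod_Cons[of c ps] by (simp add: mprod_def)

text \<open>
  The first factor lies in an ideal of square zero, and the \<open>q\<close> other ones provide the nilpotent action
  of \<open>N\<close>.
\<close>

definition blocks :: "'a set \<Rightarrow> nat \<Rightarrow> 'a set" where
  "blocks N q = {mprod R (t # zs) | t zs. t \<in> square_zero R {\<zero>} \<and> length zs = q \<and> set zs \<subseteq> N}"

text \<open>
  Let \<open>T j\<close> be a square-zero ideal containing the first factor of the \<open>j\<close>-th block. For some \<open>i < n\<close>, the
  row of \<open>T (i + 1)\<close> is bounded with respect to elements \<open>u\<close> of the preceding and \<open>v\<close> of the following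
  ideals. The product of the blocks has the form required by \<open>bounded_row_nilpotent\<close>. Here the first
  block makes sure that there is some \<open>u\<close>, the last but one that there is some \<open>v\<close>, and the remaining
  factors of the last one follow after \<open>v\<close>.
\<close>

lemma blocks_product_zero:
  assumes arr: "\<forall>u v x. \<not> separating_array R {\<zero>} n u v x"
    and N: "N \<subseteq> carrier R" "\<And>z w. z \<in> N \<Longrightarrow> w \<in> N \<Longrightarrow> z \<otimes> w \<in> N" "\<And>z. z \<in> N \<Longrightarrow> \<exists>k. pw z k = \<zero>"
    and ps: "length ps = n + 3" "set ps \<subseteq> blocks N (fact n)"
  shows "mprod R ps = \<zero>"
proof -
  have "\<exists>t zs T. ps ! j = mprod R (t # zs) \<and> length zs = fact n \<and> set zs \<subseteq> N \<and> two_sided_ideal R T \<and> t \<in> T \<and>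
      (\<forall>a\<in>T. \<forall>b\<in>T. a \<otimes> b = \<zero>)" if j: "j < n + 3" for j
  proof -
    have "ps ! j \<in> blocks N (fact n)" using ps j by auto
    then obtain t zs where t: "t \<in> square_zero R {\<zero>}" "ps ! j = mprod R (t # zs)" "length zs = fact n" "set zs \<subseteq> N"
      by (auto simp: blocks_def)
    then show ?thesis using square_zero_ideal[OF t(1)] by metis
  qed
  then have "\<forall>j. \<exists>t zs T. j < n + 3 \<longrightarrow> (ps ! j = mprod R (t # zs) \<and> length zs = fact n \<and> set zs \<subseteq> N \<and>
      two_sided_ideal R T \<and> t \<in> T \<and> (\<forall>a\<in>T. \<forall>b\<in>T. a \<otimes> b = \<zero>))"
    by blast
  then obtain t zs T where tzT: "\<forall>j. j < n + 3 \<longrightarrow> (ps ! j = mprod R (t j # zs j) \<and> length (zs j) = fact n \<and>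
      set (zs j) \<subseteq> N \<and> two_sided_ideal R (T j) \<and> t j \<in> T j \<and> (\<forall>a\<in>T j. \<forall>b\<in>T j. a \<otimes> b = \<zero>))"
    unfolding choice_iff by blast
  have psj: "\<And>j. j < n + 3 \<Longrightarrow> ps ! j = mprod R (t j # zs j)"
    and zs: "\<And>j. j < n + 3 \<Longrightarrow> length (zs j) = fact n" "\<And>j. j < n + 3 \<Longrightarrow> set (zs j) \<subseteq> N"
    and T: "\<And>j. j < n + 3 \<Longrightarrow> two_sided_ideal R (T j)" and tT: "\<And>j. j < n + 3 \<Longrightarrow> t j \<in> T j"
    and sq: "\<And>j a b. j < n + 3 \<Longrightarrow> a \<in> T j \<Longrightarrow> b \<in> T j \<Longrightarrow> a \<otimes> b = \<zero>"
    using tzT by blast+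
  note TI = ideal_facts[OF T]
  have tR: "t j \<in> carrier R" "set (zs j) \<subseteq> carrier R" if "j < n + 3" for j
    using tT[OF that] TI(2)[OF that] zs(2)[OF that] N(1) by auto
  have pT: "ps ! j \<in> T j" if j: "j < n + 3" for j
    unfolding psj[OF j] by (rule mprod_in_ideal[OF T[OF j], of _ "t j"]) (use tR[OF j] tT[OF j] in auto)
  have psR: "set ps \<subseteq> carrier R"
  proof
    fix p assume "p \<in> set ps"
    then obtain j where "j < n + 3" "p = ps ! j" using ps(1) by (metis in_set_conv_nth)
    then show "p \<in> carrier R" using pT TI(2) by blast
  qed
  define U where "U i = carrier R \<inter> (\<Inter>j\<le>i. T j)" for i
  define V where "V i = carrier R \<inter> (\<Inter>j\<in>{Suc (Suc i)..Suc n}. T j)" for i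
  have V: "two_sided_ideal R (V i)" for i
    unfolding two_sided_ideal_def
  proof (intro conjI additive_subgroup_intro ballI)
    have S: "two_sided_ideal R (T j)" if "j \<in> {Suc (Suc i)..Suc n}" for j using T that by auto
    note I = ideal_facts[OF S] and G = subgroup_facts[OF ideal_facts(1)[OF S]]
    show "\<zero> \<in> V i" using G by (auto simp: V_def)
    fix x assume x: "x \<in> V i"
    show "\<ominus> x \<in> V i" using G x by (auto simp: V_def)
    { fix y assume y: "y \<in> V i" show "x \<oplus> y \<in> V i" using G x y by (auto simp: V_def) }
    fix y assume y: "y \<in> carrier R"
    show "y \<otimes> x \<in> V i" "x \<otimes> y \<in> V i" using I x y by (auto simp: V_def m_closed)
  qed (auto simp: V_def)
  have "\<exists>i<n. \<forall>u\<in>U i. \<forall>v\<in>V i. finite ((\<lambda>x. u \<otimes> x \<otimes> v) ` T (Suc i)) \<and> card ((\<lambda>x. u \<otimes> x \<otimes> v) ` T (Suc i)) \<le> n"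
  proof (rule finite_row[OF arr, where T = "\<lambda>i. T (Suc i)"])
    fix i l u v x assume il: "i < n" "l < n" "l \<noteq> i" and u: "u \<in> U i" and v: "v \<in> V i" and x: "x \<in> T (Suc l)"
    have R: "u \<in> carrier R" "v \<in> carrier R" "x \<in> carrier R" using u v x TI(2)[of "Suc l"] il by (auto simp: U_def V_def)
    show "u \<otimes> x \<otimes> v = \<zero>"
    proof (cases "l < i")
      case True
      then have "u \<in> T (Suc l)" using u by (auto simp: U_def)
      then have "u \<otimes> x = \<zero>" using sq[of "Suc l"] x il by auto
      then show ?thesis using R by simp
    next
      case False
      then have "v \<in> T (Suc l)" using v il by (auto simp: V_def)
      then have "x \<otimes> v = \<zero>" using sq[of "Suc l"] x il by auto
      then show ?thesis using R by (simp add: m_assoc)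
    qed
  qed (use TI(2) in \<open>auto simp: U_def V_def\<close>)
  then obtain i where i: "i < n"
    and row: "\<And>u v. u \<in> U i \<Longrightarrow> v \<in> V i \<Longrightarrow> finite ((\<lambda>x. u \<otimes> x \<otimes> v) ` T (Suc i)) \<and> card ((\<lambda>x. u \<otimes> x \<otimes> v) ` T (Suc i)) \<le> n"
    by blast
  define as where "as = take (Suc i) ps"
  define bs where "bs = take (n - i) (drop (Suc (Suc i)) ps)"
  \<comment> \<open>The product is cut before and after the factor that belongs to the bounded row.\<close>
  have split: "ps = as @ [ps ! Suc i] @ bs @ [ps ! (n + 2)]"
  proof -
    have "ps = as @ ps ! Suc i # drop (Suc (Suc i)) ps"
      unfolding as_def using i ps(1) by (intro id_take_nth_drop) simp
    moreover have "drop (Suc (Suc i)) ps = bs @ drop (n + 2) ps"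
    proof -
      have "drop (n - i) (drop (Suc (Suc i)) ps) = drop (n + 2) ps" using i by simp
      then show ?thesis unfolding bs_def by (metis append_take_drop_id)
    qed
    moreover have "drop (n + 2) ps = [ps ! (n + 2)]"
      using ps(1) by (subst Cons_nth_drop_Suc[symmetric]) auto
    ultimately show ?thesis by simp
  qed
  have ne: "as \<noteq> []" "bs \<noteq> []" using i ps(1) by (auto simp: as_def bs_def)
  have R: "set as \<subseteq> carrier R" "set bs \<subseteq> carrier R" "ps ! Suc i \<in> carrier R" "ps ! (n + 2) \<in> carrier R"
  proof -
    have "set ps = set as \<union> {ps ! Suc i} \<union> set bs \<union> {ps ! (n + 2)}"
      by (subst split) auto
    then show "set as \<subseteq> carrier R" "set bs \<subseteq> carrier R" "ps ! Suc i \<in> carrier R" "ps ! (n + 2) \<in> carrier R"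
      using psR by blast+
  qed
  have u: "mprod R as \<in> U i"
  proof -
    have "mprod R as \<in> T j" if j: "j \<le> i" for j
    proof (rule mprod_in_ideal[OF _ R(1)])
      show "two_sided_ideal R (T j)" "ps ! j \<in> T j" using T pT i j by auto
      have "as ! j = ps ! j" "j < length as" using i j ps(1) by (auto simp: as_def)
      then show "ps ! j \<in> set as" by (metis nth_mem)
    qed
    then show ?thesis using mprod_closed[OF ne(1) R(1)] by (auto simp: U_def)
  qed
  have bsV: "mprod R bs \<in> V i"
  proof -
    have "mprod R bs \<in> T j" if j: "Suc (Suc i) \<le> j" "j \<le> Suc n" for j
    proof (rule mprod_in_ideal[OF _ R(2)])
      show "two_sided_ideal R (T j)" "ps ! j \<in> T j" using T pT i j by auto
      obtain k where k: "j = Suc (Suc i) + k" using j(1) le_Suc_ex by blast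
      then have "bs ! k = ps ! j" "k < length bs"
        using i j ps(1) by (auto simp: bs_def)
      then show "ps ! j \<in> set bs" by (metis nth_mem)
    qed
    then show ?thesis using mprod_closed[OF ne(2) R(2)] by (auto simp: V_def)
  qed
  note tN = tR[of "n + 2"]
  have v: "mprod R bs \<otimes> t (n + 2) \<in> V i" using ideal_facts(4)[OF V tN(1) bsV] by simp
  have uR: "mprod R as \<in> carrier R" and bR: "mprod R bs \<in> carrier R" using u bsV by (auto simp: U_def V_def)
  have "mprod R ps = mprod R as \<otimes> (ps ! Suc i \<otimes> (mprod R bs \<otimes> ps ! (n + 2)))"
    by (subst split) (use ne R mprod_closed in \<open>simp add: mprod_append mprod_Cons\<close>)
  also have "\<dots> = (mprod R as \<otimes> ps ! Suc i) \<otimes> (mprod R bs \<otimes> ps ! (n + 2))"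
    using uR bR R by (simp add: m_assoc m_closed)
  also have "mprod R bs \<otimes> ps ! (n + 2) = mprod R ((mprod R bs \<otimes> t (n + 2)) # zs (n + 2))"
    using psj[of "n + 2"] mprod_mult_Cons[OF bR tN] by simp
  also have "ps ! Suc i = mprod R (t (Suc i) # zs (Suc i))" using psj i by simp
  also have "mprod R as \<otimes> mprod R (t (Suc i) # zs (Suc i)) \<otimes> mprod R ((mprod R bs \<otimes> t (n + 2)) # zs (n + 2)) = \<zero>"
    by (rule bounded_row_nilpotent[OF N T[of "Suc i"] V uR row[OF u] tT[of "Suc i"] v
          zs(1)[of "Suc i"] zs(2)[of "Suc i"] zs(1)[of "n + 2"] zs(2)[of "n + 2"]]) (use i in auto)
  finally show ?thesis .
qed

text \<open>
  A long product of elements of \<open>N\<close> is cut into pieces of length \<open>q + 1\<close>. The first factor of each piece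
  is a sum of elements that generate square-zero ideals, so that by additivity the pieces may be taken
  to be blocks.
\<close>

theorem additive_span_square_zero_nilpotent:
  assumes arr: "\<forall>u v x. \<not> separating_array R {\<zero>} n u v x"
  shows "nilpotent_subset R (additive_span R (square_zero R {\<zero>}))"
proof -
  define N where "N = additive_span R (square_zero R {\<zero>})"
  have NI: "two_sided_ideal R N" unfolding N_def by (rule additive_span_square_zero_ideal[OF zero_ideal])
  note I = ideal_facts[OF NI]
  have N: "N \<subseteq> carrier R" "\<And>z w. z \<in> N \<Longrightarrow> w \<in> N \<Longrightarrow> z \<otimes> w \<in> N" "\<And>z. z \<in> N \<Longrightarrow> \<exists>k. pw z k = \<zero>"
    using I additive_span_nil by (auto simp: N_def)
  define q :: nat where "q = fact n"
  define P where "P = blocks N q"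
  have PR: "P \<subseteq> carrier R"
    using N(1) square_zero_closed[of "{\<zero>}"] by (auto simp: P_def blocks_def subset_iff intro!: mprod_closed)
  \<comment> \<open>The elements that are killed by any \<open>k\<close> blocks.\<close>
  define K where "K k = {c \<in> carrier R. \<forall>ps. length ps = k \<and> set ps \<subseteq> P \<longrightarrow> foldl (\<otimes>) c ps = \<zero>}" for k
  have fold_closed: "foldl (\<otimes>) c ps \<in> carrier R" if "c \<in> carrier R" "set ps \<subseteq> carrier R" for c ps
    using that by (induction ps arbitrary: c) (auto simp: m_closed)
  have fold_add: "foldl (\<otimes>) (c \<oplus> d) ps = foldl (\<otimes>) c ps \<oplus> foldl (\<otimes>) d ps"
    if "c \<in> carrier R" "d \<in> carrier R" "set ps \<subseteq> carrier R" for c d ps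
    using that by (induction ps arbitrary: c d) (auto simp: m_closed l_distr)
  have fold_zero: "foldl (\<otimes>) \<zero> ps = \<zero>" if "set ps \<subseteq> carrier R" for ps
    using that by (induction ps) auto
  have K_zero: "\<zero> \<in> K k" for k using fold_zero PR by (auto simp: K_def)
  have K_add: "c \<oplus> d \<in> K k" if "c \<in> K k" "d \<in> K k" for c d k
    using that fold_add PR by (auto simp: K_def)
  have first: "p \<in> K (n + 2)" if p: "p \<in> P" for p
  proof -
    have "foldl (\<otimes>) p ps = \<zero>" if ps: "length ps = n + 2" "set ps \<subseteq> P" for ps
    proof -
      have "mprod R (p # ps) = \<zero>"
        by (rule blocks_product_zero[OF arr N]) (use p ps in \<open>auto simp: P_def q_def\<close>)
      then show ?thesis by (simp add: mprod_def)
    qed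
    then show ?thesis using p PR by (auto simp: K_def)
  qed
  have step: "c \<otimes> p \<in> K k" if c: "c \<in> K (Suc k)" and p: "p \<in> P" for c p k
  proof -
    have "foldl (\<otimes>) (c \<otimes> p) ps = \<zero>" if "length ps = k" "set ps \<subseteq> P" for ps
      using c p that by (auto simp: K_def dest!: spec[of _ "p # ps"])
    then show ?thesis using c p PR by (auto simp: K_def m_closed)
  qed
  \<comment> \<open>Additivity is used for the two functions \<open>p \<mapsto> p\<close> and \<open>p \<mapsto> c p\<close> of a block \<open>p\<close>.\<close>
  have span: "f (mprod R (z # zs)) \<in> K k"
    if f: "\<And>p. p \<in> P \<Longrightarrow> f p \<in> K k" "f \<zero> = \<zero>" "\<And>a b. a \<in> carrier R \<Longrightarrow> b \<in> carrier R \<Longrightarrow> f (a \<oplus> b) = f a \<oplus> f b"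
      and z: "z \<in> N" and zs: "length zs = q" "set zs \<subseteq> N" for f z zs k
    using z unfolding N_def
  proof (induction rule: additive_span_induct)
    case zero
    have "mprod R (\<zero> # zs) = \<zero>" using fold_zero zs N(1) by (auto simp: mprod_def)
    then show ?case using f(2) K_zero by simp
  next
    case (add d e)
    have R: "d \<in> carrier R" "e \<in> carrier R" "set zs \<subseteq> carrier R"
      using add N(1) zs square_zero_closed by (auto simp: N_def)
    have "mprod R ((d \<oplus> e) # zs) = mprod R (d # zs) \<oplus> mprod R (e # zs)"
      using fold_add[OF R] by (simp add: mprod_def)
    moreover have "mprod R (e # zs) \<in> P" using add.hyps(2) zs by (auto simp: P_def blocks_def)
    moreover have "mprod R (d # zs) \<in> carrier R" "mprod R (e # zs) \<in> carrier R"
      using R by (auto intro!: mprod_closed)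
    ultimately show ?case using add.IH f K_add by simp
  qed
  have chain: "foldl (\<otimes>) c zs = \<zero>" if "c \<in> K k" "length zs = k * Suc q" "set zs \<subseteq> N" for c zs k
    using that
  proof (induction k arbitrary: c zs)
    case 0
    then show ?case by (auto simp: K_def)
  next
    case (Suc k)
    define as where "as = take (Suc q) zs"
    have zs: "zs = as @ drop (Suc q) zs" by (simp add: as_def)
    have las: "length as = Suc q" using Suc.prems(2) by (simp add: as_def)
    have sas: "set as \<subseteq> N" "set (drop (Suc q) zs) \<subseteq> N"
      using Suc.prems(3) by (auto simp: as_def dest: in_set_takeD in_set_dropD)
    obtain z ws where as': "as = z # ws" using las by (cases as) auto
    have cR: "c \<in> carrier R" using Suc.prems(1) by (simp add: K_def)
    have "c \<otimes> mprod R (z # ws) \<in> K k"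
      by (rule span[where f = "\<lambda>p. c \<otimes> p"]) (use step[OF Suc.prems(1)] cR r_distr las sas as' in auto)
    moreover have "foldl (\<otimes>) c as = c \<otimes> mprod R as"
      using foldl_mult[OF cR, of as] sas(1) N(1) as' by auto
    ultimately have "foldl (\<otimes>) c as \<in> K k" by (simp add: as')
    then have "foldl (\<otimes>) (foldl (\<otimes>) c as) (drop (Suc q) zs) = \<zero>"
      using Suc.prems(2) sas(2) by (intro Suc.IH) auto
    then show ?case by (subst zs) simp
  qed
  have "mprod R xs = \<zero>" if xs: "length xs = Suc q + (n + 2) * Suc q" "set xs \<subseteq> N" for xs
  proof -
    define as where "as = take (Suc q) xs"
    have split: "xs = as @ drop (Suc q) xs" by (simp add: as_def)
    have las: "length as = Suc q" using xs(1) by (simp add: as_def)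
    have sas: "set as \<subseteq> N" "set (drop (Suc q) xs) \<subseteq> N"
      using xs(2) by (auto simp: as_def dest: in_set_takeD in_set_dropD)
    obtain z ws where as': "as = z # ws" using las by (cases as) auto
    have "mprod R (z # ws) \<in> K (n + 2)"
      by (rule span[where f = "\<lambda>p. p"]) (use first las sas as' in auto)
    then have "foldl (\<otimes>) (mprod R as) (drop (Suc q) xs) = \<zero>"
      using sas xs(1) by (intro chain[of _ "n + 2"]) (auto simp: as')
    then show ?thesis by (subst split) (simp add: mprod_def as')
  qed
  then show ?thesis unfolding nilpotent_subset_def N_def[symmetric]
    by (intro exI[of _ "Suc q + (n + 2) * Suc q"]) (auto simp: mprod_def)
qed

end

section \<open>Semiprime rings\<close>

locale semiprime_rng = rng +
  assumes semiprime: "c \<in> carrier R \<Longrightarrow> (\<And>x. x \<in> carrier R \<Longrightarrow> c \<otimes> x \<otimes> c = \<zero>) \<Longrightarrow> c = \<zero>"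
begin

text \<open>
  This is \<open>(u x)\<close> to the power \<open>k\<close>, times \<open>u\<close>.
\<close>

primrec alt :: "'a \<Rightarrow> 'a \<Rightarrow> nat \<Rightarrow> 'a" where
  "alt u x 0 = u"
| "alt u x (Suc k) = u \<otimes> x \<otimes> alt u x k"

lemma alt_closed [simp]: "u \<in> carrier R \<Longrightarrow> x \<in> carrier R \<Longrightarrow> alt u x k \<in> carrier R"
  by (induction k) (auto simp: m_closed)

lemma alt_zero_mono:
  assumes "u \<in> carrier R" "x \<in> carrier R" "alt u x j = \<zero>" "j \<le> k"
  shows "alt u x k = \<zero>"
proof -
  have "alt u x (j + i) = \<zero>" for i by (induction i) (use assms in \<open>auto simp: m_closed\<close>)
  then show ?thesis using assms(4) le_Suc_ex by blast
qed

text \<open>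
  Induction on \<open>k\<close>. If \<open>u \<noteq> 0\<close>, there are \<open>x\<close> with \<open>u x u \<noteq> 0\<close> and a last nonzero element \<open>v\<close> of the
  sequence \<open>alt u x\<close>. It has the form \<open>u z u\<close>, with \<open>u z v = 0\<close>. Therefore, in the expansion of the
  hypothesis for \<open>a + z\<close>, where \<open>a = z u y\<close>, only two terms remain; one of them vanishes by the
  hypothesis for \<open>a\<close>, and the other one is the \<open>(k-1)\<close>-st case of the hypothesis for \<open>v\<close> and \<open>y\<close>.
\<close>

lemma levitzki:
  assumes "u \<in> carrier R" "\<And>x. x \<in> carrier R \<Longrightarrow> alt u x k = \<zero>"
  shows "u = \<zero>"
  using assms
proof (induction k arbitrary: u)
  case 0
  then show ?case using zero_closed by force
next
  case (Suc k)
  note uR = Suc.prems(1)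
  show ?case
  proof (rule ccontr)
    assume "u \<noteq> \<zero>"
    then obtain x where xR: "x \<in> carrier R" and x: "u \<otimes> x \<otimes> u \<noteq> \<zero>" using semiprime[OF uR] by blast
    define i where "i = (LEAST i. alt u x i = \<zero>)"
    have i: "alt u x i = \<zero>" unfolding i_def using Suc.prems(2)[OF xR] by (rule LeastI)
    have i_least: "alt u x j \<noteq> \<zero>" if "j < i" for j using not_less_Least that unfolding i_def by blast
    have "i \<noteq> 0"
    proof
      assume "i = 0"
      then show False using i \<open>u \<noteq> \<zero>\<close> by simp
    qed
    moreover have "i \<noteq> 1"
    proof
      assume "i = 1"
      then show False using i x by simp
    qed
    ultimately obtain j where j: "i = Suc (Suc j)" by (metis One_nat_def not0_implies_Suc)
    \<comment> \<open>The elements \<open>w l = x (u x) ^ l\<close> factor out the outer \<open>u\<close> on both sides of \<open>alt u x (l + 1)\<close>.\<close>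
    define w where "w = rec_nat x (\<lambda>_ y. x \<otimes> u \<otimes> y)"
    have w_simps: "w 0 = x" "w (Suc l) = x \<otimes> u \<otimes> w l" for l by (simp_all add: w_def)
    have wR: "w l \<in> carrier R" for l by (induction l) (use xR uR in \<open>auto simp: w_simps m_closed\<close>)
    have uw: "u \<otimes> w l \<otimes> alt u x b = alt u x (Suc (l + b))" for l b
    proof (induction l)
      case (Suc l)
      have "u \<otimes> w (Suc l) \<otimes> alt u x b = u \<otimes> x \<otimes> (u \<otimes> w l \<otimes> alt u x b)"
        using xR uR wR by (simp add: w_simps m_assoc m_closed)
      then show ?case using Suc by simp
    qed (simp add: w_simps)
    define z where "z = w j"
    define v where "v = u \<otimes> z \<otimes> u"
    have zR: "z \<in> carrier R" using wR by (simp add: z_def)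
    have vR: "v \<in> carrier R" using zR uR by (simp add: v_def m_closed)
    have v_alt: "v = alt u x (Suc j)" using uw[of j 0] by (simp add: v_def z_def)
    have v0: "v \<noteq> \<zero>" using i_least[of "Suc j"] j v_alt by simp
    have uzv: "u \<otimes> z \<otimes> v = \<zero>"
      unfolding v_alt z_def uw by (rule alt_zero_mono[OF uR xR i]) (use j in simp)
    have "alt v y k = \<zero>" if y: "y \<in> carrier R" for y
    proof -
      define a where "a = z \<otimes> u \<otimes> y"
      have aR: "a \<in> carrier R" using zR uR y by (simp add: a_def m_closed)
      have ua: "u \<otimes> a = v \<otimes> y" using zR uR y by (simp add: a_def v_def m_assoc m_closed)
      have kill: "u \<otimes> z \<otimes> (v \<otimes> y \<otimes> t) = \<zero>" if "t \<in> carrier R" for t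
      proof -
        have "u \<otimes> z \<otimes> (v \<otimes> y \<otimes> t) = u \<otimes> z \<otimes> v \<otimes> (y \<otimes> t)"
          using uR zR vR y that by (simp add: m_assoc m_closed)
        then show ?thesis using uzv y that by (simp add: m_closed)
      qed
      have killb: "u \<otimes> z \<otimes> alt v y l = \<zero>" for l
        by (cases l) (use uzv kill vR y in auto)
      \<comment> \<open>Expanding \<open>(u (a + z)) ^ l u\<close>, all mixed terms except one vanish because of \<open>u z v = 0\<close>.\<close>
      have "alt u (a \<oplus> z) (Suc l) = alt u a (Suc l) \<oplus> alt v y l" for l
      proof (induction l)
        case 0
        then show ?case using uR aR zR by (simp add: v_def r_distr l_distr m_closed)
      next
        case (Suc l)
        let ?p = "alt u a (Suc l)" and ?q = "alt v y l"
        have R: "?p \<in> carrier R" "?q \<in> carrier R" using uR aR vR y by (auto simp del: alt.simps)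
        have p0: "u \<otimes> z \<otimes> ?p = \<zero>" using kill[of "alt u a l"] uR aR ua by simp
        have "alt u (a \<oplus> z) (Suc (Suc l)) = u \<otimes> (a \<oplus> z) \<otimes> (?p \<oplus> ?q)"
          unfolding alt.simps(2)[of u "a \<oplus> z" "Suc l"] Suc by (rule refl)
        also have "\<dots> = (u \<otimes> a \<otimes> ?p \<oplus> u \<otimes> a \<otimes> ?q) \<oplus> (u \<otimes> z \<otimes> ?p \<oplus> u \<otimes> z \<otimes> ?q)"
          using R uR aR zR by (simp add: r_distr l_distr m_closed a_ac del: alt.simps)
        also have "\<dots> = u \<otimes> a \<otimes> ?p \<oplus> v \<otimes> y \<otimes> ?q"
          unfolding p0 killb ua using R vR y by (simp add: m_closed del: alt.simps)
        finally show ?case by simp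
      qed
      from this[of k] show ?thesis
        using Suc.prems(2)[of "a \<oplus> z"] Suc.prems(2)[OF aR] aR zR vR y by (simp del: alt.simps)
    qed
    then have "v = \<zero>" by (rule Suc.IH[OF vR])
    then show False using v0 by simp
  qed
qed

lemma alt_pw: "u \<in> carrier R \<Longrightarrow> x \<in> carrier R \<Longrightarrow> alt u x (Suc k) = pw (u \<otimes> x) k \<otimes> u"
proof (induction k)
  case (Suc k)
  have c: "pw (u \<otimes> x) j \<otimes> (u \<otimes> x) = (u \<otimes> x) \<otimes> pw (u \<otimes> x) j" for j
    using pw_mult[of "u \<otimes> x" j 0] pw_mult[of "u \<otimes> x" 0 j] Suc.prems by (simp add: m_closed)
  have "alt u x (Suc (Suc k)) = u \<otimes> x \<otimes> (pw (u \<otimes> x) k \<otimes> u)" using Suc by simp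
  also have "\<dots> = (u \<otimes> x) \<otimes> pw (u \<otimes> x) k \<otimes> u" using Suc.prems by (simp add: m_assoc m_closed)
  finally show ?case by (simp only: c[symmetric] pw.simps)
qed simp

end

definition (in rng) orthogonal :: "'a set \<Rightarrow> bool" where
  "orthogonal F \<longleftrightarrow> finite F \<and> F \<subseteq> carrier R - {\<zero>} \<and> (\<forall>e\<in>F. e \<otimes> e = e) \<and>
     (\<forall>e\<in>F. \<forall>f\<in>F. e \<noteq> f \<longrightarrow> e \<otimes> f = \<zero>)"

context rng begin

text \<open>The sum of an orthogonal family, characterized by what it does.\<close>

lemma orthogonal_sum:
  assumes "orthogonal F"
  obtains E where "E \<in> carrier R" "\<And>f. f \<in> F \<Longrightarrow> E \<otimes> f = f" "\<And>f. f \<in> F \<Longrightarrow> f \<otimes> E = f"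
    "\<And>z. z \<in> carrier R \<Longrightarrow> (\<And>f. f \<in> F \<Longrightarrow> f \<otimes> z = \<zero>) \<Longrightarrow> E \<otimes> z = \<zero>"
    "\<And>z. z \<in> carrier R \<Longrightarrow> (\<And>f. f \<in> F \<Longrightarrow> z \<otimes> f = \<zero>) \<Longrightarrow> z \<otimes> E = \<zero>"
proof -
  have "finite F" using assms by (simp add: orthogonal_def)
  then have "orthogonal F \<Longrightarrow> \<exists>E\<in>carrier R. (\<forall>f\<in>F. E \<otimes> f = f \<and> f \<otimes> E = f) \<and>
      (\<forall>z\<in>carrier R. (\<forall>f\<in>F. f \<otimes> z = \<zero>) \<longrightarrow> E \<otimes> z = \<zero>) \<and>
      (\<forall>z\<in>carrier R. (\<forall>f\<in>F. z \<otimes> f = \<zero>) \<longrightarrow> z \<otimes> E = \<zero>)"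
  proof (induction F)
    case empty
    then show ?case by (intro bexI[of _ \<zero>]) auto
  next
    case (insert g F)
    have "orthogonal F" using insert.prems by (auto simp: orthogonal_def)
    then obtain E where E: "E \<in> carrier R" "\<forall>f\<in>F. E \<otimes> f = f \<and> f \<otimes> E = f"
      "\<forall>z\<in>carrier R. (\<forall>f\<in>F. f \<otimes> z = \<zero>) \<longrightarrow> E \<otimes> z = \<zero>"
      "\<forall>z\<in>carrier R. (\<forall>f\<in>F. z \<otimes> f = \<zero>) \<longrightarrow> z \<otimes> E = \<zero>"
      using insert.IH by blast
    have g: "g \<in> carrier R" "g \<otimes> g = g" "\<And>f. f \<in> F \<Longrightarrow> f \<in> carrier R \<and> g \<otimes> f = \<zero> \<and> f \<otimes> g = \<zero>"
      using insert.prems insert.hyps(2) by (auto simp: orthogonal_def)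
    have Eg: "E \<otimes> g = \<zero>" "g \<otimes> E = \<zero>" using E(3,4) g by auto
    have "(E \<oplus> g) \<otimes> f = f \<and> f \<otimes> (E \<oplus> g) = f" if "f \<in> insert g F" for f
    proof (cases "f = g")
      case True
      then show ?thesis using E(1) g Eg by (simp add: l_distr r_distr)
    next
      case False
      then have "f \<in> F" using that by simp
      then show ?thesis using E g by (simp add: l_distr r_distr)
    qed
    moreover have "(E \<oplus> g) \<otimes> z = \<zero>" if "z \<in> carrier R" "\<forall>f\<in>insert g F. f \<otimes> z = \<zero>" for z
      using that E g by (simp add: l_distr)
    moreover have "z \<otimes> (E \<oplus> g) = \<zero>" if "z \<in> carrier R" "\<forall>f\<in>insert g F. z \<otimes> f = \<zero>" for z
      using that E g by (simp add: r_distr)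
    moreover have "E \<oplus> g \<in> carrier R" using E g by simp
    ultimately show ?case by blast
  qed
  then show thesis using that assms by blast
qed

text \<open>
  Arrange the family in \<open>n\<close> blocks of length \<open>n\<close>. If \<open>E i\<close> is the sum of the \<open>i\<close>-th block, then
  \<open>z \<mapsto> E i z E i\<close> fixes the members of this block and kills those of the others.
\<close>

lemma orthogonal_bound:
  assumes arr: "\<forall>u v x. \<not> separating_array R {\<zero>} n u v x" and F: "orthogonal F"
  shows "card F < n * n"
proof (rule ccontr)
  assume "\<not> card F < n * n"
  then have "card ({..<n} \<times> {..<n}) \<le> card F" by simp
  then obtain e where e: "inj_on e ({..<n} \<times> {..<n})" "e ` ({..<n} \<times> {..<n}) \<subseteq> F"
    using card_le_inj[of "{..<n} \<times> {..<n}" F] F by (auto simp: orthogonal_def)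
  define B where "B i = (\<lambda>j. e (i, j)) ` {..<n}" for i
  have eF: "e (i, j) \<in> F" if "i < n" "j < n" for i j using e(2) that by auto
  have eR: "e (i, j) \<in> carrier R" "e (i, j) \<noteq> \<zero>" "e (i, j) \<otimes> e (i, j) = e (i, j)" if "i < n" "j < n" for i j
    using F eF[OF that] by (auto simp: orthogonal_def)
  have ne: "e (i, j) \<noteq> e (l, k)" if "i < n" "j < n" "l < n" "k < n" "(i, j) \<noteq> (l, k)" for i j l k
    using inj_onD[OF e(1), of "(i, j)" "(l, k)"] that by auto
  have ee: "e (i, j) \<otimes> e (l, k) = \<zero>" if "i < n" "j < n" "l < n" "k < n" "(i, j) \<noteq> (l, k)" for i j l k
    using F eF that ne[OF that] by (auto simp: orthogonal_def)
  have "\<exists>E. E \<in> carrier R \<and> (\<forall>j<n. E \<otimes> e (i, j) = e (i, j) \<and> e (i, j) \<otimes> E = e (i, j)) \<and>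
      (\<forall>l<n. \<forall>j<n. l \<noteq> i \<longrightarrow> E \<otimes> e (l, j) = \<zero>)" if i: "i < n" for i
  proof -
    have "orthogonal (B i)"
      using F eF i unfolding orthogonal_def by (auto simp: B_def)
    then obtain E where E: "E \<in> carrier R" "\<And>f. f \<in> B i \<Longrightarrow> E \<otimes> f = f" "\<And>f. f \<in> B i \<Longrightarrow> f \<otimes> E = f"
      "\<And>z. z \<in> carrier R \<Longrightarrow> (\<And>f. f \<in> B i \<Longrightarrow> f \<otimes> z = \<zero>) \<Longrightarrow> E \<otimes> z = \<zero>"
      using orthogonal_sum[of "B i"] by metis
    have "E \<otimes> e (l, j) = \<zero>" if "l < n" "j < n" "l \<noteq> i" for l j
      by (rule E(4)) (use eR ee i that in \<open>auto simp: B_def\<close>)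
    then show ?thesis using E by (auto simp: B_def)
  qed
  then have "\<forall>i. \<exists>E. i < n \<longrightarrow> (E \<in> carrier R \<and> (\<forall>j<n. E \<otimes> e (i, j) = e (i, j) \<and> e (i, j) \<otimes> E = e (i, j)) \<and>
      (\<forall>l<n. \<forall>j<n. l \<noteq> i \<longrightarrow> E \<otimes> e (l, j) = \<zero>))" by blast
  then obtain E where E: "\<forall>i. i < n \<longrightarrow> (E i \<in> carrier R \<and> (\<forall>j<n. E i \<otimes> e (i, j) = e (i, j) \<and> e (i, j) \<otimes> E i = e (i, j)) \<and>
      (\<forall>l<n. \<forall>j<n. l \<noteq> i \<longrightarrow> E i \<otimes> e (l, j) = \<zero>))" unfolding choice_iff by blast
  have "e (i, j) \<ominus> e (i, j') \<noteq> \<zero>" if "i < n" "j < n" "j' < n" "j \<noteq> j'" for i j j'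
    using ne[of i j i j'] eR that by (simp add: minus_eq_zero_iff)
  then have "separating_array R {\<zero>} n E E (\<lambda>i j. e (i, j))"
    unfolding separating_array_def using E eR by auto
  then show False using arr by blast
qed

end

text \<open>
  In terms of ordinary powers, it is the power with exponent \<open>N + 1\<close> that is idempotent.
\<close>

locale semiprime_bounded = semiprime_rng +
  fixes N n :: nat
  assumes idem_pw: "x \<in> carrier R \<Longrightarrow> pw x N \<otimes> pw x N = pw x N"
    and arr: "\<forall>u v x. \<not> separating_array R {\<zero>} n u v x"
begin

text \<open>
  By \<open>levitzki\<close>, some \<open>u x\<close> is not nilpotent, so that its idempotent power is not zero.
\<close>

lemma idempotent_in_right_ideal:
  assumes u: "u \<in> carrier R" "u \<noteq> \<zero>"
  obtains z where "z \<in> carrier R" "u \<otimes> z \<noteq> \<zero>" "(u \<otimes> z) \<otimes> (u \<otimes> z) = u \<otimes> z"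
proof -
  have "\<exists>x\<in>carrier R. pw (u \<otimes> x) N \<noteq> \<zero>"
  proof (rule ccontr)
    assume "\<not> ?thesis"
    then have "alt u x (Suc N) = \<zero>" if "x \<in> carrier R" for x using alt_pw[OF u(1) that] that u by auto
    then show False using levitzki[OF u(1)] u(2) by blast
  qed
  then obtain x where x: "x \<in> carrier R" "pw (u \<otimes> x) N \<noteq> \<zero>" by blast
  have "\<exists>z\<in>carrier R. pw (u \<otimes> x) k = u \<otimes> z" for k
  proof (induction k)
    case (Suc k)
    then obtain z where "z \<in> carrier R" "pw (u \<otimes> x) k = u \<otimes> z" by blast
    then show ?case using u x by (intro bexI[of _ "z \<otimes> (u \<otimes> x)"]) (auto simp: m_assoc m_closed)
  qed (use x in auto)
  then obtain z where "z \<in> carrier R" "pw (u \<otimes> x) N = u \<otimes> z" by blast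
  then show thesis using that x idem_pw[of "u \<otimes> x"] u by (metis m_closed)
qed

lemma maximal_orthogonal:
  obtains F where "orthogonal F" "\<And>G. orthogonal G \<Longrightarrow> card G \<le> card F"
proof -
  have "orthogonal {}" by (simp add: orthogonal_def)
  then have "\<exists>F. orthogonal F \<and> (\<forall>G. orthogonal G \<longrightarrow> card G \<le> card F)"
    by (rule ex_has_greatest_nat) (use orthogonal_bound[OF arr] in blast)
  then show thesis using that by blast
qed

context
  fixes F
  assumes F: "orthogonal F" and max: "\<And>G. orthogonal G \<Longrightarrow> card G \<le> card F"
begin

lemma F_facts:
  "finite F" "\<And>f. f \<in> F \<Longrightarrow> f \<in> carrier R" "\<And>f. f \<in> F \<Longrightarrow> f \<noteq> \<zero>" "\<And>f. f \<in> F \<Longrightarrow> f \<otimes> f = f"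
  "\<And>f g. f \<in> F \<Longrightarrow> g \<in> F \<Longrightarrow> f \<noteq> g \<Longrightarrow> f \<otimes> g = \<zero>"
  using F by (auto simp: orthogonal_def)

text \<open>
  A nonzero right ideal \<open>d R\<close> annihilated by \<open>F\<close> on the left would contain an idempotent by which \<open>F\<close>
  could be enlarged.
\<close>

lemma left_faithful:
  assumes d: "d \<in> carrier R" "\<And>f. f \<in> F \<Longrightarrow> f \<otimes> d = \<zero>"
  shows "d = \<zero>"
proof (rule ccontr)
  assume "d \<noteq> \<zero>"
  then obtain z where z: "z \<in> carrier R" "d \<otimes> z \<noteq> \<zero>" "(d \<otimes> z) \<otimes> (d \<otimes> z) = d \<otimes> z"
    using idempotent_in_right_ideal d(1) by blast
  define p where "p = d \<otimes> z"
  have p: "p \<in> carrier R" "p \<noteq> \<zero>" "p \<otimes> p = p" using z d by (auto simp: p_def m_closed)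
  have fp: "f \<otimes> p = \<zero>" if "f \<in> F" for f
    using d z that F_facts by (simp add: p_def m_assoc[symmetric])
  obtain E where E: "E \<in> carrier R" "\<And>f. f \<in> F \<Longrightarrow> E \<otimes> f = f"
    "\<And>z. z \<in> carrier R \<Longrightarrow> (\<And>f. f \<in> F \<Longrightarrow> f \<otimes> z = \<zero>) \<Longrightarrow> E \<otimes> z = \<zero>"
    using orthogonal_sum[OF F] by metis
  have Ep: "E \<otimes> p = \<zero>" using E(3)[OF p(1)] fp by blast
  \<comment> \<open>The idempotent \<open>p\<close> is only orthogonal to \<open>F\<close> on one side; this is corrected.\<close>
  define q where "q = p \<ominus> p \<otimes> E"
  have qR: "q \<in> carrier R" using p E by (simp add: q_def m_closed)
  have qp: "q \<otimes> p = p"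
  proof -
    have "q \<otimes> p = p \<otimes> p \<ominus> p \<otimes> (E \<otimes> p)" unfolding q_def using p(1) E(1) by algebra
    then show ?thesis using Ep p by (simp add: a_minus_def)
  qed
  have qq: "q \<otimes> q = q"
  proof -
    have "q \<otimes> q = q \<otimes> p \<ominus> (q \<otimes> p) \<otimes> E" using qR p(1) E(1) unfolding q_def[of] by algebra
    then show ?thesis unfolding qp by (simp add: q_def)
  qed
  have fq: "f \<otimes> q = \<zero>" if f: "f \<in> F" for f
  proof -
    have "f \<otimes> q = f \<otimes> p \<ominus> (f \<otimes> p) \<otimes> E" unfolding q_def using F_facts(2)[OF f] p(1) E(1) by algebra
    then show ?thesis using fp[OF f] E(1) by (simp add: a_minus_def)
  qed
  have qf: "q \<otimes> f = \<zero>" if f: "f \<in> F" for f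
  proof -
    have "q \<otimes> f = p \<otimes> f \<ominus> p \<otimes> (E \<otimes> f)" unfolding q_def using F_facts(2)[OF f] p(1) E(1) by algebra
    then show ?thesis using E(2)[OF f] p(1) F_facts(2)[OF f] by (simp add: m_closed a_minus_def r_neg)
  qed
  have q0: "q \<noteq> \<zero>" using qp p by auto
  have "q \<notin> F" using fq qq q0 by auto
  moreover have "orthogonal (insert q F)"
    using F qR qq q0 fq qf by (auto simp: orthogonal_def)
  ultimately show False using max[of "insert q F"] F_facts(1) by simp
qed

text \<open>
  The sum \<open>E\<close> of the family is a left unit because \<open>x - E x\<close> is annihilated by \<open>F\<close>. It is a right unit
  because then \<open>x - x E\<close> annihilates the whole ring, which is semiprime.
\<close>

lemma unit:
  obtains E where "E \<in> carrier R" "\<And>f. f \<in> F \<Longrightarrow> E \<otimes> f = f" "\<And>x. x \<in> carrier R \<Longrightarrow> E \<otimes> x = x"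
    "\<And>x. x \<in> carrier R \<Longrightarrow> x \<otimes> E = x"
    "\<And>z. z \<in> carrier R \<Longrightarrow> (\<And>f. f \<in> F \<Longrightarrow> f \<otimes> z = \<zero>) \<Longrightarrow> E \<otimes> z = \<zero>"
    "\<And>z. z \<in> carrier R \<Longrightarrow> (\<And>f. f \<in> F \<Longrightarrow> z \<otimes> f = \<zero>) \<Longrightarrow> z \<otimes> E = \<zero>"
proof -
  obtain E where E: "E \<in> carrier R" "\<And>f. f \<in> F \<Longrightarrow> E \<otimes> f = f" "\<And>f. f \<in> F \<Longrightarrow> f \<otimes> E = f"
    "\<And>z. z \<in> carrier R \<Longrightarrow> (\<And>f. f \<in> F \<Longrightarrow> f \<otimes> z = \<zero>) \<Longrightarrow> E \<otimes> z = \<zero>"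
    "\<And>z. z \<in> carrier R \<Longrightarrow> (\<And>f. f \<in> F \<Longrightarrow> z \<otimes> f = \<zero>) \<Longrightarrow> z \<otimes> E = \<zero>"
    by (rule orthogonal_sum[OF F]) (rule that; blast)
  have left: "E \<otimes> x = x" if x: "x \<in> carrier R" for x
  proof -
    have "x \<ominus> E \<otimes> x = \<zero>"
    proof (rule left_faithful)
      fix f assume f: "f \<in> F"
      have "f \<otimes> (x \<ominus> E \<otimes> x) = f \<otimes> x \<ominus> (f \<otimes> E) \<otimes> x" using F_facts(2)[OF f] x E(1) by algebra
      then show "f \<otimes> (x \<ominus> E \<otimes> x) = \<zero>" using E(3)[OF f] x F_facts(2)[OF f] by (simp add: m_closed a_minus_def r_neg)
    qed (use x E in \<open>simp add: m_closed\<close>)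
    then show ?thesis using x E(1) by (simp add: minus_eq_zero_iff m_closed)
  qed
  have right: "x \<otimes> E = x" if x: "x \<in> carrier R" for x
  proof -
    define d where "d = x \<ominus> x \<otimes> E"
    have dR: "d \<in> carrier R" using x E by (simp add: d_def m_closed)
    have "d \<otimes> y = \<zero>" if y: "y \<in> carrier R" for y
    proof -
      have "d \<otimes> y = x \<otimes> y \<ominus> x \<otimes> (E \<otimes> y)" unfolding d_def using x y E(1) by algebra
      then show ?thesis using left[OF y] x y by (simp add: m_closed a_minus_def r_neg)
    qed
    then have "d \<otimes> y \<otimes> d = \<zero>" if "y \<in> carrier R" for y using that dR by simp
    then have "d = \<zero>" by (rule semiprime[OF dR])
    then show ?thesis using x E(1) by (simp add: d_def minus_eq_zero_iff m_closed)
  qed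
  show thesis by (rule that[OF E(1,2) left right E(4,5)])
qed

text \<open>
  If \<open>g \<noteq> f\<close>, the family could be enlarged by splitting \<open>f\<close> into \<open>g\<close> and \<open>f - g\<close>.
\<close>

lemma primitive:
  assumes f: "f \<in> F" and g: "g \<in> carrier R" "g \<otimes> g = g" "f \<otimes> g = g" "g \<otimes> f = g" "g \<noteq> \<zero>"
  shows "g = f"
proof (rule ccontr)
  assume "g \<noteq> f"
  define h where "h = f \<ominus> g"
  have fR: "f \<in> carrier R" using F_facts f by auto
  have hR: "h \<in> carrier R" using fR g by (simp add: h_def)
  have h0: "h \<noteq> \<zero>" using \<open>g \<noteq> f\<close> fR g by (auto simp: h_def minus_eq_zero_iff)
  have gh: "g \<otimes> h = \<zero>" "h \<otimes> g = \<zero>"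
  proof -
    have "g \<otimes> h = g \<ominus> g" "h \<otimes> g = g \<ominus> g"
      using fR g by (simp_all add: h_def r_distr_minus l_distr_minus)
    then show "g \<otimes> h = \<zero>" "h \<otimes> g = \<zero>" using g(1) by (simp_all add: a_minus_def r_neg)
  qed
  have fh: "f \<otimes> h = h" "h \<otimes> f = h"
    using fR g F_facts(4)[OF f] by (simp_all add: h_def r_distr_minus l_distr_minus)
  have hh: "h \<otimes> h = h"
  proof -
    have "h \<otimes> h = f \<otimes> h \<ominus> g \<otimes> h" using fR g hR by (simp add: h_def l_distr_minus)
    then show ?thesis using fh gh hR by (simp add: a_minus_def)
  qed
  have other: "k \<otimes> y = \<zero>" "y \<otimes> k = \<zero>" if "k \<in> F" "k \<noteq> f" "y \<in> carrier R" "f \<otimes> y = y" "y \<otimes> f = y" for k y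
  proof -
    have kR: "k \<in> carrier R" and kf: "k \<otimes> f = \<zero>" "f \<otimes> k = \<zero>" using that F_facts f by auto
    have "k \<otimes> y = (k \<otimes> f) \<otimes> y" using kR fR that by (simp add: m_assoc)
    then show "k \<otimes> y = \<zero>" using kf that by simp
    have "y \<otimes> k = y \<otimes> (f \<otimes> k)" using kR fR that by (simp add: m_assoc[symmetric])
    then show "y \<otimes> k = \<zero>" using kf that by simp
  qed
  have gF: "g \<notin> F - {f}" using other[of g g] g by auto
  have hF: "h \<notin> F - {f}" using other[of h h] hR fh hh h0 by auto
  have "g \<noteq> h" using gh g by auto
  then have "card (insert g (insert h (F - {f}))) = Suc (card F)"
  proof -
    have "card F = Suc (card (F - {f}))" using card.remove[OF F_facts(1) f] by simp
    moreover have "card (insert h (F - {f})) = Suc (card (F - {f}))"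
      using hF F_facts(1) by (intro card_insert_disjoint) auto
    moreover have "card (insert g (insert h (F - {f}))) = Suc (card (insert h (F - {f})))"
      using gF \<open>g \<noteq> h\<close> F_facts(1) by (intro card_insert_disjoint) auto
    ultimately show ?thesis by simp
  qed
  moreover have "orthogonal (insert g (insert h (F - {f})))"
    unfolding orthogonal_def
    using F_facts g hR h0 hh gh other[OF _ _ g(1,3,4)] other[OF _ _ hR fh] by auto
  ultimately show False using max by fastforce
qed

text \<open>
  The right ideal \<open>a R\<close> contains a nonzero idempotent \<open>g\<close>, and \<open>g f\<close> is a nonzero idempotent of the
  corner of \<open>f\<close>, which is \<open>f\<close> itself.
\<close>

lemma right_inverse:
  assumes f: "f \<in> F" and a: "a \<in> carrier R" "a \<noteq> \<zero>" "f \<otimes> a = a"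
  obtains z where "z \<in> carrier R" "a \<otimes> z = f"
proof -
  have fR: "f \<in> carrier R" using F_facts f by auto
  obtain z where z: "z \<in> carrier R" "a \<otimes> z \<noteq> \<zero>" "(a \<otimes> z) \<otimes> (a \<otimes> z) = a \<otimes> z"
    using idempotent_in_right_ideal a by blast
  define g where "g = a \<otimes> z"
  have gR: "g \<in> carrier R" using a z by (simp add: g_def m_closed)
  have fg: "f \<otimes> g = g" using a z fR by (simp add: g_def m_assoc[symmetric])
  have gg: "g \<otimes> g = g" using z by (simp add: g_def)
  have "g \<otimes> f = f"
  proof (rule primitive[OF f])
    have "g \<otimes> f \<otimes> g = g" using gR fR fg gg by (simp add: m_assoc)
    then show "g \<otimes> f \<noteq> \<zero>" using z gR by (auto simp: g_def)
    show "g \<otimes> f \<otimes> (g \<otimes> f) = g \<otimes> f"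
      using \<open>g \<otimes> f \<otimes> g = g\<close> gR fR by (simp add: m_assoc[symmetric] m_closed)
    show "f \<otimes> (g \<otimes> f) = g \<otimes> f" using fg gR fR by (simp add: m_assoc[symmetric])
    show "g \<otimes> f \<otimes> f = g \<otimes> f" using F_facts(4)[OF f] gR fR by (simp add: m_assoc)
  qed (use gR fR in \<open>simp add: m_closed\<close>)
  then have "a \<otimes> (z \<otimes> f) = f" using a z fR by (simp add: g_def m_assoc)
  then show thesis using that z fR by (metis m_closed)
qed

definition corner :: "'a \<Rightarrow> 'a \<Rightarrow> 'a set" where
  "corner f g = {x \<in> carrier R. f \<otimes> x = x \<and> x \<otimes> g = x}"

text \<open>
  The corner of \<open>f\<close> is a division ring by \<open>right_inverse\<close>, so that powers of \<open>x\<close> are not zero, and \<open>f\<close> is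
  its only nonzero idempotent.
\<close>

lemma corner_power:
  assumes f: "f \<in> F" and x: "x \<in> corner f f" "x \<noteq> \<zero>"
  shows "pw x N = f"
proof (rule primitive[OF f])
  have fR: "f \<in> carrier R" using F_facts f by auto
  have xR: "x \<in> carrier R" and fx: "f \<otimes> x = x" and xf: "x \<otimes> f = x" using x by (auto simp: corner_def)
  obtain z where z: "z \<in> carrier R" "x \<otimes> z = f" using right_inverse[OF f xR x(2) fx] by blast
  show "f \<otimes> pw x N = pw x N" "pw x N \<otimes> f = pw x N"
  proof -
    show "f \<otimes> pw x N = pw x N"
      by (induction N) (use xR fR fx in \<open>auto simp: m_assoc[symmetric]\<close>)
    show "pw x N \<otimes> f = pw x N"
      by (induction N) (use xR fR xf in \<open>auto simp: m_assoc\<close>)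
  qed
  show "pw x N \<noteq> \<zero>"
  proof -
    have "pw x k \<noteq> \<zero>" for k
    proof (induction k)
      case (Suc k)
      have "pw x (Suc k) \<otimes> z = pw x k \<otimes> f" using xR z by (simp add: m_assoc)
      also have "\<dots> = pw x k"
        by (induction k) (use xR fR xf in \<open>auto simp: m_assoc\<close>)
      finally show ?case using Suc z by auto
    qed (use x in simp)
    then show ?thesis .
  qed
qed (use x idem_pw in \<open>auto simp: corner_def\<close>)

text \<open>
  A nonzero element \<open>y\<close> of \<open>f R g\<close> has a right inverse \<open>t\<close> in \<open>g R f\<close>, which in turn has a right
  inverse. So right multiplication by \<open>t\<close> embeds \<open>f R g\<close> into \<open>f R f\<close>.
\<close>

lemma finite_mixed_corner:
  assumes fg: "f \<in> F" "g \<in> F" and fin: "finite (corner f f)"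
  shows "finite (corner f g)"
proof (cases "corner f g \<subseteq> {\<zero>}")
  case False
  have R: "f \<in> carrier R" "g \<in> carrier R" using F_facts fg by auto
  obtain y where y: "y \<in> carrier R" "f \<otimes> y = y" "y \<otimes> g = y" "y \<noteq> \<zero>" using False by (auto simp: corner_def)
  obtain z where z: "z \<in> carrier R" "y \<otimes> z = f" using right_inverse[OF fg(1) y(1,4,2)] by blast
  define t where "t = g \<otimes> z \<otimes> f"
  have tR: "t \<in> carrier R" using z R by (simp add: t_def m_closed)
  have yt: "y \<otimes> t = f"
  proof -
    have "y \<otimes> t = ((y \<otimes> g) \<otimes> z) \<otimes> f" using y(1) z(1) R by (simp add: t_def m_assoc[symmetric] m_closed)
    then show ?thesis using y z F_facts(4)[OF fg(1)] by simp
  qed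
  have gt: "g \<otimes> t = t" using z R F_facts(4)[OF fg(2)] by (simp add: t_def m_assoc[symmetric] m_closed)
  have tf: "t \<otimes> f = t" using z R F_facts(4)[OF fg(1)] by (simp add: t_def m_assoc m_closed)
  have "t \<noteq> \<zero>" using yt y F_facts(3)[OF fg(1)] by auto
  then obtain w where w: "w \<in> carrier R" "t \<otimes> w = g" using right_inverse[OF fg(2) tR _ gt] by blast
  have "inj_on (\<lambda>x. x \<otimes> t) (corner f g)"
  proof (rule inj_on_inverseI[of _ "\<lambda>x. x \<otimes> w"])
    fix x assume "x \<in> corner f g"
    then show "x \<otimes> t \<otimes> w = x" using tR w by (simp add: corner_def m_assoc)
  qed
  moreover have "(\<lambda>x. x \<otimes> t) ` corner f g \<subseteq> corner f f"
  proof
    fix s assume "s \<in> (\<lambda>x. x \<otimes> t) ` corner f g"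
    then obtain x where x: "x \<in> carrier R" "f \<otimes> x = x" "s = x \<otimes> t" by (auto simp: corner_def)
    have "f \<otimes> (x \<otimes> t) = f \<otimes> x \<otimes> t" "x \<otimes> t \<otimes> f = x \<otimes> (t \<otimes> f)" using x(1) tR R by (simp_all add: m_assoc)
    then show "s \<in> corner f f" using x tR tf by (simp add: corner_def m_closed)
  qed
  ultimately show ?thesis using fin inj_on_finite by blast
qed (meson finite.emptyI finite.insertI finite_subset)

text \<open>
  The Peirce decomposition: as \<open>F\<close> sums up to a unit, an element \<open>x\<close> is determined by the finitely many
  components \<open>f x g\<close>.
\<close>

lemma finite_if_corners_finite:
  assumes "\<And>f. f \<in> F \<Longrightarrow> finite (corner f f)"
  shows "finite (carrier R)"
proof (rule unit)
  fix E assume E: "E \<in> carrier R" "\<And>f. f \<in> F \<Longrightarrow> E \<otimes> f = f" "\<And>x. x \<in> carrier R \<Longrightarrow> E \<otimes> x = x"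
    "\<And>x. x \<in> carrier R \<Longrightarrow> x \<otimes> E = x"
    "\<And>z. z \<in> carrier R \<Longrightarrow> (\<And>f. f \<in> F \<Longrightarrow> f \<otimes> z = \<zero>) \<Longrightarrow> E \<otimes> z = \<zero>"
    "\<And>z. z \<in> carrier R \<Longrightarrow> (\<And>f. f \<in> F \<Longrightarrow> z \<otimes> f = \<zero>) \<Longrightarrow> z \<otimes> E = \<zero>"
  define \<Phi> where "\<Phi> x = restrict (\<lambda>(f, g). f \<otimes> x \<otimes> g) (F \<times> F)" for x
  have "inj_on \<Phi> (carrier R)"
  proof (rule inj_onI)
    fix x y assume xy: "x \<in> carrier R" "y \<in> carrier R" "\<Phi> x = \<Phi> y"
    have eq: "f \<otimes> x \<otimes> g = f \<otimes> y \<otimes> g" if "f \<in> F" "g \<in> F" for f g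
      using fun_cong[OF xy(3), of "(f, g)"] that by (simp add: \<Phi>_def)
    define d where "d = x \<ominus> y"
    have dR: "d \<in> carrier R" using xy by (simp add: d_def)
    have "d \<otimes> g = \<zero>" if g: "g \<in> F" for g
    proof -
      have gR: "g \<in> carrier R" using g F_facts by auto
      have "f \<otimes> (d \<otimes> g) = \<zero>" if f: "f \<in> F" for f
      proof -
        have fR: "f \<in> carrier R" using f F_facts by auto
        have "f \<otimes> (d \<otimes> g) = f \<otimes> x \<otimes> g \<ominus> f \<otimes> y \<otimes> g" unfolding d_def using fR gR xy(1,2) by algebra
        then show ?thesis using eq[OF f g] fR gR xy by (simp add: m_closed a_minus_def r_neg)
      qed
      then have "E \<otimes> (d \<otimes> g) = \<zero>" using dR gR by (intro E(5)) (auto simp: m_closed)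
      then show ?thesis using E(3) dR gR by (simp add: m_closed)
    qed
    then have "d \<otimes> E = \<zero>" using dR by (intro E(6)) auto
    then have "d = \<zero>" using E(4)[OF dR] by simp
    then show "x = y" unfolding d_def using minus_eq_zero_iff[OF xy(1,2)] by blast
  qed
  moreover have "\<Phi> ` carrier R \<subseteq> PiE (F \<times> F) (\<lambda>(f, g). corner f g)"
  proof
    fix p assume "p \<in> \<Phi> ` carrier R"
    then obtain x where x: "x \<in> carrier R" "p = \<Phi> x" by auto
    have "f \<otimes> x \<otimes> g \<in> corner f g" if "f \<in> F" "g \<in> F" for f g
    proof -
      have R: "f \<in> carrier R" "g \<in> carrier R" using that F_facts by auto
      have "f \<otimes> (f \<otimes> x \<otimes> g) = f \<otimes> f \<otimes> x \<otimes> g" "f \<otimes> x \<otimes> g \<otimes> g = f \<otimes> x \<otimes> (g \<otimes> g)"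
        using R x by (simp_all add: m_assoc m_closed)
      then show ?thesis using R x F_facts(4) that by (simp add: corner_def m_closed)
    qed
    then show "p \<in> PiE (F \<times> F) (\<lambda>(f, g). corner f g)" using x by (auto simp: \<Phi>_def)
  qed
  moreover have "finite (PiE (F \<times> F) (\<lambda>(f, g). corner f g))"
    using F_facts(1) finite_mixed_corner assms by (intro finite_PiE) auto
  ultimately show ?thesis using inj_on_finite by blast
qed

end

end

section \<open>Division rings of bounded exponent\<close>

lemma (in field) finite_if_bounded_exponent:
  assumes "\<And>x. x \<in> carrier R - {\<zero>} \<Longrightarrow> x [^] Suc k = \<one>"
  shows "finite (carrier R)"
proof -
  define p where "p = \<one> # replicate k \<zero> @ [\<ominus> \<one>]"
  have "p \<in> carrier (poly_ring R)"
    unfolding univ_poly_carrier[symmetric] polynomial_def p_def by auto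
  then have "finite {x. is_root p x}" by (rule finite_number_of_roots)
  moreover have "is_root p x" if x: "x \<in> carrier R - {\<zero>}" for x
  proof -
    have "eval p x = \<one> \<otimes> x [^] Suc k \<oplus> eval (replicate k \<zero> @ [\<ominus> \<one>]) x" by (simp add: p_def)
    also have "eval (replicate k \<zero> @ [\<ominus> \<one>]) x = eval [\<ominus> \<one>] x" using x by (intro eval_replicate) auto
    also have "\<dots> = \<ominus> \<one>" using x by simp
    finally have "eval p x = \<zero>" using assms[OF x] by (simp add: r_neg)
    then show ?thesis using x by (simp add: is_root_def p_def)
  qed
  then have "carrier R - {\<zero>} \<subseteq> {x. is_root p x}" by blast
  ultimately have "finite (carrier R - {\<zero>})" by (rule finite_subset[rotated])
  then show ?thesis by simp
qed

context ring begin

primrec nsum :: "(nat \<Rightarrow> 'a) \<Rightarrow> nat \<Rightarrow> 'a" where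
  "nsum f 0 = \<zero>"
| "nsum f (Suc n) = nsum f n \<oplus> f n"

lemma nsum_closed [simp]: "(\<And>i. i < n \<Longrightarrow> f i \<in> carrier R) \<Longrightarrow> nsum f n \<in> carrier R"
  by (induction n) auto

lemma nsum_cong: "(\<And>i. i < n \<Longrightarrow> f i = g i) \<Longrightarrow> nsum f n = nsum g n"
  by (induction n) auto

lemma nsum_add:
  "(\<And>i. f i \<in> carrier R) \<Longrightarrow> (\<And>i. g i \<in> carrier R) \<Longrightarrow> nsum (\<lambda>i. f i \<oplus> g i) n = nsum f n \<oplus> nsum g n"
  by (induction n) (auto simp: a_ac)

lemma nsum_zero [simp]: "nsum (\<lambda>_. \<zero>) n = \<zero>"
  by (induction n) auto

lemma nsum_swap:
  "(\<And>i j. f i j \<in> carrier R) \<Longrightarrow> nsum (\<lambda>j. nsum (\<lambda>i. f i j) m) n = nsum (\<lambda>i. nsum (\<lambda>j. f i j) n) m"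
  by (induction n) (auto simp: nsum_add)

lemma nsum_ldistr:
  "(\<And>i. f i \<in> carrier R) \<Longrightarrow> x \<in> carrier R \<Longrightarrow> x \<otimes> nsum f n = nsum (\<lambda>i. x \<otimes> f i) n"
  by (induction n) (auto simp: r_distr)

lemma nsum_rdistr:
  "(\<And>i. f i \<in> carrier R) \<Longrightarrow> x \<in> carrier R \<Longrightarrow> nsum f n \<otimes> x = nsum (\<lambda>i. f i \<otimes> x) n"
  by (induction n) (auto simp: l_distr)

lemma nsum_rotate:
  assumes f: "\<And>i. f i \<in> carrier R" and "f n = f 0"
  shows "nsum (\<lambda>i. f (Suc i)) n = nsum f n"
proof -
  have "f 0 \<oplus> nsum (\<lambda>i. f (Suc i)) n = nsum f (Suc n)"
    by (induction n) (use f in \<open>auto simp: a_assoc[symmetric]\<close>)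
  also have "\<dots> = f 0 \<oplus> nsum f n" using f assms(2) by (simp add: a_comm)
  finally show ?thesis using f by simp
qed

definition commutant :: "'a set \<Rightarrow> 'a set" where
  "commutant S = {x \<in> carrier R. \<forall>s\<in>S. x \<otimes> s = s \<otimes> x}"

lemma commutant_subring:
  assumes S: "S \<subseteq> carrier R"
  shows "subring (commutant S) R"
proof (rule subringI)
  fix x y assume "x \<in> commutant S" "y \<in> commutant S"
  then have xy: "x \<in> carrier R" "y \<in> carrier R" "\<And>s. s \<in> S \<Longrightarrow> x \<otimes> s = s \<otimes> x" "\<And>s. s \<in> S \<Longrightarrow> y \<otimes> s = s \<otimes> y"
    by (auto simp: commutant_def)
  have "x \<otimes> y \<otimes> s = s \<otimes> (x \<otimes> y)" if s: "s \<in> S" for s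
  proof -
    have sR: "s \<in> carrier R" using s S by auto
    have "x \<otimes> y \<otimes> s = x \<otimes> (s \<otimes> y)" using xy(1,2) xy(4)[OF s] sR by (simp add: m_assoc)
    also have "\<dots> = s \<otimes> x \<otimes> y" using xy(1,2) xy(3)[OF s] sR by (simp add: m_assoc[symmetric])
    finally show ?thesis using xy sR by (simp add: m_assoc)
  qed
  then show "x \<otimes> y \<in> commutant S" using xy by (simp add: commutant_def)
  show "x \<oplus> y \<in> commutant S" using xy S by (auto simp: commutant_def l_distr r_distr)
qed (use S in \<open>auto simp: commutant_def l_minus r_minus\<close>)

text \<open>
  All nonzero elements are invertible, with inverse \<open>x ^ k\<close>. Choose \<open>g\<close> with as many powers as possible. An
  element commuting with \<open>g\<close> lies together with \<open>g\<close> in a commutative subfield, which is finite with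
  cyclic multiplicative group; by the choice of \<open>g\<close> it is a power of \<open>g\<close>. So the centralizer \<open>K\<close> of \<open>g\<close>
  is finite, and a field with \<open>n + 1\<close> elements where \<open>n\<close> is the order of \<open>g\<close>.

  Right multiplication by \<open>g\<close> is a \<open>K\<close>-linear map whose \<open>n\<close>-th power is the identity. As \<open>K\<close> contains
  the \<open>n\<close> roots of unity \<open>g ^ j\<close>, the ring is the sum of the eigenspaces \<open>E j\<close>. Each of these is finite,
  since the quotient of two of its elements commutes with \<open>g\<close>.
\<close>

lemma finite_if_bounded_exponent:
  assumes one: "\<one> \<noteq> \<zero>" and tors: "\<And>x. x \<in> carrier R - {\<zero>} \<Longrightarrow> x [^] Suc k = \<one>"
  shows "finite (carrier R)"
proof -
  have inv: "x [^] k \<otimes> x = \<one>" "x \<otimes> x [^] k = \<one>" if "x \<in> carrier R - {\<zero>}" for x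
    using tors[OF that] that nat_pow_Suc2[of x k] by auto
  have cancel: "y = \<zero>" if "x \<in> carrier R - {\<zero>}" "y \<in> carrier R" "x \<otimes> y = \<zero>" for x y
  proof -
    have "y = (x [^] k \<otimes> x) \<otimes> y" using inv(1)[OF that(1)] that(2) by simp
    also have "\<dots> = x [^] k \<otimes> (x \<otimes> y)" using that by (intro m_assoc) auto
    finally show ?thesis using that by simp
  qed
  have pow_nz: "x [^] (i::nat) \<noteq> \<zero>" if x: "x \<in> carrier R - {\<zero>}" for x i
  proof (induction i)
    case (Suc i)
    then show ?case using cancel[of "x [^] i" x] x by auto
  qed (use one in simp)
  define P where "P x = {x [^] i | i :: nat. True}" for x
  have P_sub: "P y \<subseteq> P x" if "y \<in> P x" "x \<in> carrier R" for x y
    using that by (auto simp: P_def nat_pow_pow)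
  have PR: "P x \<subseteq> carrier R - {\<zero>}" if "x \<in> carrier R - {\<zero>}" for x
    using that pow_nz[OF that] by (auto simp: P_def)
  have self: "x \<in> P x" if "x \<in> carrier R" for x
    unfolding P_def using that by (intro CollectI exI[of _ 1]) simp
  have finP: "finite (P x) \<and> card (P x) \<le> Suc k" if x: "x \<in> carrier R - {\<zero>}" for x
  proof -
    have "x [^] i = x [^] (i mod Suc k)" for i
    proof -
      have "x [^] i = x [^] (Suc k * (i div Suc k) + i mod Suc k)" by (simp only: mult_div_mod_eq)
      also have "\<dots> = (x [^] Suc k) [^] (i div Suc k) \<otimes> x [^] (i mod Suc k)"
        using x by (simp only: nat_pow_pow nat_pow_mult[symmetric] nat_pow_closed DiffD1)
      finally show ?thesis using tors[OF x] x by simp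
    qed
    then have "P x \<subseteq> (\<lambda>i. x [^] i) ` {..<Suc k}" unfolding P_def by (auto simp del: mod_Suc_le_divisor) (metis image_eqI lessThan_iff mod_less_divisor zero_less_Suc)
    then show ?thesis using card_image_le[of "{..<Suc k}" "\<lambda>i. x [^] i"] card_mono finite_subset
      by (metis card_lessThan finite_imageI finite_lessThan le_trans)
  qed
  \<comment> \<open>Two commuting elements are powers of a single one.\<close>
  have common: "\<exists>a\<in>carrier R - {\<zero>}. g \<in> P a \<and> b \<in> P a"
    if g: "g \<in> carrier R - {\<zero>}" and b: "b \<in> carrier R - {\<zero>}" and gb: "g \<otimes> b = b \<otimes> g" for g b
  proof -
    \<comment> \<open>The double centralizer is commutative and closed under inverses.\<close>
    define F where "F = commutant (commutant {g, b})"
    have sub: "{g, b} \<subseteq> commutant {g, b}" using g b gb by (auto simp: commutant_def)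
    have sF: "subring F R" unfolding F_def by (rule commutant_subring) (auto simp: commutant_def)
    have gF: "g \<in> F" "b \<in> F" using g b by (auto simp: F_def commutant_def)
    have comm: "x \<otimes> y = y \<otimes> x" if "x \<in> F" "y \<in> F" for x y
    proof -
      have FD: "x \<in> carrier R \<and> x \<otimes> s = s \<otimes> x" if "x \<in> F" "s \<in> commutant {g, b}" for x s
        using that unfolding F_def commutant_def[of "commutant {g, b}"] by blast
      have "y \<otimes> g = g \<otimes> y" "y \<otimes> b = b \<otimes> y" "y \<in> carrier R" using FD[OF that(2)] sub by blast+
      then have "y \<in> commutant {g, b}" unfolding commutant_def by blast
      then show ?thesis using FD[OF that(1)] by blast
    qed
    interpret F: ring "R\<lparr>carrier := F\<rparr>" using subring_is_ring[OF sF] .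
    interpret F: cring "R\<lparr>carrier := F\<rparr>" by unfold_locales (use comm in auto)
    have powF: "x [^]\<^bsub>R\<lparr>carrier := F\<rparr>\<^esub> (i::nat) = x [^] i" for x i using nat_pow_consistent by simp
    have FR: "F \<subseteq> carrier R" by (auto simp: F_def commutant_def)
    have "field (R\<lparr>carrier := F\<rparr>)"
    proof (rule F.cring_fieldI2)
      fix a assume a: "a \<in> carrier (R\<lparr>carrier := F\<rparr>)" "a \<noteq> \<zero>\<^bsub>R\<lparr>carrier := F\<rparr>\<^esub>"
      then have "a [^] k \<in> F" using F.nat_pow_closed[of a k] powF by simp
      then show "\<exists>b\<in>carrier (R\<lparr>carrier := F\<rparr>). a \<otimes>\<^bsub>R\<lparr>carrier := F\<rparr>\<^esub> b = \<one>\<^bsub>R\<lparr>carrier := F\<rparr>\<^esub>"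
        using inv(2)[of a] a FR by auto
    qed (use one in simp)
    then interpret F: field "R\<lparr>carrier := F\<rparr>" .
    have "finite (carrier (R\<lparr>carrier := F\<rparr>))"
      by (rule F.finite_if_bounded_exponent[of k]) (unfold powF, use tors FR in auto)
    from F.finite_field_mult_group_has_gen[OF this]
    obtain a where a: "a \<in> F - {\<zero>}" "F - {\<zero>} = {a [^] i | i :: nat. True}"
      by (auto simp: powF)
    then show ?thesis using gF g b FR unfolding P_def by (intro bexI[of _ a]) auto
  qed
  have o: "\<one> \<in> carrier R - {\<zero>}" using one by simp
  obtain g where g: "g \<in> carrier R - {\<zero>}" and gmax: "\<And>x. x \<in> carrier R - {\<zero>} \<Longrightarrow> card (P x) \<le> card (P g)"
  proof -
    have "\<exists>x. x \<in> carrier R - {\<zero>} \<and> (\<forall>y. y \<in> carrier R - {\<zero>} \<longrightarrow> card (P y) \<le> card (P x))"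
      by (rule ex_has_greatest_nat[where k = \<one> and b = "Suc (Suc k)"]) (use o finP in \<open>auto simp: less_Suc_eq_le\<close>)
    then show thesis using that by blast
  qed
  have gR: "g \<in> carrier R" using g by simp
  have gP: "b \<in> P g" if b: "b \<in> carrier R - {\<zero>}" "b \<otimes> g = g \<otimes> b" for b
  proof -
    obtain a where a: "a \<in> carrier R - {\<zero>}" "g \<in> P a" "b \<in> P a" using common[OF g b(1)] b(2) by metis
    have "P g = P a"
      by (rule card_seteq) (use finP[OF a(1)] P_sub[OF a(2)] gmax[OF a(1)] a(1) in auto)
    then show ?thesis using a by simp
  qed
  define K where "K = commutant {g}"
  have K: "K = insert \<zero> (P g)"
  proof -
    have "g [^] i \<in> K" for i :: nat
    proof -
      have "g [^] i \<otimes> g = g \<otimes> g [^] i" using gR nat_pow_Suc2[OF gR, of i] by simp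
      then show ?thesis using gR by (simp add: K_def commutant_def)
    qed
    then show ?thesis using gP gR by (auto simp: K_def commutant_def P_def)
  qed
  have finK: "finite K" using K finP[OF g] by simp
  define n where "n = (LEAST n :: nat. 0 < n \<and> g [^] n = \<one>)"
  have n: "0 < n" "g [^] n = \<one>"
    unfolding n_def using LeastI[of "\<lambda>n :: nat. 0 < n \<and> g [^] n = \<one>" "Suc k"] tors[OF g] by auto
  have least: "g [^] i \<noteq> \<one>" if "0 < i" "i < n" for i
    using not_less_Least[of i "\<lambda>n :: nat. 0 < n \<and> g [^] n = \<one>"] that by (auto simp: n_def)
  have inj: "inj_on (\<lambda>i. g [^] i) {..<n}"
  proof (rule linorder_inj_onI)
    fix i j assume ij: "i < j" "i \<in> {..<n}" "j \<in> {..<n}"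
    show "g [^] i \<noteq> g [^] j"
    proof
      assume e: "g [^] i = g [^] j"
      have "g [^] (n - i) \<otimes> g [^] i = g [^] (n - i) \<otimes> g [^] j" using e by simp
      then have "\<one> = g [^] (n - i + j)" using ij n gR by (simp add: nat_pow_mult)
      also have "n - i + j = (j - i) + n" using ij by auto
      also have "g [^] ((j - i) + n) = g [^] (j - i) \<otimes> g [^] n" using gR by (rule nat_pow_mult[symmetric])
      finally have "g [^] (j - i) = \<one>" using n(2) gR by simp
      moreover have "j - i < n" "0 < j - i" using ij by (auto intro: less_imp_diff_less)
      ultimately show False using least[of "j - i"] by blast
    qed
  qed auto
  have pow_mod: "g [^] i = g [^] (i mod n)" for i
  proof -
    have "g [^] i = g [^] (n * (i div n) + i mod n)" by simp
    also have "\<dots> = (g [^] n) [^] (i div n) \<otimes> g [^] (i mod n)"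
      using gR by (simp only: nat_pow_pow nat_pow_mult[symmetric] nat_pow_closed)
    finally show ?thesis using n gR by simp
  qed
  have "P g = (\<lambda>i. g [^] i) ` {..<n}"
  proof
    show "P g \<subseteq> (\<lambda>i. g [^] i) ` {..<n}"
      unfolding P_def using pow_mod n(1) by (auto simp: image_iff) (metis lessThan_iff mod_less_divisor)
  qed (auto simp: P_def)
  then have cardK: "card K = Suc n"
    using K finP[OF g] PR[OF g] card_image[OF inj] by (subst K) (auto simp: card_insert_if)
  \<comment> \<open>The additive group of \<open>K\<close> has order \<open>n + 1\<close>.\<close>
  have n_one: "nsum (\<lambda>_. \<one>) n = \<ominus> \<one>"
  proof -
    interpret F: ring "R\<lparr>carrier := K\<rparr>"
      unfolding K_def by (rule subring_is_ring[OF commutant_subring]) (use gR in auto)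
    have "nsum (\<lambda>_. \<one>) i = [i] \<cdot>\<^bsub>R\<lparr>carrier := K\<rparr>\<^esub> \<one>" for i :: nat
      by (induction i) (simp_all add: add_pow_def nat_pow_def)
    moreover have "[order (add_monoid (R\<lparr>carrier := K\<rparr>))] \<cdot>\<^bsub>R\<lparr>carrier := K\<rparr>\<^esub> \<one> = \<zero>"
      using F.add.pow_order_eq_1[of \<one>] F.one_closed by (simp add: add_pow_def)
    moreover have "order (add_monoid (R\<lparr>carrier := K\<rparr>)) = Suc n" using cardK by (simp add: order_def)
    ultimately have "nsum (\<lambda>_. \<one>) n \<oplus> \<one> = \<zero>" by (metis nsum.simps(2))
    then show ?thesis using minus_equality[of "nsum (\<lambda>_. \<one>) n" \<one>] by simp
  qed
  define E where "E j = {x \<in> carrier R. g [^] j \<otimes> x = x \<otimes> g}" for j :: nat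
  have finE: "finite (E j)" for j
  proof (cases "E j \<subseteq> {\<zero>}")
    case True
    then show ?thesis by (rule finite_subset) simp
  next
    case False
    then obtain y where y: "y \<in> carrier R - {\<zero>}" "g [^] j \<otimes> y = y \<otimes> g" by (auto simp: E_def)
    define z where "z = y [^] k"
    have zR: "z \<in> carrier R" and zy: "z \<otimes> y = \<one>" "y \<otimes> z = \<one>" using inv[OF y(1)] y(1) by (auto simp: z_def)
    have zg: "z \<otimes> g [^] j = g \<otimes> z"
    proof -
      have "z \<otimes> g [^] j = z \<otimes> (g [^] j \<otimes> y) \<otimes> z" using zR y(1) zy gR by (simp add: m_assoc)
      also have "\<dots> = (z \<otimes> y) \<otimes> g \<otimes> z" using y zR gR by (simp add: m_assoc)
      finally show ?thesis using zy gR zR by simp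
    qed
    have "x \<in> (\<lambda>c. y \<otimes> c) ` K" if x: "x \<in> E j" for x
    proof (rule image_eqI)
      have xR: "x \<in> carrier R" and xg: "g [^] j \<otimes> x = x \<otimes> g" using x by (auto simp: E_def)
      show "x = y \<otimes> (z \<otimes> x)" using xR zR y(1) zy by (simp add: m_assoc[symmetric])
      have "z \<otimes> x \<otimes> g = z \<otimes> g [^] j \<otimes> x" using xR zR gR xg by (simp add: m_assoc)
      also have "\<dots> = g \<otimes> (z \<otimes> x)" using xR zR gR zg by (simp add: m_assoc)
      finally show "z \<otimes> x \<in> K" using xR zR by (simp add: K_def commutant_def)
    qed
    then show ?thesis using finK by (meson finite_imageI finite_subset subsetI)
  qed
  \<comment> \<open>Up to the factor \<open>n = -1\<close>, the maps \<open>\<pi> j\<close> are the projections to the eigenspaces.\<close>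
  define r where "r = g [^] (n - 1)"
  have rR: "r \<in> carrier R" using gR by (simp add: r_def)
  have rg: "r \<otimes> g = \<one>" "g \<otimes> r = \<one>"
  proof -
    have "g [^] Suc (n - 1) = \<one>" using n by simp
    then show "r \<otimes> g = \<one>" "g \<otimes> r = \<one>"
      unfolding r_def using nat_pow_Suc2[OF gR, of "n - 1"] by simp_all
  qed
  have gr_pow: "g [^] i \<otimes> r [^] i = \<one>" for i :: nat
  proof (induction i)
    case (Suc i)
    have "g [^] Suc i \<otimes> r [^] Suc i = g [^] i \<otimes> (g \<otimes> r) \<otimes> r [^] i"
      using gR rR nat_pow_Suc2[OF rR, of i] by (simp add: m_assoc)
    then show ?case using Suc rg gR by simp
  qed simp
  have r_n: "r [^] n = \<one>" using gR n by (simp add: r_def nat_pow_pow mult.commute[of _ n] nat_pow_pow[symmetric])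
  have r_least: "r [^] i \<noteq> \<one>" if "0 < i" "i < n" for i
    using gr_pow[of i] least[OF that] gR by auto
  define \<pi> where "\<pi> j x = nsum (\<lambda>i. r [^] (i * j) \<otimes> x \<otimes> g [^] i) n" for j x
  have \<pi>E: "\<pi> j x \<in> E j" if x: "x \<in> carrier R" for j x
  proof -
    define f where "f i = g [^] j \<otimes> (r [^] (i * j) \<otimes> x \<otimes> g [^] i)" for i
    have fR: "f i \<in> carrier R" for i using gR rR x by (simp add: f_def)
    have f_Suc: "f (Suc i) = r [^] (i * j) \<otimes> x \<otimes> g [^] i \<otimes> g" for i
    proof -
      have "f (Suc i) = (g [^] j \<otimes> r [^] j) \<otimes> r [^] (i * j) \<otimes> x \<otimes> g [^] i \<otimes> g"
        using gR rR x by (simp add: f_def m_assoc nat_pow_mult[symmetric])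
      then show ?thesis using gr_pow gR rR x by simp
    qed
    have "r [^] (n * j) = \<one>" using r_n rR by (simp add: nat_pow_pow[symmetric])
    then have "f n = f 0" using n(2) gR x by (simp add: f_def)
    have "g [^] j \<otimes> \<pi> j x = nsum f n"
      unfolding \<pi>_def f_def using gR rR x by (intro nsum_ldistr) auto
    also have "\<dots> = nsum (\<lambda>i. f (Suc i)) n" using nsum_rotate[OF fR \<open>f n = f 0\<close>] by simp
    also have "\<dots> = \<pi> j x \<otimes> g"
      unfolding \<pi>_def f_Suc using gR rR x by (intro nsum_rdistr[symmetric]) auto
    finally show ?thesis using gR rR x by (simp add: E_def \<pi>_def)
  qed
  have \<pi>sum: "nsum (\<lambda>j. \<pi> j x) n = \<ominus> x" if x: "x \<in> carrier R" for x
  proof -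
    have inner: "nsum (\<lambda>j. r [^] (i * j) \<otimes> x \<otimes> g [^] i) n = (if i = 0 then \<ominus> x else \<zero>)" if i: "i < n" for i
    proof -
      define h where "h = r [^] i"
      have hR: "h \<in> carrier R" using rR by (simp add: h_def)
      have "nsum (\<lambda>j. r [^] (i * j) \<otimes> x \<otimes> g [^] i) n = nsum (\<lambda>j. h [^] j) n \<otimes> x \<otimes> g [^] i"
        using gR rR x by (simp add: nsum_rdistr h_def nat_pow_pow)
      moreover have "nsum (\<lambda>j. h [^] j) n = \<zero>" if "i \<noteq> 0"
      proof -
        have hn: "h [^] n = \<one>" using r_n rR by (simp add: h_def nat_pow_pow mult.commute[of i] nat_pow_pow[symmetric])
        define S where "S = nsum (\<lambda>j. h [^] j) n"
        have SR: "S \<in> carrier R" using hR by (simp add: S_def)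
        have "h \<otimes> S = nsum (\<lambda>j. h [^] Suc j) n"
          unfolding S_def using hR nat_pow_Suc2[OF hR] by (simp add: nsum_ldistr)
        also have "\<dots> = S" unfolding S_def using hR hn by (intro nsum_rotate) auto
        finally have "(h \<ominus> \<one>) \<otimes> S = \<zero>" using hR SR by (simp add: a_minus_def l_distr l_minus r_neg)
        moreover have "h \<ominus> \<one> \<noteq> \<zero>" using r_least[of i] that i hR by (simp add: h_def)
        ultimately show ?thesis using cancel[of "h \<ominus> \<one>" S] hR SR by (simp add: S_def)
      qed
      moreover have "nsum (\<lambda>j. h [^] j) n = \<ominus> \<one>" if "i = 0" using n_one that by (simp add: h_def)
      ultimately show ?thesis using x gR by (auto simp: l_minus)
    qed
    have "nsum (\<lambda>j. \<pi> j x) n = nsum (\<lambda>i. nsum (\<lambda>j. r [^] (i * j) \<otimes> x \<otimes> g [^] i) n) n"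
      unfolding \<pi>_def using gR rR x by (intro nsum_swap) auto
    also have "\<dots> = nsum (\<lambda>i. if i = 0 then \<ominus> x else \<zero>) n" by (rule nsum_cong[OF inner])
    also have "\<dots> = \<ominus> x"
    proof -
      have "nsum (\<lambda>i. if i = 0 then \<ominus> x else \<zero>) (Suc i) = \<ominus> x" for i by (induction i) (use x in auto)
      then show ?thesis using n(1) by (metis gr0_implies_Suc)
    qed
    finally show ?thesis .
  qed
  have "carrier R \<subseteq> (\<lambda>y. \<ominus> nsum y n) ` (PiE {..<n} E)"
  proof
    fix x assume x: "x \<in> carrier R"
    define y where "y = restrict (\<lambda>j. \<pi> j x) {..<n}"
    have "nsum y n = nsum (\<lambda>j. \<pi> j x) n" by (rule nsum_cong) (simp add: y_def)
    then have "x = \<ominus> nsum y n" using \<pi>sum[OF x] x by simp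
    moreover have "y \<in> PiE {..<n} E" using \<pi>E[OF x] by (simp add: y_def)
    ultimately show "x \<in> (\<lambda>y. \<ominus> nsum y n) ` (PiE {..<n} E)" by blast
  qed
  then show ?thesis using finE by (meson finite_PiE finite_imageI finite_lessThan finite_subset)
qed

end

section \<open>Finiteness of semiprime rings with bounded arrays\<close>

context semiprime_bounded begin

lemma finite_corner:
  assumes F: "orthogonal F" and max: "\<And>G. orthogonal G \<Longrightarrow> card G \<le> card F" and f: "f \<in> F"
  shows "finite (corner f f)"
proof -
  note FF = F_facts[OF F max]
  have fR: "f \<in> carrier R" and ff: "f \<otimes> f = f" and f0: "f \<noteq> \<zero>" using FF f by auto
  define D where "D = R\<lparr>carrier := corner f f, one := f\<rparr>"
  have corner: "x \<in> corner f f \<longleftrightarrow> x \<in> carrier R \<and> f \<otimes> x = x \<and> x \<otimes> f = x" for x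
    by (auto simp: corner_def[OF F max])
  have mult: "x \<otimes> y \<in> corner f f" if "x \<in> corner f f" "y \<in> corner f f" for x y
  proof -
    have R: "x \<in> carrier R" "y \<in> carrier R" "f \<otimes> x = x" "y \<otimes> f = y" using that by (auto simp: corner)
    have "f \<otimes> (x \<otimes> y) = f \<otimes> x \<otimes> y" "x \<otimes> y \<otimes> f = x \<otimes> (y \<otimes> f)"
      using R(1,2) fR by (simp_all add: m_assoc)
    then show ?thesis using R by (simp add: corner m_closed)
  qed
  have D: "ring D"
  proof (rule ringI)
    show "abelian_group D"
    proof (rule abelian_groupI)
      fix x assume x: "x \<in> carrier D"
      then have "\<ominus> x \<in> corner f f" using fR by (simp add: D_def corner l_minus r_minus)
      then show "\<exists>y\<in>carrier D. y \<oplus>\<^bsub>D\<^esub> x = \<zero>\<^bsub>D\<^esub>"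
        using x by (intro bexI[of _ "\<ominus> x"]) (auto simp: D_def corner l_neg)
    qed (use fR in \<open>auto simp: D_def corner l_distr r_distr a_ac\<close>)
    show "Group.monoid D"
      by (rule monoidI) (use mult fR ff in \<open>auto simp: D_def corner m_assoc\<close>)
  qed (auto simp: D_def corner l_distr r_distr)
  interpret D: ring D by (rule D)
  have pw: "x [^]\<^bsub>D\<^esub> Suc k = pw x k" if "x \<in> corner f f" for x k
  proof (induction k)
    case 0
    then show ?case using that by (simp add: D_def corner)
  next
    case (Suc k)
    then show ?case by (simp add: D_def)
  qed
  have "finite (carrier D)"
  proof (rule D.finite_if_bounded_exponent[of N])
    show "\<one>\<^bsub>D\<^esub> \<noteq> \<zero>\<^bsub>D\<^esub>" using f0 by (simp add: D_def)
    fix x assume x: "x \<in> carrier D - {\<zero>\<^bsub>D\<^esub>}"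
    then have x': "x \<in> corner f f" "x \<noteq> \<zero>" by (auto simp: D_def)
    show "x [^]\<^bsub>D\<^esub> Suc N = \<one>\<^bsub>D\<^esub>"
    proof -
      have "\<one>\<^bsub>D\<^esub> = f" by (simp add: D_def)
      then show ?thesis using trans[OF pw[OF x'(1)] corner_power[OF F max f x']] by (simp only:)
    qed
  qed
  then show ?thesis by (simp add: D_def)
qed

theorem finite_carrier: "finite (carrier R)"
proof -
  obtain F where F: "orthogonal F" "\<And>G. orthogonal G \<Longrightarrow> card G \<le> card F"
    using maximal_orthogonal by blast
  show ?thesis
    by (rule finite_if_corners_finite[where F = F], rule F(1), erule F(2),
        rule finite_corner[where F = F], rule F(1), erule F(2), assumption)
qed

end

section \<open>Quotients\<close>

lemma rng_image:
  assumes A: "rng A" and B: "carrier B = h ` carrier A"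
    and add: "\<And>x y. x \<in> carrier A \<Longrightarrow> y \<in> carrier A \<Longrightarrow> h (x \<oplus>\<^bsub>A\<^esub> y) = h x \<oplus>\<^bsub>B\<^esub> h y"
    and mult: "\<And>x y. x \<in> carrier A \<Longrightarrow> y \<in> carrier A \<Longrightarrow> h (x \<otimes>\<^bsub>A\<^esub> y) = h x \<otimes>\<^bsub>B\<^esub> h y"
    and zero: "h \<zero>\<^bsub>A\<^esub> = \<zero>\<^bsub>B\<^esub>"
  shows "rng B"
proof -
  interpret A: rng A by (rule A)
  have "abelian_group B"
  proof (rule abelian_groupI)
    fix x assume "x \<in> carrier B"
    then obtain a where a: "a \<in> carrier A" "x = h a" using B by auto
    then have "h (\<ominus>\<^bsub>A\<^esub> a) \<oplus>\<^bsub>B\<^esub> x = \<zero>\<^bsub>B\<^esub>" by (simp add: add[symmetric] A.l_neg zero)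
    then show "\<exists>y\<in>carrier B. y \<oplus>\<^bsub>B\<^esub> x = \<zero>\<^bsub>B\<^esub>" using a B by blast
    show "\<zero>\<^bsub>B\<^esub> \<oplus>\<^bsub>B\<^esub> x = x" using a by (simp add: add[symmetric] zero[symmetric])
  next
    fix x y assume "x \<in> carrier B" "y \<in> carrier B"
    then obtain a b where ab: "a \<in> carrier A" "x = h a" "b \<in> carrier A" "y = h b" using B by auto
    then show "x \<oplus>\<^bsub>B\<^esub> y \<in> carrier B" using B by (simp add: add[symmetric])
    show "x \<oplus>\<^bsub>B\<^esub> y = y \<oplus>\<^bsub>B\<^esub> x" using ab by (simp add: add[symmetric] A.a_comm)
    fix z assume "z \<in> carrier B"
    then obtain c where "c \<in> carrier A" "z = h c" using B by auto
    then show "x \<oplus>\<^bsub>B\<^esub> y \<oplus>\<^bsub>B\<^esub> z = x \<oplus>\<^bsub>B\<^esub> (y \<oplus>\<^bsub>B\<^esub> z)"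
      using ab by (simp add: add[symmetric] A.a_assoc)
  next
    show "\<zero>\<^bsub>B\<^esub> \<in> carrier B" using B zero by (metis A.zero_closed imageI)
  qed
  moreover have "rng_axioms B"
  proof
    fix x y assume "x \<in> carrier B" "y \<in> carrier B"
    then obtain a b where ab: "a \<in> carrier A" "x = h a" "b \<in> carrier A" "y = h b" using B by auto
    then show "x \<otimes>\<^bsub>B\<^esub> y \<in> carrier B" using B A.m_closed by (simp add: mult[symmetric])
    fix z assume "z \<in> carrier B"
    then obtain c where c: "c \<in> carrier A" "z = h c" using B by auto
    show "x \<otimes>\<^bsub>B\<^esub> y \<otimes>\<^bsub>B\<^esub> z = x \<otimes>\<^bsub>B\<^esub> (y \<otimes>\<^bsub>B\<^esub> z)"
      using ab c by (simp add: mult[symmetric] A.m_assoc A.m_closed)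
    show "(x \<oplus>\<^bsub>B\<^esub> y) \<otimes>\<^bsub>B\<^esub> z = x \<otimes>\<^bsub>B\<^esub> z \<oplus>\<^bsub>B\<^esub> y \<otimes>\<^bsub>B\<^esub> z"
      "z \<otimes>\<^bsub>B\<^esub> (x \<oplus>\<^bsub>B\<^esub> y) = z \<otimes>\<^bsub>B\<^esub> x \<oplus>\<^bsub>B\<^esub> z \<otimes>\<^bsub>B\<^esub> y"
      using ab c by (simp_all add: mult[symmetric] add[symmetric] A.l_distr A.r_distr A.m_closed)
  qed
  ultimately show ?thesis by (simp add: rng_def)
qed

context rng begin

text \<open>
  Addition and multiplication of cosets are defined by means of representatives \<open>r Z\<close>.
\<close>

definition quotient :: "'a set \<Rightarrow> 'a set ring" where
  "quotient Q = (let r = (\<lambda>Z. SOME x. x \<in> carrier R \<and> coset Q x = Z) in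
     \<lparr>carrier = coset Q ` carrier R, monoid.mult = (\<lambda>Z Y. coset Q (r Z \<otimes> r Y)), one = undefined,
      zero = coset Q \<zero>, add = (\<lambda>Z Y. coset Q (r Z \<oplus> r Y))\<rparr>)"

lemma quotient_facts:
  assumes Q: "two_sided_ideal R Q"
  shows "carrier (quotient Q) = coset Q ` carrier R" "coset Q \<zero> = \<zero>\<^bsub>quotient Q\<^esub>"
    "\<And>x y. x \<in> carrier R \<Longrightarrow> y \<in> carrier R \<Longrightarrow> coset Q (x \<oplus> y) = coset Q x \<oplus>\<^bsub>quotient Q\<^esub> coset Q y"
    "\<And>x y. x \<in> carrier R \<Longrightarrow> y \<in> carrier R \<Longrightarrow> coset Q (x \<otimes> y) = coset Q x \<otimes>\<^bsub>quotient Q\<^esub> coset Q y"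
proof -
  note I = ideal_facts[OF Q] and S = subgroup_facts[OF ideal_facts(1)[OF Q]]
  note eq = coset_eq_iff[OF I(1)]
  define r where "r Z = (SOME x. x \<in> carrier R \<and> coset Q x = Z)" for Z
  have r: "r (coset Q x) \<in> carrier R \<and> coset Q (r (coset Q x)) = coset Q x" if "x \<in> carrier R" for x
    unfolding r_def by (rule someI[of _ x]) (use that in auto)
  show "carrier (quotient Q) = coset Q ` carrier R" "coset Q \<zero> = \<zero>\<^bsub>quotient Q\<^esub>"
    by (simp_all add: quotient_def)
  fix x y assume xy: "x \<in> carrier R" "y \<in> carrier R"
  define x' y' where "x' = r (coset Q x)" and "y' = r (coset Q y)"
  have R': "x' \<in> carrier R" "y' \<in> carrier R" using r xy by (auto simp: x'_def y'_def)
  have d: "x \<ominus> x' \<in> Q" "y \<ominus> y' \<in> Q"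
    using r[OF xy(1)] r[OF xy(2)] eq[OF xy(1) R'(1)] eq[OF xy(2) R'(2)] by (simp_all add: x'_def y'_def)
  have "(x \<oplus> y) \<ominus> (x' \<oplus> y') = (x \<ominus> x') \<oplus> (y \<ominus> y')" using xy R' by algebra
  then have "coset Q (x \<oplus> y) = coset Q (x' \<oplus> y')" using S(3)[OF d] xy R' by (simp add: eq)
  then show "coset Q (x \<oplus> y) = coset Q x \<oplus>\<^bsub>quotient Q\<^esub> coset Q y"
    by (simp add: quotient_def r_def[symmetric] x'_def y'_def)
  have "(x \<otimes> y) \<ominus> (x' \<otimes> y') = (x \<ominus> x') \<otimes> y \<oplus> x' \<otimes> (y \<ominus> y')" using xy R' by algebra
  moreover have "(x \<ominus> x') \<otimes> y \<oplus> x' \<otimes> (y \<ominus> y') \<in> Q"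
    using S(3)[OF I(4)[OF xy(2) d(1)] I(3)[OF R'(1) d(2)]] .
  ultimately have "coset Q (x \<otimes> y) = coset Q (x' \<otimes> y')" using xy R' by (simp add: eq m_closed)
  then show "coset Q (x \<otimes> y) = coset Q x \<otimes>\<^bsub>quotient Q\<^esub> coset Q y"
    by (simp add: quotient_def r_def[symmetric] x'_def y'_def)
qed

lemma quotient_rng: "two_sided_ideal R Q \<Longrightarrow> rng (quotient Q)"
  using rng_image[OF rng_axioms, where h = "coset Q" and B = "quotient Q"] quotient_facts[of Q] by simp

lemma coset_zero_iff:
  assumes "two_sided_ideal R Q" "x \<in> carrier R"
  shows "coset Q x = \<zero>\<^bsub>quotient Q\<^esub> \<longleftrightarrow> x \<in> Q"
proof -
  have "x \<ominus> \<zero> = x" using assms(2) by algebra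
  then show ?thesis
    using coset_eq_iff[OF ideal_facts(1)[OF assms(1)] assms(2) zero_closed] quotient_facts(2)[OF assms(1)] by simp
qed

lemma separating_array_quotient:
  assumes Q: "two_sided_ideal R Q" and arr: "separating_array (quotient Q) {\<zero>\<^bsub>quotient Q\<^esub>} n U V Z"
  shows "\<exists>u v x. separating_array R Q n u v x"
proof -
  interpret B: rng "quotient Q" by (rule quotient_rng[OF Q])
  note q = quotient_facts[OF Q]
  define r where "r Z = (SOME x. x \<in> carrier R \<and> coset Q x = Z)" for Z
  have r: "r Z \<in> carrier R \<and> coset Q (r Z) = Z" if Z: "Z \<in> carrier (quotient Q)" for Z
  proof -
    obtain x where "x \<in> carrier R" "coset Q x = Z" using Z q(1) by auto
    then show ?thesis unfolding r_def using someI[of "\<lambda>x. x \<in> carrier R \<and> coset Q x = Z" x] by simp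
  qed
  have c: "U i \<in> carrier (quotient Q)" "V i \<in> carrier (quotient Q)" "Z i j \<in> carrier (quotient Q)"
    if "i < n" "j < n" for i j
    using arr that by (auto simp: separating_array_def)
  have prod: "coset Q (r (U i) \<otimes> r (Z l j) \<otimes> r (V i)) = U i \<otimes>\<^bsub>quotient Q\<^esub> Z l j \<otimes>\<^bsub>quotient Q\<^esub> V i"
    and prod_R: "r (U i) \<otimes> r (Z l j) \<otimes> r (V i) \<in> carrier R"
    if "i < n" "l < n" "j < n" for i l j
    using r c that by (simp_all add: q(4)[symmetric] q(4) m_closed)
  have "separating_array R Q n (\<lambda>i. r (U i)) (\<lambda>i. r (V i)) (\<lambda>i j. r (Z i j))"
    unfolding separating_array_def
  proof (intro conjI allI impI)
    fix i l j assume ilj: "i < n" "l < n" "j < n" "l \<noteq> i"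
    then have "U i \<otimes>\<^bsub>quotient Q\<^esub> Z l j \<otimes>\<^bsub>quotient Q\<^esub> V i = \<zero>\<^bsub>quotient Q\<^esub>"
      using arr by (auto simp: separating_array_def)
    then show "r (U i) \<otimes> r (Z l j) \<otimes> r (V i) \<in> Q"
      using prod[OF ilj(1-3)] coset_zero_iff[OF Q prod_R[OF ilj(1-3)]] by simp
  next
    fix i j j' assume ij: "i < n" "j < n" "j' < n" "j \<noteq> j'"
    let ?b = "\<lambda>j. U i \<otimes>\<^bsub>quotient Q\<^esub> Z i j \<otimes>\<^bsub>quotient Q\<^esub> V i"
    have "?b j \<ominus>\<^bsub>quotient Q\<^esub> ?b j' \<noteq> \<zero>\<^bsub>quotient Q\<^esub>" using arr ij by (auto simp: separating_array_def)
    moreover have "?b j \<in> carrier (quotient Q)" "?b j' \<in> carrier (quotient Q)"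
      using c ij by (auto intro!: B.m_closed)
    ultimately have "?b j \<noteq> ?b j'" using B.minus_eq_zero_iff by blast
    then show "r (U i) \<otimes> r (Z i j) \<otimes> r (V i) \<ominus> r (U i) \<otimes> r (Z i j') \<otimes> r (V i) \<notin> Q"
      using prod[OF ij(1,1,2)] prod[OF ij(1,1,3)] prod_R[OF ij(1,1,2)] prod_R[OF ij(1,1,3)]
        coset_eq_iff[OF ideal_facts(1)[OF Q]] by metis
  qed (use r c in auto)
  then show ?thesis by blast
qed

lemma coset_pw:
  assumes "two_sided_ideal R Q" "x \<in> carrier R"
  shows "rng.pw (quotient Q) (coset Q x) k = coset Q (pw x k)"
proof -
  interpret B: rng "quotient Q" by (rule quotient_rng[OF assms(1)])
  show ?thesis by (induction k) (use quotient_facts(4)[OF assms(1)] assms(2) in auto)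
qed

lemma coset_mprod:
  assumes "two_sided_ideal R Q" "xs \<noteq> []" "set xs \<subseteq> carrier R"
  shows "mprod (quotient Q) (map (coset Q) xs) = coset Q (mprod R xs)"
proof -
  interpret B: rng "quotient Q" by (rule quotient_rng[OF assms(1)])
  show ?thesis using assms(2,3)
  proof (induction xs rule: rev_nonempty_induct)
    case (snoc x xs)
    then show ?case using quotient_facts(4)[OF assms(1)] mprod_closed[of xs]
      by (simp add: mprod_snoc B.mprod_snoc)
  qed simp
qed

lemma nilpotent_extension:
  assumes N: "N \<subseteq> carrier R" and Q: "Q \<subseteq> carrier R" "nilpotent_subset R Q"
    and K: "K \<ge> 1" "\<And>xs. length xs = K \<Longrightarrow> set xs \<subseteq> N \<Longrightarrow> mprod R xs \<in> Q"
  shows "nilpotent_subset R N"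
proof -
  have nonempty: "xs \<noteq> []" if "length xs = k * K" "k \<ge> 1" for xs :: "'a list" and k
    using that K(1) by auto
  have chunk: "\<exists>ys. length ys = Suc k \<and> set ys \<subseteq> Q \<and> mprod R xs = mprod R ys"
    if "length xs = Suc k * K" "set xs \<subseteq> N" for xs k
    using that
  proof (induction k arbitrary: xs)
    case 0
    then show ?case using K(2)[of xs] by (intro exI[of _ "[mprod R xs]"]) auto
  next
    case (Suc k)
    define as bs where "as = take K xs" and "bs = drop K xs"
    have xs: "xs = as @ bs" by (simp add: as_def bs_def)
    have len: "length as = K" "length bs = Suc k * K" using Suc.prems(1) by (auto simp: as_def bs_def)
    have sub: "set as \<subseteq> N" "set bs \<subseteq> N" using Suc.prems(2) xs by auto
    obtain ys where ys: "length ys = Suc k" "set ys \<subseteq> Q" "mprod R bs = mprod R ys"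
      using Suc.IH[OF len(2) sub(2)] by blast
    have ne: "as \<noteq> []" "bs \<noteq> []" "ys \<noteq> []" using len K(1) ys(1) by auto
    have "mprod R xs = mprod R as \<otimes> mprod R ys"
      unfolding xs using mprod_append[OF ne(1) _ ne(2)] sub N ys(3) by auto
    also have "\<dots> = mprod R (mprod R as # ys)"
      using mprod_Cons[of "mprod R as" ys] ne ys(2) Q(1) mprod_closed[OF ne(1)] sub(1) N by auto
    finally show ?case using ys K(2)[OF len(1) sub(1)] by (intro exI[of _ "mprod R as # ys"]) auto
  qed
  obtain d where d: "d \<ge> 1" "\<And>ys. length ys = d \<Longrightarrow> set ys \<subseteq> Q \<Longrightarrow> mprod R ys = \<zero>"
    using Q(2) unfolding nilpotent_subset_def mprod_def by blast
  obtain k where k: "d = Suc k" using d(1) by (cases d) auto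
  have "mprod R xs = \<zero>" if "length xs = d * K" "set xs \<subseteq> N" for xs
    using chunk[of xs k] d(2) that k by metis
  moreover have "d * K \<ge> 1" using d(1) K(1) by simp
  ultimately show ?thesis unfolding nilpotent_subset_def mprod_def[symmetric] by blast
qed

text \<open>
  From the exponent \<open>i + 1\<close> on, the powers of \<open>x\<close> are periodic with period \<open>j - i\<close>. So a power whose
  exponent is at least \<open>i + 1\<close> and a multiple of the period is idempotent.
\<close>

lemma idempotent_power:
  assumes ij: "i < j" and eq: "\<And>x. x \<in> carrier R \<Longrightarrow> pw x i = pw x j" and x: "x \<in> carrier R"
  shows "pw x (Suc i * (j - i) - 1) \<otimes> pw x (Suc i * (j - i) - 1) = pw x (Suc i * (j - i) - 1)"
proof -
  define p where "p = j - i"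
  have p: "j = i + p" "p \<ge> 1" using ij by (auto simp: p_def)
  have shift: "pw x (k + p) = pw x k" if "i \<le> k" for k
  proof (cases "k = i")
    case True
    then show ?thesis using eq[OF x] p by simp
  next
    case False
    then obtain l where l: "k = Suc (i + l)" using \<open>i \<le> k\<close> by (metis le_neq_implies_less less_iff_Suc_add)
    have "pw x (k + p) = pw x j \<otimes> pw x l" using pw_mult[OF x, of j l] by (simp add: l p(1) ac_simps)
    also have "\<dots> = pw x k" using pw_mult[OF x, of i l] eq[OF x] by (simp add: l)
    finally show ?thesis .
  qed
  have shifts: "pw x (k + m * p) = pw x k" if "i \<le> k" for k m
  proof (induction m)
    case (Suc m)
    then show ?case using shift[of "k + m * p"] that by (simp add: ac_simps)
  qed simp
  define N where "N = Suc i * p - 1"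
  have N: "Suc N = Suc i * p" using p by (simp add: N_def)
  have "Suc i \<le> Suc i * p" using p by (metis mult_le_mono2 mult.right_neutral)
  then have "i \<le> N" using N by simp
  have "pw x N \<otimes> pw x N = pw x (N + Suc N)" using pw_mult[OF x, of N N] by simp
  also have "\<dots> = pw x N" unfolding N by (rule shifts[OF \<open>i \<le> N\<close>])
  finally show ?thesis by (simp add: N_def p_def)
qed

end

context ring_model begin

text \<open>
  The infinitely many formulas \<open>y = x ^ k\<close> have only two variables, so that two of them are equivalent.
\<close>

lemma power_identity:
  assumes cL: "countable_language L" and oc: "omega_categorical L R"
  obtains i j where "i < j" "\<And>x. x \<in> carrier A \<Longrightarrow> pw x i = pw x j"
proof -
  define t :: "nat \<Rightarrow> 'f ring_sym tm" where
    "t = rec_nat (Var 0) (\<lambda>_ s. Fun Times [s, Var 0])"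
  have t: "t 0 = Var 0" "t (Suc k) = Fun Times [t k, Var 0]" for k by (simp_all add: t_def)
  have tL: "term_of L (t k)" for k by (induction k) (simp_all add: t del: term_of.simps(2))
  have tv: "tvars (t k) = {0}" for k by (induction k) (simp_all add: t)
  have tval: "tval R \<sigma> (t k) = pw (\<sigma> 0) k" for \<sigma> k
    by (induction k) (simp_all add: t terms del: tval.simps(2))
  obtain i j where ij: "i < j"
    and eq: "\<And>\<tau>. \<forall>v. \<tau> v \<in> Dom R \<Longrightarrow> sat R \<tau> (Eq (Var 1) (t i)) = sat R \<tau> (Eq (Var 1) (t j))"
    by (rule formula_pigeonhole[OF cL str oc, where \<phi> = "\<lambda>k. Eq (Var 1) (t k)" and n = 2])
      (use tL tv in auto)
  have "pw x i = pw x j" if x: "x \<in> carrier A" for x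
  proof -
    have "\<forall>v. ((\<lambda>_. x)(1 := pw x i)) v \<in> Dom R" using x pw_closed[OF x] by (simp add: carrier_A)
    from eq[OF this] show ?thesis by (simp add: tval)
  qed
  then show thesis using that ij by blast
qed

lemma definable_sums: "definable L R D \<Longrightarrow> definable L R (sums_of_length A D l)"
  by (induction l) (auto intro: definable_zero definable_sum)

text \<open>
  The ideal \<open>S\<close> consists of the sums of elements that generate an ideal of square zero modulo \<open>Q\<close>. It is
  definable as a union of definable sets, and it is nilpotent because its image in the quotient is. By
  the maximality of \<open>Q\<close>, it is \<open>Q\<close>.
\<close>

theorem nilpotent_by_finite_reduct:
  assumes cL: "countable_language L" and oc: "omega_categorical L R" and ntp: "NTP2 L R"
  shows "nilpotent_by_finite A"
proof -
  define \<Q> where "\<Q> = {Q. definable L R Q \<and> two_sided_ideal A Q \<and> nilpotent_subset A Q}"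
  have "finite \<Q>" by (rule finite_subset[OF _ finite_definable[OF cL str oc]]) (auto simp: \<Q>_def)
  moreover have "nilpotent_subset A {\<zero>\<^bsub>A\<^esub>}"
    unfolding nilpotent_subset_def by (intro exI[of _ 1]) (auto simp: length_Suc_conv)
  then have "{\<zero>\<^bsub>A\<^esub>} \<in> \<Q>" using definable_zero zero_ideal by (simp add: \<Q>_def)
  ultimately obtain Q where Q: "Q \<in> \<Q>" and Q_max: "\<And>Q'. Q' \<in> \<Q> \<Longrightarrow> Q \<subseteq> Q' \<Longrightarrow> Q = Q'"
    using finite_has_maximal[of \<Q>] by blast
  have Qd: "definable L R Q" and QI: "two_sided_ideal A Q" and Qn: "nilpotent_subset A Q"
    using Q by (auto simp: \<Q>_def)
  note I = ideal_facts[OF QI]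
  define B where "B = quotient Q"
  interpret B: rng B unfolding B_def by (rule quotient_rng[OF QI])
  note q = quotient_facts[OF QI, folded B_def] and q0 = coset_zero_iff[OF QI, folded B_def]
  obtain n where n: "\<forall>u v x. \<not> separating_array A Q n u v x"
    using bounded_arrays[OF cL oc ntp Qd I(1)] by blast
  have nB: "\<forall>u v x. \<not> separating_array B {\<zero>\<^bsub>B\<^esub>} n u v x"
  proof (intro allI notI)
    fix u v x assume "separating_array B {\<zero>\<^bsub>B\<^esub>} n u v x"
    then show False using separating_array_quotient[OF QI, folded B_def] n by blast
  qed
  \<comment> \<open>The square-zero ideals of the quotient generate a nilpotent ideal, so there are none.\<close>
  define S where "S = additive_span A (square_zero A Q)"
  have SI: "two_sided_ideal A S" unfolding S_def by (rule additive_span_square_zero_ideal[OF QI])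
  have SR: "S \<subseteq> carrier A" using ideal_facts[OF SI] by simp
  have "definable L R (square_zero A Q)" unfolding square_zero_def by (rule definable_square_zero[OF Qd])
  then have Sd: "definable L R S"
    unfolding S_def additive_span_def
    by (intro definable_UN finite_definable[OF cL str oc] str definable_sums)
  have square_zero_S: "square_zero A Q \<subseteq> S"
  proof
    fix c assume c: "c \<in> square_zero A Q"
    then have "c \<in> carrier A" using square_zero_closed by blast
    then have "\<zero>\<^bsub>A\<^esub> \<oplus>\<^bsub>A\<^esub> c = c" by (rule l_zero)
    then show "c \<in> S" unfolding S_def
      using additive_span_add[OF additive_span_zero[of A "square_zero A Q"] c] by simp
  qed
  have QS: "Q \<subseteq> S"
  proof
    fix c assume "c \<in> Q"
    then have "c \<in> square_zero A Q" using I m_closed by (auto simp: square_zero_def)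
    then show "c \<in> S" using square_zero_S by blast
  qed
  have S_image: "coset Q z \<in> additive_span B (square_zero B {\<zero>\<^bsub>B\<^esub>})" if "z \<in> S" for z
    using that unfolding S_def
  proof (induction rule: additive_span_induct)
    case zero
    then show ?case using additive_span_zero[of B] q(2) by simp
  next
    case (add d e)
    have eR: "e \<in> carrier A" "d \<in> carrier A"
      using add.hyps square_zero_closed SR by (auto simp: S_def)
    have "coset Q e \<in> square_zero B {\<zero>\<^bsub>B\<^esub>}"
      unfolding square_zero_def using add.hyps(2) eR(1) q0 m_closed by (auto simp: q(1) q(4)[symmetric] square_zero_def)
    then show ?case using additive_span_add[OF add.IH] q(3)[OF eR(2,1)] by simp
  qed
  obtain K where K: "K \<ge> 1" "\<And>xs. length xs = K \<Longrightarrow> set xs \<subseteq> additive_span B (square_zero B {\<zero>\<^bsub>B\<^esub>}) \<Longrightarrow> mprod B xs = \<zero>\<^bsub>B\<^esub>"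
    using B.additive_span_square_zero_nilpotent[OF nB] unfolding nilpotent_subset_def mprod_def by blast
  have "nilpotent_subset A S"
  proof (rule nilpotent_extension[OF SR I(2) Qn K(1)])
    fix xs assume xs: "length xs = K" "set xs \<subseteq> S"
    then have ne: "xs \<noteq> []" using K(1) by auto
    have xR: "set xs \<subseteq> carrier A" using xs SR by auto
    have "mprod B (map (coset Q) xs) = \<zero>\<^bsub>B\<^esub>" using xs S_image by (intro K(2)) auto
    then show "mprod A xs \<in> Q"
      using coset_mprod[OF QI ne xR] q0[OF mprod_closed[OF ne xR]] by (simp add: B_def)
  qed
  then have "S \<in> \<Q>" using Sd SI by (simp add: \<Q>_def)
  then have "S = Q" using Q_max QS by blast
  then have square_zero_Q: "c \<in> Q" if "c \<in> square_zero A Q" for c using that square_zero_S by blast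
  obtain i j where ij: "i < j" "\<And>x. x \<in> carrier A \<Longrightarrow> pw x i = pw x j"
    using power_identity[OF cL oc] by blast
  define N where "N = Suc i * (j - i) - 1"
  interpret B: semiprime_bounded B N n
  proof unfold_locales
    fix c assume c: "c \<in> carrier B" and cxc: "\<And>x. x \<in> carrier B \<Longrightarrow> c \<otimes>\<^bsub>B\<^esub> x \<otimes>\<^bsub>B\<^esub> c = \<zero>\<^bsub>B\<^esub>"
    obtain a where a: "a \<in> carrier A" "c = coset Q a" using c q(1) by auto
    have axa: "a \<otimes>\<^bsub>A\<^esub> x \<otimes>\<^bsub>A\<^esub> a \<in> Q" if x: "x \<in> carrier A" for x
      using cxc[of "coset Q x"] a x q0[of "a \<otimes>\<^bsub>A\<^esub> x \<otimes>\<^bsub>A\<^esub> a"] m_closed by (auto simp: q(1) q(4))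
    \<comment> \<open>The definition of \<open>square_zero\<close> also demands \<open>a a \<in> Q\<close>, which is shown first.\<close>
    define d where "d = a \<otimes>\<^bsub>A\<^esub> a"
    have dR: "d \<in> carrier A" using a m_closed by (simp add: d_def)
    have "d \<otimes>\<^bsub>A\<^esub> d \<in> Q"
      using axa[OF dR] a by (simp add: d_def m_assoc m_closed)
    moreover have "d \<otimes>\<^bsub>A\<^esub> x \<otimes>\<^bsub>A\<^esub> d \<in> Q" if x: "x \<in> carrier A" for x
      using axa[of "a \<otimes>\<^bsub>A\<^esub> x \<otimes>\<^bsub>A\<^esub> a"] a x by (simp add: d_def m_assoc m_closed)
    ultimately have "d \<in> Q" using dR by (intro square_zero_Q) (simp add: square_zero_def)
    then have "a \<in> Q" using a axa by (intro square_zero_Q) (simp add: square_zero_def d_def)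
    then show "c = \<zero>\<^bsub>B\<^esub>" using a q0 by simp
  next
    fix c assume "c \<in> carrier B"
    then obtain a where a: "a \<in> carrier A" "c = coset Q a" using q(1) by auto
    have "B.pw c N = coset Q (pw a N)" using coset_pw[OF QI a(1)] a(2) by (simp add: B_def)
    moreover have "pw a N \<otimes>\<^bsub>A\<^esub> pw a N = pw a N" unfolding N_def by (rule idempotent_power[OF ij a(1)])
    ultimately show "B.pw c N \<otimes>\<^bsub>B\<^esub> B.pw c N = B.pw c N" using a(1) by (simp add: q(4)[symmetric])
  qed (rule nB)
  have fin: "finite (coset Q ` carrier A)" using B.finite_carrier q(1) by simp
  have "a_rcosets\<^bsub>A\<^esub> Q = coset Q ` carrier A"
  proof -
    have "Q +>\<^bsub>A\<^esub> x = coset Q x" if x: "x \<in> carrier A" for x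
    proof (intro equalityI subsetI)
      fix y assume "y \<in> Q +>\<^bsub>A\<^esub> x"
      then obtain p where p: "p \<in> Q" "y = p \<oplus>\<^bsub>A\<^esub> x" by (auto simp: a_r_coset_def')
      then have pR: "p \<in> carrier A" using I(2) by auto
      have "p \<oplus>\<^bsub>A\<^esub> x \<ominus>\<^bsub>A\<^esub> x = p" using pR x by algebra
      then show "y \<in> coset Q x" using p pR x by (simp add: coset_def)
    next
      fix y assume "y \<in> coset Q x"
      then have y: "y \<in> carrier A" "y \<ominus>\<^bsub>A\<^esub> x \<in> Q" by (auto simp: coset_def)
      have "y = (y \<ominus>\<^bsub>A\<^esub> x) \<oplus>\<^bsub>A\<^esub> x" using x y(1) by algebra
      then show "y \<in> Q +>\<^bsub>A\<^esub> x" using y(2) by (auto simp: a_r_coset_def')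
    qed
    then show ?thesis by (auto simp: A_RCOSETS_def')
  qed
  then show ?thesis unfolding nilpotent_by_finite_def using QI Qn fin by (intro exI[of _ Q]) simp
qed

end

theorem theorem8p3:
  fixes L :: "('f ring_sym, 'r) language"
    and R :: "('a, 'f ring_sym, 'r) fo_structure"
  assumes "countable_language L"
    and "ring_structure L R"
    and "omega_categorical L R"
    and "NTP2 L R"
  shows "nilpotent_by_finite (ring_reduct R)"
proof -
  interpret ring_model L R by unfold_locales (rule assms(2))
  show ?thesis using nilpotent_by_finite_reduct[OF assms(1,3,4)] .
qed

end
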